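(* Let $q\in\mathbb{C}\setminus\{0\}$ with $|q|\neq 1$, and let $a_0(z),\ldots,a_{n+1}(z)$ be meromorphic functions of finite $\varphi$-order with $a_0a_n\not\equiv0$, at least one of which is non-constant. Put $\rho_\varphi=\max_{0\le j\le n+1}\rho_\varphi(a_j)$. Suppose $s$ is convex and differentiable with $$\limsup_{r\to\infty}\frac{r^2s'(r)}{s(r)^2}<\infty,$$ and that $\varphi$ is subadditive and differentiable and that one of the following holds: $$\limsup_{r\to\infty}\frac{\varphi'(s(r))s'(r)r}{\varphi(s(r))}<\frac1\lambda\quad\text{or}\quad \liminf_{r\to\infty}\frac{\varphi'(s(r))s'(r)r}{\varphi(s(r))}\ge\frac1\lambda,$$ where $\lambda$ is the $\varphi$-exponent of convergence of the zeros of $a_0$ (with $1/0=\infty$). Suppose $\alpha_{\varphi,s}>0$. If $f$ is a meromorphic solution of $$\sum_{j=0}^n a_j(z)f(q^jz)=a_{n+1}(z),$$ then $$\rho_\varphi(f)\le\frac{\rho_\varphi}{\alpha_{\varphi,s}^2}-\frac{\gamma_{\varphi,s}}{\alpha_{\varphi,s}}+2\beta_\varphi.$$ If all of $a_0,\ldots,a_{n+1}$ are constants, then every meromorphic solution $f$ satisfies $\rho_\varphi(f)\le\beta_\varphi$.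
   Context: Let $R_0>0$. Throughout, $\varphi:(R_0,\infty)\to(0,\infty)$ is a non-decreasing unbounded function with $\log r\le\varphi(r)\le r$ for $r\ge R_0$. For a non-decreasing function $T$ with positive values, its $\varphi$-order is $\rho_\varphi(T)=\limsup_{r\to\infty}\frac{\log T(r)}{\log\varphi(r)}$; for a meromorphic function $f$ in $\mathbb{C}$, $\rho_\varphi(f)=\rho_\varphi(T(r,f))$ where $T(r,f)$ is the Nevanlinna characteristic. $\varphi$ is subadditive if $\varphi(a+b)\le\varphi(a)+\varphi(b)$ for all $a,b\ge R_0$. The function $s:(R_0,\infty)\to(0,\infty)$ is non-decreasing with $r<s(r)\le r^2$ for $r\ge R_0$ and $\liminf_{r\to\infty}s(r)/r>1$. Standing assumption: every meromorphic function of finite $\varphi$-order considered has classical order $\rho(f)<1$. Define $$\alpha_{\varphi,s}=\liminf_{r\to\infty}\frac{\log\varphi(r)}{\log\varphi(s(r))},\quad \beta_\varphi=\limsup_{r\to\infty}\frac{\log\log r}{\log\varphi(r)},\quad \gamma_{\varphi,s}=\liminf_{r\to\infty}\frac{\log\log\frac{s(r)}{r}}{\log\varphi(r)}.$$ The $\varphi$-exponent of convergence of a sequence $\{z_n\}$ with $|z_n|\to\infty$ is $\lambda_\varphi=\inf\{\mu>0:\sum_n\varphi(|z_n|)^{-\mu}<\infty\}$, and $\lambda_\varphi=\infty$ if the sum diverges for all $\mu>0$ (for a finite sequence it is $0$). *)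

theory Defs
  imports "HOL-Complex_Analysis.Complex_Analysis" "HOL-Library.Extended_Real"
    "HOL-Library.Liminf_Limsup"
begin

text \<open>Meromorphic functions on the whole plane are represented by their canonical
  representative: nicely meromorphic on UNIV (removable singularities filled in,
  value 0 at poles).\<close>

definition ln_plus :: "real \<Rightarrow> real" where
  "ln_plus x = (if x \<le> 1 then 0 else ln x)"

definition pole_count :: "(complex \<Rightarrow> complex) \<Rightarrow> real \<Rightarrow> real" where
  "pole_count f t = (\<Sum>p\<in>{p. is_pole f p \<and> norm p \<le> t}. real_of_int (- zorder f p))"

definition nev_N :: "(complex \<Rightarrow> complex) \<Rightarrow> real \<Rightarrow> real" where
  "nev_N f r = integral {0..r} (\<lambda>t. (pole_count f t - pole_count f 0) / t)
              + pole_count f 0 * ln r"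

definition nev_m :: "(complex \<Rightarrow> complex) \<Rightarrow> real \<Rightarrow> real" where
  "nev_m f r = (1 / (2 * pi)) *
     integral {0..2*pi} (\<lambda>\<theta>. ln_plus (norm (f (complex_of_real r * exp (\<i> * complex_of_real \<theta>)))))"

definition nev_T :: "(complex \<Rightarrow> complex) \<Rightarrow> real \<Rightarrow> real" where
  "nev_T f r = nev_m f r + nev_N f r"

definition phi_order_fun :: "(real \<Rightarrow> real) \<Rightarrow> (real \<Rightarrow> real) \<Rightarrow> ereal" where
  "phi_order_fun \<phi> T = Limsup at_top (\<lambda>r. ereal (ln (T r) / ln (\<phi> r)))"

definition phi_order :: "(real \<Rightarrow> real) \<Rightarrow> (complex \<Rightarrow> complex) \<Rightarrow> ereal" where
  "phi_order \<phi> f = phi_order_fun \<phi> (nev_T f)"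

definition mero_order :: "(complex \<Rightarrow> complex) \<Rightarrow> ereal" where
  "mero_order f = Limsup at_top (\<lambda>r. ereal (ln (nev_T f r) / ln r))"

text \<open>phi-exponent of convergence of a sequence of points given as a set Z with
  multiplicities m (each z in Z listed m z times).  Inf of the empty set is infinity;
  for a finite sequence the value is 0.\<close>
definition phi_exp_conv :: "(real \<Rightarrow> real) \<Rightarrow> complex set \<Rightarrow> (complex \<Rightarrow> nat) \<Rightarrow> ereal" where
  "phi_exp_conv \<phi> Z m = Inf (ereal ` {\<mu>::real. \<mu> > 0 \<and>
      (\<lambda>z. real (m z) * \<phi> (norm z) powr (-\<mu>)) summable_on Z})"

definition mero_zeros :: "(complex \<Rightarrow> complex) \<Rightarrow> complex set" where
  "mero_zeros f = {z. f z = 0 \<and> \<not> is_pole f z}"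

definition zero_exp_conv :: "(real \<Rightarrow> real) \<Rightarrow> (complex \<Rightarrow> complex) \<Rightarrow> ereal" where
  "zero_exp_conv \<phi> f = phi_exp_conv \<phi> (mero_zeros f) (\<lambda>z. nat (zorder f z))"

definition alpha_phi_s :: "(real \<Rightarrow> real) \<Rightarrow> (real \<Rightarrow> real) \<Rightarrow> ereal" where
  "alpha_phi_s \<phi> s = Liminf at_top (\<lambda>r. ereal (ln (\<phi> r) / ln (\<phi> (s r))))"

definition beta_phi :: "(real \<Rightarrow> real) \<Rightarrow> ereal" where
  "beta_phi \<phi> = Limsup at_top (\<lambda>r. ereal (ln (ln r) / ln (\<phi> r)))"

definition gamma_phi_s :: "(real \<Rightarrow> real) \<Rightarrow> (real \<Rightarrow> real) \<Rightarrow> ereal" where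
  "gamma_phi_s \<phi> s = Liminf at_top (\<lambda>r. ereal (ln (ln (s r / r)) / ln (\<phi> r)))"

end

theory Submission
  imports Defs
begin

text \<open>
  The equation is unwound towards the origin. If \<open>|q| > 1\<close>, substituting \<open>q\<^sup>-\<^sup>n z\<close> reverses the roles of
  the coefficients, so one may assume that the dilation factor \<open>p\<close> satisfies \<open>|p| < 1\<close>. Solving
  for the undilated term gives, at almost every \<open>z\<close>,
  \<open>log\<^sup>+ |f(z)| \<le> v(z) + max\<^sub>j log\<^sup>+ |f(p\<^sup>j z)|\<close> with \<open>v\<close> built from \<open>log\<^sup>+\<close> of the coefficients and of
  \<open>1/a\<^sub>0\<close>; pole multiplicities of \<open>f\<close> obey the same recurrence. Because a maximum rather than a sum
  appears, iterating \<open>O(log r)\<close> times until \<open>p\<^sup>k z\<close> lies in a fixed punctured disc about \<open>0\<close> without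
  poles of \<open>f\<close> gives \<open>log\<^sup>+ |f(z)| \<le> (\<Sum>k. v(p\<^sup>k z)) + O(1)\<close>. Averaging over circles and using
  \<open>T(r, 1/a\<^sub>0) \<le> T(r, a\<^sub>0) + O(1)\<close> yields \<open>T(r, f) = O(log r \<sqdot> \<Psi>(r))\<close> whenever a non-decreasing
  \<open>\<Psi> \<ge> 1\<close> majorises all \<open>T(r, a\<^sub>j)\<close>. Hence \<open>\<rho>\<^sub>\<phi>(f) \<le> \<rho>\<^sub>\<phi> + \<beta>\<close>, and \<open>\<rho>\<^sub>\<phi>(f) \<le> \<beta>\<close> for constant
  coefficients. The stated bound is weaker since \<open>0 < \<alpha> \<le> 1\<close>, \<open>\<rho>\<^sub>\<phi> \<ge> 0\<close> and \<open>\<gamma> \<le> \<alpha> \<beta>\<close>.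
\<close>

section \<open>Mean values on circles\<close>

text \<open>Bounding the undilated term by the sum of log+ over all n dilated terms could multiply
  the estimate by n at each step, and O(log r) steps would then cost a power of r. With a maximum,
  each step adds a single term v, so the total cost is one factor log r, and this factor is the
  source of \<beta>. The origin may itself be a pole of f, so the iteration cannot run down to 0. It
  stops in the annulus |p|^n \<delta> \<le> |z| < \<delta>, which no orbit can jump over because one
  application of the equation shrinks the modulus by a factor of at least |p|^n. The equation holds
  only off a sparse set; on a circle of radius r only finitely many points have an orbit that meets
  this set before the stop, so circle means are not affected. The coefficients are averaged over the
  circles of radius |c p^k| r, and monotonicity of \<Psi> replaces all these radii by r. Here c =
  p^n is what the reversal leaves behind when |q| > 1, and c = 1 otherwise. For non-constant
  coefficients \<Psi> is a power of \<phi> with exponent above the maximal order; for constant ones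
  it is a constant.\<close>

definition circ :: "real \<Rightarrow> real \<Rightarrow> complex" where
  "circ r \<theta> = complex_of_real r * exp (\<i> * complex_of_real \<theta>)"

definition circle_mean :: "(complex \<Rightarrow> real) \<Rightarrow> real \<Rightarrow> real" where
  "circle_mean u r = (1 / (2 * pi)) * integral {0..2*pi} (\<lambda>\<theta>. u (circ r \<theta>))"

text \<open>Absolute integrability is demanded because gauge integrability alone is not preserved by
  absolute values, and \<open>ln_plus x\<close> is treated below as half of
  \<open>ln x + \<bar>ln x\<bar>\<close>.\<close>

definition circle_integrable :: "(complex \<Rightarrow> real) \<Rightarrow> real \<Rightarrow> bool" where
  "circle_integrable u r \<longleftrightarrow> (\<lambda>\<theta>. u (circ r \<theta>)) absolutely_integrable_on {0..2*pi}"

lemma norm_circ [simp]: "norm (circ r \<theta>) = \<bar>r\<bar>"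
  by (simp add: circ_def norm_mult)

lemma circ_plus: "circ r (\<theta> + c) = circ r \<theta> * exp (\<i> * complex_of_real c)"
  by (simp add: circ_def distrib_left exp_add)

lemma circ_plus_2pi [simp]: "circ r (\<theta> + 2 * pi) = circ r \<theta>"
  using exp_two_pi_i by (simp add: circ_plus mult_ac)

lemma continuous_on_circ [continuous_intros]: "continuous_on A (circ r)"
  unfolding circ_def by (intro continuous_intros)

lemma sincos_eq_2pi:
  assumes "sin x = sin y \<and> cos x = cos y" "0 \<le> x" "x < 2*pi" "0 \<le> y" "y < 2*pi"
  shows "x = y"
proof -
  have "sin y = sin x \<and> cos y = cos x" using assms(1) by simp
  then obtain n where "y = x + 2 * pi * of_int n"
    using sin_cos_eq_iff by blast
  then have "\<bar>2 * pi * of_int n\<bar> < 2 * pi * 1"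
    using assms by linarith
  then have "\<bar>of_int n :: real\<bar> < 1"
    by (simp add: abs_mult)
  then have "n = 0" by linarith
  then show ?thesis using \<open>y = _\<close> by simp
qed

text \<open>Finitely many exceptional points on a circle thus become a negligible set of angles.
  Both endpoints of the interval give the same point, so injectivity is used on the half-open
  interval only.\<close>

lemma finite_circ_preimage:
  assumes "r \<noteq> 0" "finite S"
  shows "finite {\<theta>\<in>{0..2*pi}. circ r \<theta> \<in> S}"
proof -
  have "finite {\<theta>\<in>{0..<2*pi}. circ r \<theta> \<in> S}"
  proof (rule inj_on_finite[of "circ r" _ S])
    show "inj_on (circ r) {\<theta> \<in> {0..<2*pi}. circ r \<theta> \<in> S}"
    proof (rule inj_onI)
      fix x y assume xy: "x \<in> {\<theta> \<in> {0..<2*pi}. circ r \<theta> \<in> S}"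
        "y \<in> {\<theta> \<in> {0..<2*pi}. circ r \<theta> \<in> S}" "circ r x = circ r y"
      then have "cis x = cis y"
        using assms by (simp add: circ_def cis_conv_exp)
      then have "sin x = sin y \<and> cos x = cos y"
        by (simp add: complex_eq_iff)
      then show "x = y"
        using xy by (intro sincos_eq_2pi) simp_all
    qed
  qed (use assms in auto)
  moreover have "{\<theta>\<in>{0..2*pi}. circ r \<theta> \<in> S} \<subseteq> insert (2*pi) {\<theta>\<in>{0..<2*pi}. circ r \<theta> \<in> S}"
    by auto
  ultimately show ?thesis
    by (meson finite.insertI finite_subset)
qed

lemma circle_mean_holomorphic:
  fixes f :: "complex \<Rightarrow> complex"
  assumes "f holomorphic_on ball 0 R" "0 < r" "r < R"
  shows "((\<lambda>\<theta>. f (circ r \<theta>)) has_integral (2 * pi * f 0)) {0..2*pi}"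
proof -
  have "((\<lambda>u. f u / (u - 0)) has_contour_integral 2 * of_real pi * \<i> * f 0) (circlepath 0 r)"
    using assms
    by (intro Cauchy_integral_circlepath)
       (auto intro!: holomorphic_on_imp_continuous_on elim!: holomorphic_on_subset)
  then have "((\<lambda>\<theta>. (f (circ r \<theta>) / circ r \<theta>) * r * \<i> * exp (\<i> * \<theta>))
      has_integral (2 * of_real pi * \<i> * f 0)) {0..2*pi}"
    unfolding circlepath_def
    by (subst (asm) has_contour_integral_part_circlepath_iff) (auto simp: circ_def cis_conv_exp)
  then have "((\<lambda>\<theta>. \<i> * f (circ r \<theta>)) has_integral (\<i> * (2 * of_real pi * f 0))) {0..2*pi}"
    using assms by (simp add: circ_def mult_ac)
  from has_integral_mult_right[OF this, of "-\<i>"] show ?thesis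
    by (simp add: mult.assoc[symmetric])
qed

lemma circle_mean_Re_holomorphic:
  assumes "f holomorphic_on ball 0 R" "0 < r" "r < R"
  shows "((\<lambda>\<theta>. Re (f (circ r \<theta>))) has_integral (2 * pi * Re (f 0))) {0..2*pi}"
  using has_integral_Re[OF circle_mean_holomorphic[OF assms]] by simp

text \<open>On a ball a nonvanishing \<open>g\<close> has a holomorphic logarithm \<open>h\<close>,
  and ln |g| = Re h has the mean value property.\<close>

lemma circle_mean_ln_nonvanishing:
  assumes "g holomorphic_on ball 0 R" "\<And>z. z \<in> ball 0 R \<Longrightarrow> g z \<noteq> 0" "0 < r" "r < R"
  shows "((\<lambda>\<theta>. ln (norm (g (circ r \<theta>)))) has_integral (2 * pi * ln (norm (g 0)))) {0..2*pi}"
proof -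
  obtain h where h: "h holomorphic_on ball 0 R" "\<And>z. z \<in> ball 0 R \<Longrightarrow> g z = exp (h z)"
    using contractible_imp_holomorphic_log[OF assms(1)] assms(2)
    by (metis convex_ball convex_imp_contractible)
  have "ln (norm (g z)) = Re (h z)" if "norm z < R" for z
    using h(2)[of z] that by simp
  then show ?thesis
    using circle_mean_Re_holomorphic[OF h(1) assms(3,4)] assms(3,4) by simp
qed

lemma has_integral_ln_one_minus_lt:
  assumes "norm w < 1"
  shows "((\<lambda>\<theta>. ln (norm (1 - w * circ 1 \<theta>))) has_integral 0) {0..2*pi}"
proof (cases "w = 0")
  case False
  have "((\<lambda>\<theta>. ln (norm (1 - w * circ 1 \<theta>))) has_integral (2 * pi * ln (norm (1 - w * 0)))) {0..2*pi}"
  \<comment> \<open>The function 1 - w z vanishes only at 1/w, outside the open disc of radius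
    1/|w|; this disc contains the unit circle since |w| < 1.\<close>
  proof (rule circle_mean_ln_nonvanishing[where R = "1 / norm w"])
    fix z :: complex assume "z \<in> ball 0 (1 / norm w)"
    then have "norm (w * z) < 1"
      using False by (simp add: norm_mult field_simps)
    then show "1 - w * z \<noteq> 0"
      by auto
  qed (use assms False in \<open>auto intro!: holomorphic_intros\<close>)
  then show ?thesis by simp
qed auto

text \<open>Dividing by \<open>1 + x\<close> makes \<open>|1 - x u|\<close> monotone in \<open>x\<close>, so that the case of a zero on the
  circle follows from the interior case by monotone convergence.\<close>

lemma norm_one_minus_div_decreasing:
  fixes u :: complex
  assumes "norm u = 1" "0 \<le> x" "x \<le> y" "y \<le> 1"
  shows "norm (1 - of_real y * u) / (1 + y) \<le> norm (1 - of_real x * u) / (1 + x)"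
proof -
  \<comment> \<open>After division by (1 + x)^2 the variable x occurs only through x / (1 + x)^2,
    which increases on [0, 1].\<close>
  have n: "(norm (1 - of_real x * u))\<^sup>2 = (1 + x)\<^sup>2 - 2 * x * (1 + Re u)" for x
  proof -
    have "(Re u)\<^sup>2 + (Im u)\<^sup>2 = 1"
      using assms(1) by (simp add: norm_complex_def)
    moreover have "(norm (1 - of_real x * u))\<^sup>2 = 1 - 2 * x * Re u + x\<^sup>2 * ((Re u)\<^sup>2 + (Im u)\<^sup>2)"
      unfolding cmod_power2 by (simp add: power2_eq_square algebra_simps)
    ultimately show ?thesis
      by (simp add: power2_eq_square algebra_simps)
  qed
  have "x * (1 + y)\<^sup>2 \<le> y * (1 + x)\<^sup>2"
  proof -
    have "y * (1 + x)\<^sup>2 - x * (1 + y)\<^sup>2 = (y - x) * (1 - x * y)"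
      by (simp add: power2_eq_square algebra_simps)
    also have "\<dots> \<ge> 0"
      using assms by (intro mult_nonneg_nonneg) (auto intro: mult_le_one)
    finally show ?thesis by simp
  qed
  then have le: "x / (1 + x)\<^sup>2 \<le> y / (1 + y)\<^sup>2"
    using assms by (simp add: divide_simps)
  have Re: "0 \<le> 1 + Re u"
    using abs_Re_le_cmod[of u] assms(1) by linarith
  have "(norm (1 - of_real y * u) / (1 + y))\<^sup>2 = 1 - 2 * (y / (1 + y)\<^sup>2) * (1 + Re u)"
    using assms by (simp add: power_divide n diff_divide_distrib)
  also have "\<dots> \<le> 1 - 2 * (x / (1 + x)\<^sup>2) * (1 + Re u)"
    using mult_right_mono[OF le Re] by linarith
  also have "\<dots> = (norm (1 - of_real x * u) / (1 + x))\<^sup>2"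
    using assms by (simp add: power_divide n diff_divide_distrib)
  finally show ?thesis
    using assms by (simp add: power2_le_iff_abs_le)
qed

lemma norm_one_minus_le_2: "norm (w::complex) \<le> 1 \<Longrightarrow> norm (1 - w) \<le> 2"
  using norm_triangle_ineq4[of 1 w] by simp

lemma has_integral_ln_one_minus:
  assumes "norm w \<le> 1"
  shows "((\<lambda>\<theta>. ln (norm (1 - w * circ 1 \<theta>))) has_integral 0) {0..2*pi}"
proof (cases "norm w = 1")
  case False
  then show ?thesis using assms by (intro has_integral_ln_one_minus_lt) auto
next
  case True
  define N where "N = {\<theta>\<in>{0..2*pi}. circ 1 \<theta> \<in> {inverse w}}"
  have fin: "finite N"
    unfolding N_def by (intro finite_circ_preimage) auto
  define x where "x = (\<lambda>k. 1 - inverse (real (Suc k)))"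
  have x: "0 \<le> x k" "x k < 1" "x k \<le> x (Suc k)" for k
    by (auto simp: x_def divide_simps) (auto simp: algebra_simps)
  have xlim: "x \<longlonglongrightarrow> 1"
    unfolding x_def using tendsto_diff[OF tendsto_const LIMSEQ_inverse_real_of_nat, of 1] by simp
  \<comment> \<open>Up to sign this is the logarithm of the quotient that decreases in x, so
    \<open>h k\<close> increases with k. On \<open>N\<close> the values would tend to infinity,
    whereas \<open>ln 0 = 0\<close>; they are reset to 0 there, on finitely many angles.\<close>
  define h where "h = (\<lambda>k \<theta>. if \<theta> \<in> N then 0 else
     ln (1 + x k) - ln (norm (1 - of_real (x k) * w * circ 1 \<theta>)))"
  define H where "H = (\<lambda>\<theta>. if \<theta> \<in> N then 0 else ln 2 - ln (norm (1 - w * circ 1 \<theta>)))"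
  have h_int: "(h k has_integral (2 * pi * ln (1 + x k))) {0..2*pi}" for k
  proof -
    have nw: "norm (of_real (x k) * w) < 1"
      using x[of k] True by (simp add: norm_mult)
    have "((\<lambda>\<theta>. ln (1 + x k) - ln (norm (1 - of_real (x k) * w * circ 1 \<theta>)))
       has_integral (2 * pi * ln (1 + x k) - 0)) {0..2*pi}"
      using has_integral_const_real[of "ln (1 + x k)" 0 "2*pi"]
      by (intro has_integral_diff has_integral_ln_one_minus_lt nw) auto
    from this[unfolded diff_zero] show ?thesis
      by (rule has_integral_spike_finite[OF fin, rotated]) (auto simp: h_def)
  qed
  have ne: "1 - w * circ 1 \<theta> \<noteq> 0" if "\<theta> \<in> {0..2*pi}" "\<theta> \<notin> N" for \<theta>
  proof
    assume "1 - w * circ 1 \<theta> = 0"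
    then have "inverse w = circ 1 \<theta>" by (intro inverse_unique) simp
    then show False using that by (simp add: N_def)
  qed
  have ne': "1 - of_real (x k) * w * circ 1 \<theta> \<noteq> 0" for k \<theta>
  proof -
    have "norm (of_real (x k) * w * circ 1 \<theta>) < 1"
      using x[of k] True by (simp add: norm_mult)
    then show ?thesis by (metis eq_iff_diff_eq_0 norm_one order_less_irrefl)
  qed
  have conv: "H integrable_on {0..2*pi} \<and> (\<lambda>k. integral {0..2*pi} (h k)) \<longlonglongrightarrow> integral {0..2*pi} H"
  proof (rule monotone_convergence_increasing)
    show "h k integrable_on {0..2*pi}" for k using h_int by blast
  next
    fix k \<theta> assume "\<theta> \<in> {0..2*pi}"
    have "norm (1 - of_real (x (Suc k)) * (w * circ 1 \<theta>)) / (1 + x (Suc k))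
        \<le> norm (1 - of_real (x k) * (w * circ 1 \<theta>)) / (1 + x k)"
      using x[of k] x[of "Suc k"] True by (intro norm_one_minus_div_decreasing) (auto simp: norm_mult)
    moreover have "0 < norm (1 - of_real (x (Suc k)) * (w * circ 1 \<theta>)) / (1 + x (Suc k))"
      using ne'[of "Suc k" \<theta>] x[of "Suc k"] by (auto simp: mult.assoc)
    ultimately have "ln (norm (1 - of_real (x (Suc k)) * (w * circ 1 \<theta>)) / (1 + x (Suc k)))
        \<le> ln (norm (1 - of_real (x k) * (w * circ 1 \<theta>)) / (1 + x k))"
      by (intro ln_mono) auto
    then show "h k \<theta> \<le> h (Suc k) \<theta>"
      using x[of k] x[of "Suc k"] ne'[of k \<theta>] ne'[of "Suc k" \<theta>]
      by (auto simp: h_def ln_div mult.assoc)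
  next
    fix \<theta> assume th: "\<theta> \<in> {0..2*pi}"
    show "(\<lambda>k. h k \<theta>) \<longlonglongrightarrow> H \<theta>"
    proof (cases "\<theta> \<in> N")
      case False
      have "(\<lambda>k. ln (1 + x k) - ln (norm (1 - of_real (x k) * w * circ 1 \<theta>)))
         \<longlonglongrightarrow> ln (1 + 1) - ln (norm (1 - of_real 1 * w * circ 1 \<theta>))"
        using ne[OF th False] by (intro tendsto_intros xlim) auto
      then show ?thesis using False by (simp add: h_def H_def)
    qed (auto simp: h_def H_def)
  next
    have "integral {0..2*pi} (h k) \<in> {0..2 * pi * ln 2}" for k
      using x[of k] by (subst integral_unique[OF h_int]) (auto intro!: mult_left_mono ln_mono)
    then show "bounded (range (\<lambda>k. integral {0..2*pi} (h k)))"
      by (intro bounded_subset[OF bounded_closed_interval[of 0 "2*pi*ln 2"]]) auto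
  qed
  have "(\<lambda>k. integral {0..2*pi} (h k)) \<longlonglongrightarrow> 2 * pi * ln (1 + 1)"
    unfolding integral_unique[OF h_int] by (intro tendsto_intros xlim) auto
  with conv have "integral {0..2*pi} H = 2 * pi * ln 2"
    using LIMSEQ_unique by fastforce
  with conv have "(H has_integral (2 * pi * ln 2)) {0..2*pi}"
    using integrable_integral by fastforce
  from has_integral_diff[OF has_integral_const_real[of "ln 2" 0 "2*pi"] this]
  have "((\<lambda>\<theta>. ln 2 - H \<theta>) has_integral 0) {0..2*pi}"
    by simp
  then show ?thesis
    by (rule has_integral_spike_finite[OF fin, rotated]) (auto simp: H_def)
qed

text \<open>Since |1 - w u| \<le> 2, the difference of ln 2 and the integrand is non-negative with a
  known integral, hence absolutely integrable. Its size also controls the absolute value, by a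
  constant that does not depend on \<open>w\<close>.\<close>

lemma circle_ln_one_minus:
  assumes "norm w \<le> 1"
  shows "(\<lambda>\<theta>. ln (norm (1 - w * circ 1 \<theta>))) absolutely_integrable_on {0..2*pi}"
    and "integral {0..2*pi} (\<lambda>\<theta>. \<bar>ln (norm (1 - w * circ 1 \<theta>))\<bar>) \<le> 4 * pi * ln 2"
proof -
  let ?L = "\<lambda>\<theta>. ln (norm (1 - w * circ 1 \<theta>))"
  note I = has_integral_ln_one_minus[OF assms]
  have le: "?L \<theta> \<le> ln 2" for \<theta>
  proof (cases "1 - w * circ 1 \<theta> = 0")
    case False
    then show ?thesis
      using assms norm_one_minus_le_2[of "w * circ 1 \<theta>"] by (intro ln_mono) (auto simp: norm_mult)
  qed auto
  have D: "((\<lambda>\<theta>. ln 2 - ?L \<theta>) has_integral (2 * pi * ln 2)) {0..2*pi}"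
    using has_integral_diff[OF has_integral_const_real[of "ln 2" 0 "2*pi"] I] by simp
  have "(\<lambda>\<theta>. ln 2 - ?L \<theta>) absolutely_integrable_on {0..2*pi}"
    using D le by (intro nonnegative_absolutely_integrable_1) auto
  from set_integral_diff(1)[OF _ this, of "\<lambda>_. ln 2"]
  show A: "?L absolutely_integrable_on {0..2*pi}"
    by simp
  have "integral {0..2*pi} (\<lambda>\<theta>. \<bar>?L \<theta>\<bar>) \<le> integral {0..2*pi} (\<lambda>\<theta>. ln 2 + (ln 2 - ?L \<theta>))"
  proof (rule integral_le)
    show "(\<lambda>\<theta>. \<bar>?L \<theta>\<bar>) integrable_on {0..2*pi}"
      using A by (simp add: absolutely_integrable_on_def)
    show "(\<lambda>\<theta>. ln 2 + (ln 2 - ?L \<theta>)) integrable_on {0..2*pi}"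
      using D by (intro integrable_add) auto
    show "\<bar>?L \<theta>\<bar> \<le> ln 2 + (ln 2 - ?L \<theta>)" for \<theta>
      using le[of \<theta>] ln_2_less_1 ln_gt_zero[of "2::real"] by linarith
  qed
  also have "\<dots> = 4 * pi * ln 2"
    using has_integral_add[OF has_integral_const_real[of "ln 2" 0 "2*pi"] D]
    by (intro integral_unique) (simp add: mult.assoc)
  finally show "integral {0..2*pi} (\<lambda>\<theta>. \<bar>?L \<theta>\<bar>) \<le> 4 * pi * ln 2" .
qed

text \<open>Points inside and outside the circle share one normal form. Inside, conjugation and
  multiplication by a unimodular number move the variable to the other term (reflection in the
  circle); outside, it is enough to factor out p.\<close>

lemma norm_circ_diff_eq:
  assumes "0 < r"
  obtains w where "norm w \<le> 1" "\<And>\<theta>. norm (circ r \<theta> - p) = max r (norm p) * norm (1 - w * circ 1 \<theta>)"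
proof (cases "norm p \<le> r")
  case True
  show ?thesis
  proof
    show "norm (cnj p / r) \<le> 1" using True assms by (simp add: norm_divide)
    fix \<theta>
    have c: "cnj (circ 1 \<theta>) * circ 1 \<theta> = 1"
      by (metis complex_norm_square mult.commute norm_circ abs_one of_real_1 one_power2)
    have "norm (1 - cnj p / r * circ 1 \<theta>) = norm (cnj (1 - cnj p / r * circ 1 \<theta>))"
      by (simp only: complex_mod_cnj)
    also have "\<dots> = norm (1 - p / r * cnj (circ 1 \<theta>)) * norm (circ 1 \<theta>)"
      by simp
    also have "\<dots> = norm (circ 1 \<theta> - p / r * (cnj (circ 1 \<theta>) * circ 1 \<theta>))"
      by (simp only: norm_mult[symmetric]) (simp add: algebra_simps)
    also have "\<dots> = norm (circ 1 \<theta> - p / r)"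
      by (simp add: c)
    finally have "r * norm (1 - cnj p / r * circ 1 \<theta>) = norm (r * (circ 1 \<theta> - p / r))"
      using assms by (simp add: norm_mult)
    also have "r * (circ 1 \<theta> - p / r) = circ r \<theta> - p"
      using assms by (simp add: circ_def field_simps)
    finally show "norm (circ r \<theta> - p) = max r (norm p) * norm (1 - (cnj p / r) * circ 1 \<theta>)"
      using True by simp
  qed
next
  case False
  then have "p \<noteq> 0" using assms by auto
  show ?thesis
  proof
    show "norm (r / p) \<le> 1" using False assms \<open>p \<noteq> 0\<close> by (simp add: norm_divide)
    fix \<theta>
    have "norm p * norm (1 - r / p * circ 1 \<theta>) = norm (p * (1 - r / p * circ 1 \<theta>))"
      by (simp only: norm_mult)
    also have "p * (1 - r / p * circ 1 \<theta>) = - (circ r \<theta> - p)"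
      using \<open>p \<noteq> 0\<close> by (simp add: circ_def field_simps)
    finally show "norm (circ r \<theta> - p) = max r (norm p) * norm (1 - (r / p) * circ 1 \<theta>)"
      using False by (simp only: norm_minus_cancel)
  qed
qed

lemma circle_ln_diff:
  assumes "0 < r"
  shows "circle_integrable (\<lambda>z. ln (norm (z - p))) r"
    and "circle_mean (\<lambda>z. ln (norm (z - p))) r = ln (max r (norm p))"
    and "circle_mean (\<lambda>z. \<bar>ln (norm (z - p))\<bar>) r \<le> \<bar>ln (max r (norm p))\<bar> + 2 * ln 2"
proof -
  obtain w where w: "norm w \<le> 1" "\<And>\<theta>. norm (circ r \<theta> - p) = max r (norm p) * norm (1 - w * circ 1 \<theta>)"
    using norm_circ_diff_eq[OF assms] by blast
  let ?L = "\<lambda>\<theta>. ln (norm (1 - w * circ 1 \<theta>))"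
  let ?M = "ln (max r (norm p))"
  define N where "N = {\<theta>\<in>{0..2*pi}. circ r \<theta> \<in> {p}}"
  have fin: "finite N"
    unfolding N_def using assms by (intro finite_circ_preimage) auto
  have eq: "ln (norm (circ r \<theta> - p)) = ?M + ?L \<theta>" if "\<theta> \<in> {0..2*pi} - N" for \<theta>
  proof -
    have "norm (circ r \<theta> - p) \<noteq> 0"
      using that by (auto simp: N_def)
    then have "norm (1 - w * circ 1 \<theta>) \<noteq> 0"
      using w(2)[of \<theta>] by auto
    then show ?thesis
      using assms unfolding w(2) by (subst ln_mult) auto
  qed
  have A: "(\<lambda>\<theta>. ?M + ?L \<theta>) absolutely_integrable_on {0..2*pi}"
    using circle_ln_one_minus(1)[OF w(1)] by (intro set_integral_add(1)) auto
  show B: "circle_integrable (\<lambda>z. ln (norm (z - p))) r"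
    unfolding circle_integrable_def
    by (rule absolutely_integrable_spike[OF A negligible_finite[OF fin]]) (use eq in auto)
  have "((\<lambda>\<theta>. ?M + ?L \<theta>) has_integral (2 * pi * ?M)) {0..2*pi}"
    using has_integral_add[OF has_integral_const_real[of ?M 0 "2*pi"] has_integral_ln_one_minus[OF w(1)]]
    by simp
  then have "((\<lambda>\<theta>. ln (norm (circ r \<theta> - p))) has_integral (2 * pi * ?M)) {0..2*pi}"
    by (rule has_integral_spike_finite[OF fin, rotated]) (use eq in auto)
  then show "circle_mean (\<lambda>z. ln (norm (z - p))) r = ?M"
    unfolding circle_mean_def by (subst integral_unique) auto
  have "integral {0..2*pi} (\<lambda>\<theta>. \<bar>ln (norm (circ r \<theta> - p))\<bar>) = integral {0..2*pi} (\<lambda>\<theta>. \<bar>?M + ?L \<theta>\<bar>)"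
    by (rule integral_spike[OF negligible_finite[OF fin]]) (use eq in auto)
  also have "\<dots> \<le> integral {0..2*pi} (\<lambda>\<theta>. \<bar>?M\<bar> + \<bar>?L \<theta>\<bar>)"
    using A circle_ln_one_minus(1)[OF w(1)]
    by (intro integral_le integrable_add) (auto simp: absolutely_integrable_on_def)
  also have "\<dots> = 2 * pi * \<bar>?M\<bar> + integral {0..2*pi} (\<lambda>\<theta>. \<bar>?L \<theta>\<bar>)"
    using circle_ln_one_minus(1)[OF w(1)]
    by (subst integral_add) (auto simp: absolutely_integrable_on_def)
  also have "\<dots> \<le> 2 * pi * \<bar>?M\<bar> + 4 * pi * ln 2"
    using circle_ln_one_minus(2)[OF w(1)] by simp
  finally show "circle_mean (\<lambda>z. \<bar>ln (norm (z - p))\<bar>) r \<le> \<bar>?M\<bar> + 2 * ln 2"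
    unfolding circle_mean_def by (simp add: field_simps)
qed

section \<open>Factorization of meromorphic functions in a disc\<close>

text \<open>A witness \<open>z0\<close> with \<open>f z0 \<noteq> 0\<close> is the form in which
  "not identically zero" is carried throughout. As poles have the value 0, the sparse set excluded
  here contains the poles as well as the zeros.\<close>

lemma nicely_meromorphic_UNIV_ev_nonzero:
  assumes "f nicely_meromorphic_on UNIV" "f z0 \<noteq> 0"
  shows "\<forall>\<^sub>\<approx>z. f z \<noteq> 0"
  using nicely_meromorphic_imp_constant_or_avoid[OF assms(1), of 0] assms(2) by auto

lemma nicely_meromorphic_UNIV_at:
  assumes "f nicely_meromorphic_on UNIV"
  shows "f meromorphic_on {z}" "isolated_singularity_at f z" "not_essential f z"
  using assms meromorphic_on_subset[of f UNIV "{z}"]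
  by (auto simp: nicely_meromorphic_on_def meromorphic_at_iff)

lemma nicely_meromorphic_UNIV_ev_nonzero_at:
  assumes "f nicely_meromorphic_on UNIV" "f z0 \<noteq> 0"
  shows "\<forall>\<^sub>F w in at z. f w \<noteq> 0" "\<exists>\<^sub>F w in at z. f w \<noteq> 0"
proof -
  show "\<forall>\<^sub>F w in at z. f w \<noteq> 0"
    using nicely_meromorphic_UNIV_ev_nonzero[OF assms] eventually_cosparse_imp_eventually_at by blast
  then show "\<exists>\<^sub>F w in at z. f w \<noteq> 0"
    by (intro eventually_frequently) auto
qed

lemma is_pole_iff_zorder_neg:
  assumes "f nicely_meromorphic_on UNIV" "f z0 \<noteq> 0"
  shows "is_pole f z \<longleftrightarrow> zorder f z < 0"
  using isolated_pole_imp_neg_zorder zorder_neg_imp_is_pole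
    nicely_meromorphic_UNIV_at[OF assms(1)] nicely_meromorphic_UNIV_ev_nonzero_at[OF assms]
  by blast

lemma zorder_eq_0_imp_analytic:
  assumes "f nicely_meromorphic_on UNIV" "f z0 \<noteq> 0" "zorder f z = 0"
  shows "f analytic_on {z}" "f z \<noteq> 0"
proof -
  have "\<not> is_pole f z"
    using is_pole_iff_zorder_neg[OF assms(1,2)] assms(3) by auto
  then show an: "f analytic_on {z}"
    using assms(1) nicely_meromorphic_on_imp_analytic_at by blast
  show "f z \<noteq> 0"
    using zorder_eq_0_iff[OF an] nicely_meromorphic_UNIV_ev_nonzero_at(2)[OF assms(1,2)] assms(3) by blast
qed

lemma zorder_support_cosparse:
  assumes "f nicely_meromorphic_on UNIV" "f z0 \<noteq> 0"
  shows "\<forall>\<^sub>\<approx>z. zorder f z = 0"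
proof -
  have "\<forall>\<^sub>\<approx>z. f analytic_on {z}"
    using assms by (intro meromorphic_on_imp_analytic_cosparse) (auto simp: nicely_meromorphic_on_def)
  then show ?thesis
    using nicely_meromorphic_UNIV_ev_nonzero[OF assms]
    by eventually_elim (rule zorder_eq_0I)
qed

lemma cosparse_imp_finite:
  fixes P :: "complex \<Rightarrow> bool"
  assumes "\<forall>\<^sub>\<approx>z. P z"
  shows "finite {z. norm z \<le> R \<and> \<not> P z}"
proof -
  have "{z. \<not> P z} sparse_in cball 0 R"
    using assms by (auto simp: eventually_cosparse intro: sparse_in_subset)
  then have "finite (cball 0 R \<inter> {z. \<not> P z})"
    by (intro sparse_in_compact_finite) auto
  also have "cball 0 R \<inter> {z. \<not> P z} = {z. norm z \<le> R \<and> \<not> P z}"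
    by auto
  finally show ?thesis .
qed

lemma finite_zorder_support:
  assumes "f nicely_meromorphic_on UNIV" "f z0 \<noteq> 0"
  shows "finite {z. norm z \<le> R \<and> zorder f z \<noteq> 0}"
  using cosparse_imp_finite[OF zorder_support_cosparse[OF assms]] .

lemma zorder_diff_powi:
  "zorder (\<lambda>z. (z - p) powi m) w = (if w = p then m else 0)"
proof (cases "w = p")
  case True
  then show ?thesis
    by (auto intro!: zorder_eqI[of UNIV p "\<lambda>_. 1"])
next
  case False
  then show ?thesis
    by (auto intro!: zorder_eq_0I analytic_intros)
qed

lemma ln_powi:
  fixes x :: real
  assumes "x > 0"
  shows "ln (x powi m) = of_int m * ln x"
  using assms by (simp add: power_int_def ln_realpow power_inverse[symmetric] ln_inverse)

text \<open>Divide f by the product of (z - p)^(zorder f p) over the closed disc. After removal of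
  singularities the quotient has order 0 at every point of that disc, so it is analytic and
  zero-free there, boundary included. The logarithmic identity is confined to points outside
  \<open>S\<close>, where no logarithm of 0 occurs.\<close>

lemma nicely_meromorphic_ln_factorization:
  fixes R :: real
  assumes f: "f nicely_meromorphic_on UNIV" "f z0 \<noteq> 0"
  defines "S \<equiv> {z. norm z \<le> R \<and> zorder f z \<noteq> 0}"
  obtains g where "g holomorphic_on ball 0 R" "continuous_on (cball 0 R) g" "\<And>z. z \<in> cball 0 R \<Longrightarrow> g z \<noteq> 0"
    "\<And>z. z \<in> cball 0 R - S \<Longrightarrow> f z \<noteq> 0 \<and>
        ln (norm (f z)) = ln (norm (g z)) + (\<Sum>p\<in>S. of_int (zorder f p) * ln (norm (z - p)))"
proof -
  have fin: "finite S"
    unfolding S_def by (rule finite_zorder_support[OF f])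
  define P where "P = (\<lambda>z. \<Prod>p\<in>S. (z - p) powi (zorder f p))"
  define g0 where "g0 = (\<lambda>z. f z / P z)"
  define g where "g = remove_sings g0"
  have P_nz: "P z \<noteq> 0" if "z \<notin> S" for z
    using that fin by (auto simp: P_def)
  have ev_S: "\<forall>\<^sub>F z in at w. z \<notin> S" for w
    using islimpt_finite[OF fin, of w] by (simp add: islimpt_iff_eventually)
  have ev_P: "\<forall>\<^sub>F z in at w. P z \<noteq> 0" for w
    using ev_S[of w] by eventually_elim (rule P_nz)
  have P_mero: "P meromorphic_on A" for A
    unfolding P_def by (intro meromorphic_intros)
  have f_mero: "f meromorphic_on A" for A
    using f(1) meromorphic_on_subset by (auto simp: nicely_meromorphic_on_def)
  have g0_mero: "g0 meromorphic_on A" for A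
    unfolding g0_def by (intro meromorphic_intros f_mero P_mero)
  have zP: "zorder P w = zorder f w" if "norm w \<le> R" for w
  proof -
    have "zorder P w = (\<Sum>p\<in>S. zorder (\<lambda>z. (z - p) powi (zorder f p)) w)"
      unfolding P_def using ev_P[of w]
      by (intro Meromorphic.zorder_prod meromorphic_intros) (auto simp: P_def)
    also have "\<dots> = (\<Sum>p\<in>S. if p = w then zorder f w else 0)"
      by (intro sum.cong) (auto simp: zorder_diff_powi)
    also have "\<dots> = zorder f w"
      using fin that by (auto simp: S_def)
    finally show ?thesis .
  qed
  have zg: "zorder g w = 0" if "norm w \<le> R" for w
  proof -
    have "zorder g w = zorder g0 w"
      unfolding g_def using g0_mero[of "{w}"] by (simp add: meromorphic_at_iff)
    also have "\<dots> = zorder f w - zorder P w"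
      unfolding g0_def using ev_P[of w] f_mero P_mero nicely_meromorphic_UNIV_ev_nonzero_at(2)[OF f]
      by (intro Meromorphic.zorder_divide) (auto intro: eventually_frequently)
    finally show ?thesis using zP[OF that] by simp
  qed
  have g_nice: "g nicely_meromorphic_on UNIV"
    unfolding g_def by (intro remove_sings_nicely_meromorphic g0_mero)
  have f_an: "f analytic_on {z}" "f z \<noteq> 0" if "norm z \<le> R" "z \<notin> S" for z
    using zorder_eq_0_imp_analytic[OF f, of z] that by (auto simp: S_def)
  have P_an: "P analytic_on {z}" if "z \<notin> S" for z
    unfolding P_def using that by (intro analytic_intros) auto
  have g_eq: "g z = f z / P z" if "norm z \<le> R" "z \<notin> S" for z
  proof -
    have "g0 analytic_on {z}"
      unfolding g0_def using that by (intro analytic_intros f_an P_an) (auto simp: P_nz)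
    then show ?thesis by (simp add: g_def g0_def)
  qed
  have g_nz: "\<exists>z. g z \<noteq> 0"
  proof -
    have "\<forall>\<^sub>\<approx>z. remove_sings g0 z = g0 z"
      by (rule eventually_remove_sings_eq[OF g0_mero])
    then have "\<forall>\<^sub>F z in at 0. remove_sings g0 z = g0 z"
      by (rule eventually_cosparse_imp_eventually_at) auto
    then have "\<forall>\<^sub>F z in at 0. g z \<noteq> 0"
      using ev_P[of 0] nicely_meromorphic_UNIV_ev_nonzero_at(1)[OF f, of 0]
      by eventually_elim (auto simp: g_def g0_def)
    then show ?thesis
      using eventually_happens'[OF at_neq_bot] by blast
  qed
  then obtain z1 where z1: "g z1 \<noteq> 0" by blast
  have g_an: "g analytic_on cball 0 R"
    using zorder_eq_0_imp_analytic(1)[OF g_nice z1] zg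
    by (subst analytic_on_analytic_at) auto
  show ?thesis
  proof
    show "g holomorphic_on ball 0 R" "continuous_on (cball 0 R) g"
      using g_an analytic_imp_holomorphic analytic_on_subset[OF g_an, of "ball 0 R"]
      by (auto intro: holomorphic_on_imp_continuous_on)
    show "g z \<noteq> 0" if "z \<in> cball 0 R" for z
      using zorder_eq_0_imp_analytic(2)[OF g_nice z1 zg] that by simp
    fix z assume z: "z \<in> cball 0 R - S"
    have "f z = g z * P z"
      using g_eq[of z] P_nz[of z] z by simp
    then have "ln (norm (f z)) = ln (norm (g z)) + ln (norm (P z))"
      using f_an(2)[of z] P_nz[of z] z by (auto simp: norm_mult ln_mult)
    also have "ln (norm (P z)) = (\<Sum>p\<in>S. ln (norm (z - p) powi (zorder f p)))"
      unfolding P_def prod_norm[symmetric] norm_power_int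
      using fin z by (intro ln_prod) auto
    also have "\<dots> = (\<Sum>p\<in>S. of_int (zorder f p) * ln (norm (z - p)))"
      using z by (intro sum.cong refl ln_powi) auto
    finally show "f z \<noteq> 0 \<and> ln (norm (f z)) =
       ln (norm (g z)) + (\<Sum>p\<in>S. of_int (zorder f p) * ln (norm (z - p)))"
      using f_an(2)[of z] z by simp
  qed
qed

section \<open>Jensen's formula\<close>

lemma circle_integrable_const [simp, intro]: "circle_integrable (\<lambda>_. c) r"
  by (simp add: circle_integrable_def)

lemma circle_integrable_add [intro]:
  assumes "circle_integrable u r" "circle_integrable v r"
  shows "circle_integrable (\<lambda>z. u z + v z) r"
  using assms unfolding circle_integrable_def by (rule set_integral_add(1))

lemma circle_integrable_cmult [intro]:
  assumes "circle_integrable u r"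
  shows "circle_integrable (\<lambda>z. c * u z) r"
  using assms unfolding circle_integrable_def by (rule set_integrable_mult_right)

lemma circle_integrable_abs [intro]:
  assumes "circle_integrable u r"
  shows "circle_integrable (\<lambda>z. \<bar>u z\<bar>) r"
  using assms unfolding circle_integrable_def by (rule set_integrable_abs)

lemma circle_integrable_sum [intro]:
  assumes "\<And>i. i \<in> I \<Longrightarrow> circle_integrable (u i) r"
  shows "circle_integrable (\<lambda>z. \<Sum>i\<in>I. u i z) r"
  using assms by (induction I rule: infinite_finite_induct) auto

lemma circle_integrable_continuous:
  assumes "continuous_on (sphere 0 \<bar>r\<bar>) u"
  shows "circle_integrable u r"
  unfolding circle_integrable_def
  by (intro absolutely_integrable_continuous_real continuous_on_compose2[OF assms continuous_on_circ]) auto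

lemma circle_integrable_imp_integrable:
  "circle_integrable u r \<Longrightarrow> (\<lambda>\<theta>. u (circ r \<theta>)) integrable_on {0..2*pi}"
  by (simp add: circle_integrable_def absolutely_integrable_on_def)

lemma circle_mean_const [simp]: "circle_mean (\<lambda>_. c) r = c"
  by (simp add: circle_mean_def)

lemma circle_mean_add:
  assumes "circle_integrable u r" "circle_integrable v r"
  shows "circle_mean (\<lambda>z. u z + v z) r = circle_mean u r + circle_mean v r"
  using integral_add[OF assms[THEN circle_integrable_imp_integrable]]
  by (simp add: circle_mean_def add_divide_distrib)

lemma circle_mean_diff:
  assumes "circle_integrable u r" "circle_integrable v r"
  shows "circle_mean (\<lambda>z. u z - v z) r = circle_mean u r - circle_mean v r"
  using integral_diff[OF assms[THEN circle_integrable_imp_integrable]]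
  by (simp add: circle_mean_def diff_divide_distrib)

lemma circle_mean_cmult: "circle_mean (\<lambda>z. c * u z) r = c * circle_mean u r"
  by (simp add: circle_mean_def)

lemma circle_mean_sum:
  assumes "\<And>i. i \<in> I \<Longrightarrow> circle_integrable (u i) r"
  shows "circle_mean (\<lambda>z. \<Sum>i\<in>I. u i z) r = (\<Sum>i\<in>I. circle_mean (u i) r)"
  using assms
  by (induction I rule: infinite_finite_induct) (auto simp: circle_mean_add circle_integrable_sum)

lemma circle_spike:
  assumes "r \<noteq> 0" "finite {z. norm z = \<bar>r\<bar> \<and> u z \<noteq> v z}"
  shows "circle_integrable u r \<longleftrightarrow> circle_integrable v r" "circle_mean u r = circle_mean v r"
proof -
  let ?N = "{\<theta>\<in>{0..2*pi}. circ r \<theta> \<in> {z. norm z = \<bar>r\<bar> \<and> u z \<noteq> v z}}"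
  have fin: "negligible ?N"
    by (intro negligible_finite finite_circ_preimage assms)
  show "circle_integrable u r \<longleftrightarrow> circle_integrable v r"
    unfolding circle_integrable_def by (rule absolutely_integrable_spike_eq[OF fin]) auto
  show "circle_mean u r = circle_mean v r"
    unfolding circle_mean_def by (subst integral_spike[OF fin]) auto
qed

lemma circle_mean_mono_ae:
  assumes "r \<noteq> 0" "circle_integrable u r" "circle_integrable v r"
    "finite {z. norm z = \<bar>r\<bar> \<and> \<not> u z \<le> v z}"
  shows "circle_mean u r \<le> circle_mean v r"
proof -
  \<comment> \<open>The truncated function satisfies the inequality everywhere and differs from
    \<open>u\<close> at finitely many points of the circle only.\<close>
  define u' where "u' = (\<lambda>z. min (u z) (v z))"
  have fin: "finite {z. norm z = \<bar>r\<bar> \<and> u z \<noteq> u' z}"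
    by (rule finite_subset[OF _ assms(4)]) (auto simp: u'_def)
  have "circle_integrable u' r"
    using circle_spike(1)[OF assms(1) fin] assms by simp
  then have "circle_mean u' r \<le> circle_mean v r"
    unfolding circle_mean_def using assms(3)
    by (intro mult_left_mono integral_le circle_integrable_imp_integrable) (auto simp: u'_def)
  then show ?thesis
    using circle_spike(2)[OF assms(1) fin] by simp
qed

lemma circle_mean_mono:
  assumes "circle_integrable u r" "circle_integrable v r" "\<And>z. norm z = \<bar>r\<bar> \<Longrightarrow> u z \<le> v z"
  shows "circle_mean u r \<le> circle_mean v r"
  unfolding circle_mean_def using assms
  by (intro mult_left_mono integral_le circle_integrable_imp_integrable) auto

lemma circle_mean_nonneg:
  assumes "\<And>z. 0 \<le> u z"
  shows "0 \<le> circle_mean u r"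
  unfolding circle_mean_def using assms
  \<comment> \<open>In the non-integrable case the integral is 0 by convention.\<close>
  by (cases "(\<lambda>\<theta>. u (circ r \<theta>)) integrable_on {0..2*pi}")
     (auto intro!: divide_nonneg_nonneg integral_nonneg simp: not_integrable_integral)

section \<open>Invariance of circle means under rotation, and change of radius\<close>

lemma has_integral_shift_real:
  fixes h :: "real \<Rightarrow> real"
  assumes "(h has_integral I) {a..b}"
  shows "((\<lambda>x. h (x + c)) has_integral I) {a - c..b - c}"
proof -
  have "((\<lambda>x. h (1 *\<^sub>R x + c)) has_integral (1 / \<bar>1\<bar> ^ DIM(real)) *\<^sub>R I)
     ((\<lambda>x. (1 / 1) *\<^sub>R x + - ((1 / 1) *\<^sub>R c)) ` cbox a b)"
    by (rule has_integral_affinity) (use assms in auto)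
  moreover have "(\<lambda>x. x - c) ` {a..b} = {a - c..b - c}"
    using image_add_atLeastAtMost[of "-c" a b] by (simp add: algebra_simps)
  ultimately show ?thesis by simp
qed

text \<open>The shifted interval loses {0..c} and gains {T..c + T}; periodicity makes these two
  pieces contribute the same integral.\<close>

lemma has_integral_shift_periodic:
  fixes h :: "real \<Rightarrow> real"
  assumes h: "(h has_integral I) {0..T}" and per: "\<And>x. h (x + T) = h x" and c: "0 \<le> c" "c \<le> T"
  shows "((\<lambda>x. h (x + c)) has_integral I) {0..T}"
proof -
  have int: "h integrable_on {0..c}" "h integrable_on {c..T}"
    using h c by (auto intro: integrable_subinterval_real)
  let ?I1 = "integral {0..c} h" and ?I2 = "integral {c..T} h"
  have I: "I = ?I1 + ?I2"
    using has_integral_combine[OF c integrable_integral[OF int(1)] integrable_integral[OF int(2)]] h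
      has_integral_unique by blast
  have "((\<lambda>x. h (x + (-T))) has_integral ?I1) {0 - (-T)..c - (-T)}"
    by (rule has_integral_shift_real[OF integrable_integral[OF int(1)]])
  moreover have "h (x + (-T)) = h x" for x
    using per[of "x - T"] by simp
  ultimately have "(h has_integral ?I1) {T..c + T}"
    by simp
  then have "(h has_integral (?I2 + ?I1)) {c..c + T}"
    using c by (intro has_integral_combine[OF _ _ integrable_integral[OF int(2)]]) auto
  from has_integral_shift_real[OF this, of c] show ?thesis
    by (simp add: I add.commute)
qed

text \<open>Multiplication by c rescales the radius by |c| and shifts the angle by the argument of
  c, and periodicity removes the shift. This is how the average of a coefficient at
  \<open>c * p ^ k * z\<close> becomes an average over a smaller circle.\<close>

lemma circle_rotate:
  assumes c: "c \<noteq> 0" and u: "circle_integrable u (norm c * r)"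
  shows "circle_integrable (\<lambda>z. u (c * z)) r" "circle_mean (\<lambda>z. u (c * z)) r = circle_mean u (norm c * r)"
proof -
  define \<eta> where "\<eta> = Arg2pi c"
  have \<eta>: "0 \<le> \<eta>" "\<eta> \<le> 2 * pi" and c_eq: "c = of_real (norm c) * exp (\<i> * of_real \<eta>)"
    using Arg2pi[of c] by (auto simp: \<eta>_def is_Arg_def)
  have eq: "c * circ r \<theta> = circ (norm c * r) (\<theta> + \<eta>)" for \<theta>
    by (subst c_eq, simp only: circ_plus) (simp add: circ_def mult_ac)
  let ?h = "\<lambda>\<theta>. u (circ (norm c * r) \<theta>)"
  have 1: "(?h has_integral integral {0..2*pi} ?h) {0..2*pi}"
    using circle_integrable_imp_integrable[OF u] by (rule integrable_integral)
  have 2: "((\<lambda>\<theta>. \<bar>?h \<theta>\<bar>) has_integral integral {0..2*pi} (\<lambda>\<theta>. \<bar>?h \<theta>\<bar>)) {0..2*pi}"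
    using circle_integrable_imp_integrable[OF circle_integrable_abs[OF u]] by (rule integrable_integral)
  have 3: "((\<lambda>\<theta>. ?h (\<theta> + \<eta>)) has_integral integral {0..2*pi} ?h) {0..2*pi}"
    using has_integral_shift_periodic[OF 1 _ \<eta>] by simp
  have 4: "((\<lambda>\<theta>. \<bar>?h (\<theta> + \<eta>)\<bar>) has_integral integral {0..2*pi} (\<lambda>\<theta>. \<bar>?h \<theta>\<bar>)) {0..2*pi}"
    using has_integral_shift_periodic[OF 2 _ \<eta>] by simp
  show "circle_integrable (\<lambda>z. u (c * z)) r"
    using 3 4 unfolding circle_integrable_def absolutely_integrable_on_def eq by auto
  show "circle_mean (\<lambda>z. u (c * z)) r = circle_mean u (norm c * r)"
    unfolding circle_mean_def eq integral_unique[OF 3] ..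
qed

text \<open>\<open>zor_poly f 0 0\<close> is the leading Laurent coefficient of f at the origin.
  Near 0 there are two expressions for ln |f|; their singular terms
  \<open>zorder f 0 * ln (norm w)\<close> cancel, and w tends to 0 in what remains.\<close>

lemma zor_poly_0_factorization:
  assumes f: "f nicely_meromorphic_on UNIV" "f z0 \<noteq> 0" and R: "0 < R" and fin: "finite S"
    and S: "0 \<notin> S \<Longrightarrow> zorder f 0 = 0"
    and g: "g holomorphic_on ball 0 R" "\<And>z. z \<in> cball 0 R \<Longrightarrow> g z \<noteq> 0"
    "\<And>z. z \<in> cball 0 R - S \<Longrightarrow> f z \<noteq> 0 \<and>
        ln (norm (f z)) = ln (norm (g z)) + (\<Sum>p\<in>S. of_int (zorder f p) * ln (norm (z - p)))"
  shows "ln (norm (zor_poly f 0 0)) = ln (norm (g 0)) + (\<Sum>p\<in>S-{0}. of_int (zorder f p) * ln (norm p))"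
proof -
  obtain \<rho> where rho: "zor_poly f 0 0 \<noteq> 0" "\<rho> > 0" "zor_poly f 0 holomorphic_on cball 0 \<rho>"
    "\<And>w. w \<in> cball 0 \<rho> - {0} \<Longrightarrow> f w = zor_poly f 0 w * (w - 0) powi (zorder f 0) \<and> zor_poly f 0 w \<noteq> 0"
    using zorder_exist[OF nicely_meromorphic_UNIV_at(2,3)[OF f(1)] nicely_meromorphic_UNIV_ev_nonzero_at(2)[OF f], of 0]
    by blast
  have ev1: "\<forall>\<^sub>F w in at 0. w \<in> ball 0 (min \<rho> R) - {0}"
    using rho(2) R by (intro eventually_at_in_open) auto
  have ev2: "\<forall>\<^sub>F w in at 0. w \<notin> S"
    using islimpt_finite[OF fin] by (simp add: islimpt_iff_eventually)
  have ev: "\<forall>\<^sub>F w in at 0. ln (norm (zor_poly f 0 w)) =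
    ln (norm (g w)) + (\<Sum>p\<in>S-{0}. of_int (zorder f p) * ln (norm (w - p)))"
    using ev1 ev2
  proof eventually_elim
    case (elim w)
    have w: "w \<in> cball 0 \<rho> - {0}" "w \<in> cball 0 R - S" "w \<noteq> 0"
      using elim by auto
    have "ln (norm (f w)) = ln (norm (zor_poly f 0 w)) + of_int (zorder f 0) * ln (norm w)"
      using rho(4)[OF w(1)] w(3) by (simp add: norm_mult norm_power_int ln_mult ln_powi)
    moreover have "(\<Sum>p\<in>S. of_int (zorder f p) * ln (norm (w - p))) =
       of_int (zorder f 0) * ln (norm w) + (\<Sum>p\<in>S-{0}. of_int (zorder f p) * ln (norm (w - p)))"
      using fin S by (cases "0 \<in> S") (auto simp: sum.remove)
    ultimately show ?case
      using g(3)[OF w(2)] by simp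
  qed
  have lim1: "((\<lambda>w. ln (norm (zor_poly f 0 w))) \<longlongrightarrow> ln (norm (zor_poly f 0 0))) (at 0)"
  proof -
    have "isCont (zor_poly f 0) 0"
      using rho(2,3) by (metis centre_in_ball continuous_on_eq_continuous_at holomorphic_on_imp_continuous_on
          holomorphic_on_subset ball_subset_cball open_ball)
    then show ?thesis
      using rho(1) by (intro tendsto_intros) (auto simp: isCont_def)
  qed
  have lim2: "((\<lambda>w. ln (norm (g w)) + (\<Sum>p\<in>S-{0}. of_int (zorder f p) * ln (norm (w - p))))
     \<longlongrightarrow> ln (norm (g 0)) + (\<Sum>p\<in>S-{0}. of_int (zorder f p) * ln (norm (0 - p)))) (at 0)"
  proof -
    have "isCont g 0"
      using g(1) R by (metis centre_in_ball continuous_on_eq_continuous_at holomorphic_on_imp_continuous_on open_ball)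
    then show ?thesis
      using g(2)[of 0] R by (intro tendsto_intros) (auto simp: isCont_def)
  qed
  from tendsto_unique[OF at_neq_bot lim1[unfolded tendsto_cong[OF ev]] lim2] show ?thesis
    by simp
qed

text \<open>Averaging the factorization gives each zero or pole p the weight ln (max r |p|).
  Expressing ln |g 0| by the leading coefficient subtracts ln |p| for p \<noteq> 0, which leaves ln
  (r / |p|) inside the circle and 0 outside.\<close>

lemma Jensen_formula:
  assumes f: "f nicely_meromorphic_on UNIV" "f z0 \<noteq> 0" and r: "0 < r"
  shows "circle_integrable (\<lambda>z. ln (norm (f z))) r"
    and "circle_mean (\<lambda>z. ln (norm (f z))) r = ln (norm (zor_poly f 0 0)) + of_int (zorder f 0) * ln r
      + (\<Sum>p\<in>{p. 0 < norm p \<and> norm p \<le> r \<and> zorder f p \<noteq> 0}. of_int (zorder f p) * ln (r / norm p))"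
proof -
  \<comment> \<open>Any radius beyond r serves: the circle has to lie in the open disc on which
    \<open>g\<close> is holomorphic.\<close>
  define R where "R = r + 1"
  define S where "S = {z. norm z \<le> R \<and> zorder f z \<noteq> 0}"
  have R: "0 < R" "r < R" using r by (auto simp: R_def)
  obtain g where g: "g holomorphic_on ball 0 R" "continuous_on (cball 0 R) g" "\<And>z. z \<in> cball 0 R \<Longrightarrow> g z \<noteq> 0"
    "\<And>z. z \<in> cball 0 R - S \<Longrightarrow> f z \<noteq> 0 \<and>
        ln (norm (f z)) = ln (norm (g z)) + (\<Sum>p\<in>S. of_int (zorder f p) * ln (norm (z - p)))"
    by (rule nicely_meromorphic_ln_factorization[OF f, of R, folded S_def]) blast
  have fin: "finite S"
    unfolding S_def by (rule finite_zorder_support[OF f])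
  let ?v = "\<lambda>z. ln (norm (g z)) + (\<Sum>p\<in>S. of_int (zorder f p) * ln (norm (z - p)))"
  have fin': "finite {z. norm z = \<bar>r\<bar> \<and> ln (norm (f z)) \<noteq> ?v z}"
  proof (rule finite_subset[OF _ fin], safe)
    fix z assume "norm z = \<bar>r\<bar>" "ln (norm (f z)) \<noteq> ?v z"
    then show "z \<in> S"
      using g(4)[of z] R r by auto
  qed
  have int_g: "circle_integrable (\<lambda>z. ln (norm (g z))) r"
    using r R g(3)
    by (intro circle_integrable_continuous continuous_intros continuous_on_subset[OF g(2)]) auto
  have int_s: "circle_integrable (\<lambda>z. of_int (zorder f p) * ln (norm (z - p))) r" for p
    by (intro circle_integrable_cmult circle_ln_diff(1) r)
  have int_v: "circle_integrable ?v r"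
    by (intro circle_integrable_add int_g circle_integrable_sum int_s)
  have r0: "r \<noteq> 0" using r by simp
  show "circle_integrable (\<lambda>z. ln (norm (f z))) r"
    using circle_spike(1)[OF r0 fin'] int_v by simp
  have mean_g: "circle_mean (\<lambda>z. ln (norm (g z))) r = ln (norm (g 0))"
    unfolding circle_mean_def
    using integral_unique[OF circle_mean_ln_nonvanishing[OF g(1) _ r R(2)]] g(3) by simp
  have S0: "zorder f 0 = 0" if "0 \<notin> S"
    using that R by (auto simp: S_def)
  have sum0: "(\<Sum>p\<in>S. of_int (zorder f p) * ln (max r (norm p))) =
     of_int (zorder f 0) * ln r + (\<Sum>p\<in>S-{0}. of_int (zorder f p) * ln (max r (norm p)))"
    using fin S0 r by (cases "0 \<in> S") (auto simp: sum.remove)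
  have "circle_mean (\<lambda>z. ln (norm (f z))) r = circle_mean ?v r"
    by (rule circle_spike(2)[OF r0 fin'])
  also have "\<dots> = ln (norm (g 0)) + (\<Sum>p\<in>S. of_int (zorder f p) * ln (max r (norm p)))"
    by (simp add: circle_mean_add[OF int_g circle_integrable_sum[OF int_s]] circle_mean_sum[OF int_s]
        mean_g circle_mean_cmult circle_ln_diff(2)[OF r])
  also have "\<dots> = ln (norm (zor_poly f 0 0)) + of_int (zorder f 0) * ln r +
      (\<Sum>p\<in>S-{0}. of_int (zorder f p) * (ln (max r (norm p)) - ln (norm p)))"
    using zor_poly_0_factorization[OF f R(1) fin S0 g(1,3,4)] sum0
    by (simp add: right_diff_distrib sum_subtractf)
  also have "(\<Sum>p\<in>S-{0}. of_int (zorder f p) * (ln (max r (norm p)) - ln (norm p))) =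
     (\<Sum>p\<in>{p. 0 < norm p \<and> norm p \<le> r \<and> zorder f p \<noteq> 0}. of_int (zorder f p) * ln (r / norm p))"
  proof (rule sum.mono_neutral_cong_right)
    show "{p. 0 < norm p \<and> norm p \<le> r \<and> zorder f p \<noteq> 0} \<subseteq> S - {0}"
      using R by (auto simp: S_def)
    show "\<forall>i\<in>S - {0} - {p. 0 < norm p \<and> norm p \<le> r \<and> zorder f p \<noteq> 0}.
       real_of_int (zorder f i) * (ln (max r (norm i)) - ln (norm i)) = 0"
      by (auto simp: S_def max_def)
    show "real_of_int (zorder f x) * (ln (max r (norm x)) - ln (norm x)) =
         real_of_int (zorder f x) * ln (r / norm x)"
      if "x \<in> {p. 0 < norm p \<and> norm p \<le> r \<and> zorder f p \<noteq> 0}" for x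
      using that r by (simp add: ln_div max_def)
  qed (use fin in auto)
  finally show "circle_mean (\<lambda>z. ln (norm (f z))) r = ln (norm (zor_poly f 0 0)) + of_int (zorder f 0) * ln r
      + (\<Sum>p\<in>{p. 0 < norm p \<and> norm p \<le> r \<and> zorder f p \<noteq> 0}. of_int (zorder f p) * ln (r / norm p))" .
qed

lemma abs_ln_le:
  fixes x :: real
  assumes "0 < a" "a \<le> x" "x \<le> b"
  shows "\<bar>ln x\<bar> \<le> \<bar>ln a\<bar> + \<bar>ln b\<bar>"
  using ln_mono[of a x] ln_mono[of x b] assms by linarith

text \<open>The bound is uniform in the radius, also for circles through zeros or poles, because
  every factor z - p has a mean of \<bar>ln\<bar> controlled by ln (max t |p|), and max t |p| lies
  between d and R + |p|. It serves the small circles, where no growth assumption on the coefficients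
  is available.\<close>

lemma circle_mean_abs_ln_bounded:
  assumes f: "f nicely_meromorphic_on UNIV" "f z0 \<noteq> 0" and d: "0 < d"
  shows "\<exists>C. \<forall>t\<in>{d..R}. circle_mean (\<lambda>z. \<bar>ln (norm (f z))\<bar>) t \<le> C"
proof -
  define S where "S = {z. norm z \<le> R \<and> zorder f z \<noteq> 0}"
  obtain g where g: "g holomorphic_on ball 0 R" "continuous_on (cball 0 R) g" "\<And>z. z \<in> cball 0 R \<Longrightarrow> g z \<noteq> 0"
    "\<And>z. z \<in> cball 0 R - S \<Longrightarrow> f z \<noteq> 0 \<and>
        ln (norm (f z)) = ln (norm (g z)) + (\<Sum>p\<in>S. of_int (zorder f p) * ln (norm (z - p)))"
    by (rule nicely_meromorphic_ln_factorization[OF f, of R, folded S_def]) blast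
  have fin: "finite S"
    unfolding S_def by (rule finite_zorder_support[OF f])
  have "compact ((\<lambda>z. ln (norm (g z))) ` cball 0 R)"
    using g(2,3) by (intro compact_continuous_image continuous_intros) auto
  then obtain B where B: "\<And>z. z \<in> cball 0 R \<Longrightarrow> \<bar>ln (norm (g z))\<bar> \<le> B"
    using compact_imp_bounded bounded_iff by (metis (no_types, lifting) image_eqI real_norm_def)
  have "circle_mean (\<lambda>z. \<bar>ln (norm (f z))\<bar>) t \<le>
     B + (\<Sum>p\<in>S. \<bar>of_int (zorder f p)\<bar> * (\<bar>ln d\<bar> + \<bar>ln (R + norm p)\<bar> + 2 * ln 2))"
    if t: "d \<le> t" "t \<le> R" for t
  proof -
    have t0: "0 < t" using t d by simp
    let ?v = "\<lambda>z. B + (\<Sum>p\<in>S. \<bar>of_int (zorder f p)\<bar> * \<bar>ln (norm (z - p))\<bar>)"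
    have int_s: "circle_integrable (\<lambda>z. \<bar>of_int (zorder f p)\<bar> * \<bar>ln (norm (z - p))\<bar>) t" for p
      by (intro circle_integrable_cmult circle_integrable_abs circle_ln_diff(1) t0)
    have le: "\<bar>ln (norm (f z))\<bar> \<le> ?v z" if z: "norm z = \<bar>t\<bar>" "z \<notin> S" for z
    proof -
      have "z \<in> cball 0 R" using z t t0 by simp
      then have "\<bar>ln (norm (f z))\<bar> \<le> \<bar>ln (norm (g z))\<bar> + \<bar>\<Sum>p\<in>S. of_int (zorder f p) * ln (norm (z - p))\<bar>"
        using g(4)[of z] z by simp
      also have "\<bar>\<Sum>p\<in>S. of_int (zorder f p) * ln (norm (z - p))\<bar> \<le>
          (\<Sum>p\<in>S. \<bar>of_int (zorder f p) * ln (norm (z - p))\<bar>)"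
        by (rule sum_abs)
      finally show ?thesis using B[OF \<open>z \<in> cball 0 R\<close>] by (simp add: abs_mult)
    qed
    have "circle_mean (\<lambda>z. \<bar>ln (norm (f z))\<bar>) t \<le> circle_mean ?v t"
    proof (rule circle_mean_mono_ae)
      show "circle_integrable (\<lambda>z. \<bar>ln (norm (f z))\<bar>) t"
        by (intro circle_integrable_abs Jensen_formula(1)[OF f] t0)
      show "circle_integrable ?v t"
        by (intro circle_integrable_add circle_integrable_const circle_integrable_sum int_s)
      show "finite {z. norm z = \<bar>t\<bar> \<and> \<not> \<bar>ln (norm (f z))\<bar> \<le> ?v z}"
        by (rule finite_subset[OF _ fin]) (use le in blast)
    qed (use t0 in simp)
    also have "\<dots> = B + (\<Sum>p\<in>S. \<bar>of_int (zorder f p)\<bar> * circle_mean (\<lambda>z. \<bar>ln (norm (z - p))\<bar>) t)"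
      by (simp add: circle_mean_add[OF _ circle_integrable_sum[OF int_s]] circle_mean_sum[OF int_s] circle_mean_cmult)
    also have "\<dots> \<le> B + (\<Sum>p\<in>S. \<bar>of_int (zorder f p)\<bar> * (\<bar>ln d\<bar> + \<bar>ln (R + norm p)\<bar> + 2 * ln 2))"
    proof (intro add_left_mono sum_mono mult_left_mono)
      fix p :: complex
      have "\<bar>ln (max t (norm p))\<bar> \<le> \<bar>ln d\<bar> + \<bar>ln (R + norm p)\<bar>"
        using t d by (intro abs_ln_le) (auto simp: max_def add_increasing2)
      then show "circle_mean (\<lambda>z. \<bar>ln (norm (z - p))\<bar>) t \<le> \<bar>ln d\<bar> + \<bar>ln (R + norm p)\<bar> + 2 * ln 2"
        using circle_ln_diff(3)[OF t0, of p] by linarith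
    qed auto
    finally show ?thesis .
  qed
  then show ?thesis by (meson atLeastAtMost_iff)
qed

section \<open>Counting functions and the first main theorem\<close>

text \<open>The guard \<open>is_pole\<close> gives the identically zero function multiplicity 0
  everywhere; \<open>zorder\<close> carries no information for it.\<close>

definition pole_mult :: "(complex \<Rightarrow> complex) \<Rightarrow> complex \<Rightarrow> nat" where
  "pole_mult f z = (if is_pole f z then nat (- zorder f z) else 0)"

definition zero_mult :: "(complex \<Rightarrow> complex) \<Rightarrow> complex \<Rightarrow> nat" where
  "zero_mult f z = nat (zorder f z)"

text \<open>This is the integrated counting function of Nevanlinna theory, written as a sum. The
  origin is left out: it would contribute its multiplicity times ln r, and this term is added
  separately.\<close>

definition weighted_count :: "(complex \<Rightarrow> nat) \<Rightarrow> real \<Rightarrow> real" where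
  "weighted_count m r = (\<Sum>z\<in>{z. 0 < norm z \<and> norm z \<le> r \<and> m z \<noteq> 0}. real (m z) * ln (r / norm z))"

lemma pole_mult_cosparse:
  assumes "f nicely_meromorphic_on UNIV"
  shows "\<forall>\<^sub>\<approx>z. pole_mult f z = 0"
proof -
  have "\<forall>\<^sub>\<approx>z. \<not> is_pole f z"
    using assms by (intro meromorphic_on_imp_not_pole_cosparse) (simp add: nicely_meromorphic_on_def)
  then show ?thesis
    by eventually_elim (simp add: pole_mult_def)
qed

lemma pole_mult_pos_iff:
  assumes "f nicely_meromorphic_on UNIV"
  shows "is_pole f z \<longleftrightarrow> pole_mult f z > 0"
  using isolated_pole_imp_neg_zorder[of f z] nicely_meromorphic_UNIV_at(2)[OF assms]
  by (auto simp: pole_mult_def)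

lemma weighted_count_nonneg: "0 \<le> weighted_count m r"
  unfolding weighted_count_def
  by (intro sum_nonneg mult_nonneg_nonneg ln_ge_zero) auto

lemma weighted_count_superset:
  assumes "finite A" "{z. 0 < norm z \<and> norm z \<le> r \<and> m z \<noteq> 0} \<subseteq> A"
    "A \<subseteq> {z. 0 < norm z \<and> norm z \<le> r}"
  shows "weighted_count m r = (\<Sum>z\<in>A. real (m z) * ln (r / norm z))"
  unfolding weighted_count_def using assms by (intro sum.mono_neutral_left) auto

lemma weighted_count_add:
  assumes "finite {z. norm z \<le> r \<and> m z \<noteq> 0}" "finite {z. norm z \<le> r \<and> m' z \<noteq> 0}"
  shows "weighted_count (\<lambda>z. m z + m' z) r = weighted_count m r + weighted_count m' r"
proof -
  let ?A = "{z. 0 < norm z \<and> norm z \<le> r \<and> (m z \<noteq> 0 \<or> m' z \<noteq> 0)}"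
  have fin: "finite ?A"
    by (rule finite_subset[OF _ finite_UnI[OF assms]]) auto
  have "weighted_count (\<lambda>z. m z + m' z) r = (\<Sum>z\<in>?A. real (m z + m' z) * ln (r / norm z))"
    by (intro weighted_count_superset fin) auto
  also have "\<dots> = (\<Sum>z\<in>?A. real (m z) * ln (r / norm z)) + (\<Sum>z\<in>?A. real (m' z) * ln (r / norm z))"
    by (simp add: ring_distribs sum.distrib)
  also have "(\<Sum>z\<in>?A. real (m z) * ln (r / norm z)) = weighted_count m r"
    by (intro weighted_count_superset[symmetric] fin) auto
  also have "(\<Sum>z\<in>?A. real (m' z) * ln (r / norm z)) = weighted_count m' r"
    by (intro weighted_count_superset[symmetric] fin) auto
  finally show ?thesis .
qed

lemma weighted_count_0: "weighted_count (\<lambda>_. 0) r = 0"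
  by (simp add: weighted_count_def)

lemma weighted_count_sum:
  assumes "finite I" "\<And>i. i \<in> I \<Longrightarrow> finite {z. norm z \<le> r \<and> m i z \<noteq> 0}"
  shows "weighted_count (\<lambda>z. \<Sum>i\<in>I. m i z) r = (\<Sum>i\<in>I. weighted_count (m i) r)"
  using assms
proof (induction I rule: finite_induct)
  case (insert i I)
  have "finite {z. norm z \<le> r \<and> (\<Sum>i\<in>I. m i z) \<noteq> 0}"
    by (rule finite_subset[of _ "\<Union>i\<in>I. {z. norm z \<le> r \<and> m i z \<noteq> 0}"])
       (use insert in \<open>auto simp: sum_eq_0_iff\<close>)
  then show ?case
    using insert by (simp add: weighted_count_add)
qed (simp add: weighted_count_0)

lemma has_integral_step_div:
  fixes a r m :: real
  assumes "0 < a" "a \<le> r"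
  shows "((\<lambda>t. (if a \<le> t then m else 0) / t) has_integral (m * ln (r / a))) {0..r}"
proof -
  have "((\<lambda>t. m / t) has_integral (m * ln r - m * ln a)) {a..r}"
    using assms by (intro fundamental_theorem_of_calculus[of a r "\<lambda>t. m * ln t" "\<lambda>t. m / t"])
      (auto intro!: derivative_eq_intros simp: has_real_derivative_iff_has_vector_derivative[symmetric])
  then have "((\<lambda>t. if t \<in> {a..r} then m / t else 0) has_integral (m * ln r - m * ln a)) {0..r}"
    using assms by (subst has_integral_restrict) auto
  then have "((\<lambda>t. (if a \<le> t then m else 0) / t) has_integral (m * ln r - m * ln a)) {0..r}"
    by (rule has_integral_eq[rotated]) auto
  then show ?thesis
    using assms by (simp add: ln_div right_diff_distrib)
qed

text \<open>In n(t) - n(0) a pole of modulus a switches on at t = a, so it contributes the integral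
  of its multiplicity over t from a to r.\<close>

lemma nev_N_eq:
  assumes f: "f nicely_meromorphic_on UNIV" and r: "0 < r"
  shows "nev_N f r = weighted_count (pole_mult f) r + real (pole_mult f 0) * ln r"
proof -
  let ?Q = "{z. 0 < norm z \<and> norm z \<le> r \<and> pole_mult f z \<noteq> 0}"
  have fin: "finite {z. norm z \<le> t \<and> pole_mult f z \<noteq> 0}" for t
    using cosparse_imp_finite[OF pole_mult_cosparse[OF f], of t] by simp
  have finQ: "finite ?Q"
    by (rule finite_subset[OF _ fin[of r]]) auto
  have pc: "pole_count f t = (\<Sum>z\<in>{z. norm z \<le> t \<and> pole_mult f z \<noteq> 0}. real (pole_mult f z))" for t
    unfolding pole_count_def
  proof (rule sum.cong)
    show "{p. is_pole f p \<and> cmod p \<le> t} = {z. cmod z \<le> t \<and> pole_mult f z \<noteq> 0}"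
      using pole_mult_pos_iff[OF f] by auto
    show "real_of_int (- zorder f x) = real (pole_mult f x)" if "x \<in> {z. cmod z \<le> t \<and> pole_mult f z \<noteq> 0}" for x
      using that by (auto simp: pole_mult_def split: if_splits)
  qed
  have pc0: "pole_count f 0 = real (pole_mult f 0)"
  proof -
    have "{z. norm z \<le> 0 \<and> pole_mult f z \<noteq> 0} = (if pole_mult f 0 = 0 then {} else {0})"
      by auto
    then show ?thesis by (simp add: pc)
  qed
  have diff: "pole_count f t - pole_count f 0 = (\<Sum>z\<in>?Q. if norm z \<le> t then real (pole_mult f z) else 0)"
    if t: "0 \<le> t" "t \<le> r" for t
  proof -
    have "pole_count f t = pole_count f 0 + (\<Sum>z\<in>{z. 0 < norm z \<and> norm z \<le> t \<and> pole_mult f z \<noteq> 0}. real (pole_mult f z))"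
    proof -
      have "{z. norm z \<le> t \<and> pole_mult f z \<noteq> 0} = {z. norm z \<le> 0 \<and> pole_mult f z \<noteq> 0} \<union>
         {z. 0 < norm z \<and> norm z \<le> t \<and> pole_mult f z \<noteq> 0}"
        using t by auto
      then show ?thesis
        unfolding pc by (simp only:) (intro sum.union_disjoint finite_subset[OF _ fin[of t]], use t in auto)
    qed
    also have "{z. 0 < norm z \<and> norm z \<le> t \<and> pole_mult f z \<noteq> 0} = {z\<in>?Q. norm z \<le> t}"
      using t by auto
    also have "(\<Sum>z\<in>{z\<in>?Q. norm z \<le> t}. real (pole_mult f z)) = (\<Sum>z\<in>?Q. if norm z \<le> t then real (pole_mult f z) else 0)"
      using finQ by (rule sum.inter_filter)
    finally show ?thesis by simp
  qed
  have "((\<lambda>t. \<Sum>z\<in>?Q. (if norm z \<le> t then real (pole_mult f z) else 0) / t) has_integral weighted_count (pole_mult f) r) {0..r}"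
    unfolding weighted_count_def by (intro has_integral_sum finQ has_integral_step_div) auto
  then have "((\<lambda>t. (pole_count f t - pole_count f 0) / t) has_integral weighted_count (pole_mult f) r) {0..r}"
    by (rule has_integral_eq[rotated]) (auto simp: diff sum_divide_distrib)
  then show ?thesis
    unfolding nev_N_def by (simp add: integral_unique pc0)
qed

section \<open>Estimates for log+ and the proximity function\<close>

lemma ln_plus_eq_max: "0 \<le> x \<Longrightarrow> ln_plus x = max 0 (ln x)"
  by (cases "x = 0") (auto simp: ln_plus_def max_def)

lemma ln_plus_nonneg [simp]: "0 \<le> ln_plus x"
  by (simp add: ln_plus_def)

text \<open>The conventions \<open>inverse 0 = 0\<close> and \<open>ln 0 = 0\<close> keep the
  identity valid at 0, so it can be averaged over a circle without exceptional points.\<close>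

lemma ln_plus_inverse: "0 \<le> x \<Longrightarrow> ln_plus (inverse x) = ln_plus x - ln x"
  by (cases "x = 0") (auto simp: ln_plus_eq_max ln_inverse max_def)

lemma ln_plus_mono: "x \<le> y \<Longrightarrow> ln_plus x \<le> ln_plus y"
  by (simp add: ln_plus_def)

lemma ln_plus_mult_le:
  assumes "0 \<le> x" "0 \<le> y" shows "ln_plus (x * y) \<le> ln_plus x + ln_plus y"
  using assms by (cases "x = 0 \<or> y = 0") (auto simp: ln_plus_eq_max ln_mult)

text \<open>A sum is at most the number of terms times the largest one, so passing from one common
  bound \<open>M\<close> to the sum costs only an additive constant. This is the place where a
  maximum replaces a sum of logarithms. The \<open>+ 1\<close> keeps the argument of ln at least 1
  when there are no terms.\<close>

lemma ln_plus_sum_le: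
  assumes "finite I" "\<And>i. i \<in> I \<Longrightarrow> 0 \<le> x i" "\<And>i. i \<in> I \<Longrightarrow> ln_plus (x i) \<le> M" "0 \<le> M" "card I \<le> N"
  shows "ln_plus (\<Sum>i\<in>I. x i) \<le> ln (real N + 1) + M"
proof -
  have "x i \<le> exp M" if "i \<in> I" for i
  proof (cases "x i \<le> 1")
    case True then show ?thesis using assms(4) by (meson one_le_exp_iff order_trans)
  next
    case False
    then have "ln (x i) \<le> M" using assms(3)[OF that] by (simp add: ln_plus_def)
    then show ?thesis using False by (metis exp_le_cancel_iff exp_ln not_le order_less_trans zero_less_one)
  qed
  then have "(\<Sum>i\<in>I. x i) \<le> real (card I) * exp M"
    by (intro sum_bounded_above) auto
  also have "\<dots> \<le> (real N + 1) * exp M"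
    using assms(5) by (intro mult_right_mono) auto
  finally have "ln_plus (\<Sum>i\<in>I. x i) \<le> ln_plus ((real N + 1) * exp M)"
    by (rule ln_plus_mono)
  also have "\<dots> \<le> ln_plus (real N + 1) + ln_plus (exp M)"
    by (intro ln_plus_mult_le) auto
  also have "\<dots> = ln (real N + 1) + M"
    using assms(4) by (simp add: ln_plus_eq_max)
  finally show ?thesis .
qed

lemma ln_plus_abs: "0 \<le> x \<Longrightarrow> ln_plus x = (ln x + \<bar>ln x\<bar>) / 2"
  by (simp add: ln_plus_eq_max max_def)

lemma circle_integrable_ln_plus:
  assumes f: "f nicely_meromorphic_on UNIV" and r: "0 < r"
  shows "circle_integrable (\<lambda>z. ln_plus (norm (f z))) r"
proof (cases "\<exists>z. f z \<noteq> 0")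
  case True
  then obtain z0 where "f z0 \<noteq> 0" by blast
  then have "circle_integrable (\<lambda>z. (1/2) * (ln (norm (f z)) + \<bar>ln (norm (f z))\<bar>)) r"
    by (intro circle_integrable_cmult circle_integrable_add circle_integrable_abs Jensen_formula(1)[OF f _ r])
  then show ?thesis by (simp add: ln_plus_abs)
qed (auto simp: ln_plus_def)

lemma nev_m_eq_circle_mean: "nev_m f r = circle_mean (\<lambda>z. ln_plus (norm (f z))) r"
  by (simp add: nev_m_def circle_mean_def circ_def)

lemma nev_m_nonneg: "0 \<le> nev_m f r"
  unfolding nev_m_eq_circle_mean by (intro circle_mean_nonneg) auto

lemma nev_N_nonneg:
  assumes "f nicely_meromorphic_on UNIV" "1 \<le> r"
  shows "0 \<le> nev_N f r" "weighted_count (pole_mult f) r \<le> nev_N f r"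
  using assms weighted_count_nonneg[of "pole_mult f" r] by (auto simp: nev_N_eq)

lemma nev_T_nonneg:
  assumes "f nicely_meromorphic_on UNIV" "1 \<le> r"
  shows "0 \<le> nev_T f r"
  unfolding nev_T_def using nev_m_nonneg[of f r] nev_N_nonneg[OF assms] by simp

lemma nev_m_bounded:
  assumes f: "f nicely_meromorphic_on UNIV" and d: "0 < d"
  shows "\<exists>C. \<forall>t\<in>{d..R}. nev_m f t \<le> C"
proof (cases "\<exists>z. f z \<noteq> 0")
  case True
  then obtain z0 where z0: "f z0 \<noteq> 0" by blast
  have "nev_m f t \<le> circle_mean (\<lambda>z. \<bar>ln (norm (f z))\<bar>) t" if "t \<in> {d..R}" for t
    unfolding nev_m_eq_circle_mean using that d
    by (intro circle_mean_mono circle_integrable_ln_plus f circle_integrable_abs Jensen_formula(1)[OF f z0])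
       (auto simp: ln_plus_eq_max)
  then show ?thesis
    using circle_mean_abs_ln_bounded[OF f z0 d, of R] by (meson order_trans)
next
  case False
  then have "nev_m f t = 0" for t
    by (simp add: nev_m_eq_circle_mean ln_plus_def)
  then show ?thesis by auto
qed

lemma Jensen_formula_counts:
  assumes f: "f nicely_meromorphic_on UNIV" "f z0 \<noteq> 0" and r: "0 < r"
  shows "circle_mean (\<lambda>z. ln (norm (f z))) r = ln (norm (zor_poly f 0 0))
     + (real (zero_mult f 0) - real (pole_mult f 0)) * ln r
     + weighted_count (zero_mult f) r - weighted_count (pole_mult f) r"
proof -
  let ?A = "{p. 0 < norm p \<and> norm p \<le> r \<and> zorder f p \<noteq> 0}"
  have fin: "finite ?A"
    by (rule finite_subset[OF _ finite_zorder_support[OF f, of r]]) auto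
  have z: "real_of_int (zorder f p) = real (zero_mult f p) - real (pole_mult f p)" for p
    using is_pole_iff_zorder_neg[OF f, of p] by (auto simp: zero_mult_def pole_mult_def)
  have "(\<Sum>p\<in>?A. of_int (zorder f p) * ln (r / norm p)) =
     (\<Sum>p\<in>?A. real (zero_mult f p) * ln (r / norm p)) - (\<Sum>p\<in>?A. real (pole_mult f p) * ln (r / norm p))"
    by (simp add: z left_diff_distrib sum_subtractf)
  also have "(\<Sum>p\<in>?A. real (zero_mult f p) * ln (r / norm p)) = weighted_count (zero_mult f) r"
    by (intro weighted_count_superset[symmetric] fin) (auto simp: zero_mult_def pole_mult_def split: if_splits)
  also have "(\<Sum>p\<in>?A. real (pole_mult f p) * ln (r / norm p)) = weighted_count (pole_mult f) r"
    by (intro weighted_count_superset[symmetric] fin) (auto simp: zero_mult_def pole_mult_def split: if_splits)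
  finally show ?thesis
    using Jensen_formula(2)[OF f r] by (simp add: z)
qed

text \<open>Average log+ |1/f| = log+ |f| - log |f| and insert Jensen's formula. Equality would hold
  with the further term \<open>zero_mult f 0 * ln r\<close> on the left; for
  \<open>1 \<le> r\<close> it is non-negative and is dropped.\<close>

lemma first_main_theorem:
  assumes f: "f nicely_meromorphic_on UNIV" "f z0 \<noteq> 0" and r: "1 \<le> r"
  shows "nev_m (\<lambda>z. inverse (f z)) r + weighted_count (zero_mult f) r \<le> nev_T f r - ln (norm (zor_poly f 0 0))"
proof -
  have r0: "0 < r" using r by simp
  have "nev_m (\<lambda>z. inverse (f z)) r = circle_mean (\<lambda>z. ln_plus (norm (f z)) - ln (norm (f z))) r"
    unfolding nev_m_eq_circle_mean norm_inverse by (simp add: ln_plus_inverse)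
  also have "\<dots> = nev_m f r - circle_mean (\<lambda>z. ln (norm (f z))) r"
    unfolding nev_m_eq_circle_mean
    by (intro circle_mean_diff circle_integrable_ln_plus Jensen_formula(1)[OF f] f r0)
  finally show ?thesis
    using Jensen_formula_counts[OF f r0] nev_N_eq[OF f(1) r0] r
    by (simp add: nev_T_def left_diff_distrib)
qed


text \<open>The order of growth at a point, phrased without \<open>zorder\<close> so that it is stable under sums
  and needs no case distinction for identically vanishing functions.\<close>

definition pole_order_le :: "(complex \<Rightarrow> complex) \<Rightarrow> complex \<Rightarrow> nat \<Rightarrow> bool" where
  "pole_order_le h z k \<longleftrightarrow> (\<exists>C. \<forall>\<^sub>F w in at z. norm (h w) * norm (w - z) ^ k \<le> C)"

lemma pole_order_le_mono:
  assumes "pole_order_le h z k" "k \<le> k'"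
  shows "pole_order_le h z k'"
proof -
  obtain C where "\<forall>\<^sub>F w in at z. norm (h w) * norm (w - z) ^ k \<le> C"
    using assms by (auto simp: pole_order_le_def)
  moreover have "\<forall>\<^sub>F w in at z. w \<in> ball z 1"
    by (intro eventually_at_in_open') auto
  ultimately have "\<forall>\<^sub>F w in at z. norm (h w) * norm (w - z) ^ k' \<le> C"
  proof eventually_elim
    case (elim w)
    have "norm (w - z) ^ k' \<le> norm (w - z) ^ k"
      using elim(2) assms(2) by (intro power_decreasing) (auto simp: dist_norm norm_minus_commute)
    then have "norm (h w) * norm (w - z) ^ k' \<le> norm (h w) * norm (w - z) ^ k"
      by (intro mult_left_mono) auto
    with elim(1) show ?case by linarith
  qed
  then show ?thesis by (auto simp: pole_order_le_def)
qed

lemma pole_order_le_cong: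
  assumes "\<forall>\<^sub>F w in at z. h w = h' w"
  shows "pole_order_le h z k \<longleftrightarrow> pole_order_le h' z k"
proof -
  have "(\<forall>\<^sub>F w in at z. norm (h w) * norm (w - z) ^ k \<le> C) \<longleftrightarrow> (\<forall>\<^sub>F w in at z. norm (h' w) * norm (w - z) ^ k \<le> C)" for C
    using assms by (intro eventually_subst) (auto elim: eventually_mono)
  then show ?thesis by (simp add: pole_order_le_def)
qed

lemma pole_order_le_const: "pole_order_le (\<lambda>_. c) z k"
  by (rule pole_order_le_mono[of _ _ 0]) (auto simp: pole_order_le_def)

lemma pole_order_le_add:
  assumes "pole_order_le g z k" "pole_order_le h z k"
  shows "pole_order_le (\<lambda>w. g w + h w) z k"
proof -
  obtain C D where "\<forall>\<^sub>F w in at z. norm (g w) * norm (w - z) ^ k \<le> C" "\<forall>\<^sub>F w in at z. norm (h w) * norm (w - z) ^ k \<le> D"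
    using assms by (auto simp: pole_order_le_def)
  then have "\<forall>\<^sub>F w in at z. norm (g w + h w) * norm (w - z) ^ k \<le> C + D"
  proof eventually_elim
    case (elim w)
    have "norm (g w + h w) * norm (w - z) ^ k \<le> (norm (g w) + norm (h w)) * norm (w - z) ^ k"
      by (intro mult_right_mono norm_triangle_ineq) auto
    with elim show ?case by (simp add: distrib_right)
  qed
  then show ?thesis by (auto simp: pole_order_le_def)
qed

lemma pole_order_le_mult:
  assumes "pole_order_le g z k" "pole_order_le h z l"
  shows "pole_order_le (\<lambda>w. g w * h w) z (k + l)"
proof -
  obtain C D where "\<forall>\<^sub>F w in at z. norm (g w) * norm (w - z) ^ k \<le> C" "\<forall>\<^sub>F w in at z. norm (h w) * norm (w - z) ^ l \<le> D"
    using assms by (auto simp: pole_order_le_def)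
  then have "\<forall>\<^sub>F w in at z. norm (g w * h w) * norm (w - z) ^ (k + l) \<le> C * D"
  proof eventually_elim
    case (elim w)
    have "0 \<le> norm (g w) * norm (w - z) ^ k" by simp
    then have "0 \<le> C" using elim(1) by linarith
    then have "(norm (g w) * norm (w - z) ^ k) * (norm (h w) * norm (w - z) ^ l) \<le> C * D"
      using elim by (intro mult_mono) auto
    then show ?case by (simp add: norm_mult power_add mult_ac)
  qed
  then show ?thesis by (auto simp: pole_order_le_def)
qed

lemma pole_order_le_uminus: "pole_order_le (\<lambda>w. - h w) z k \<longleftrightarrow> pole_order_le h z k"
  by (simp add: pole_order_le_def)

lemma pole_order_le_sum:
  assumes "\<And>i. i \<in> I \<Longrightarrow> pole_order_le (h i) z k"
  shows "pole_order_le (\<lambda>w. \<Sum>i\<in>I. h i w) z k"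
  using assms by (induction I rule: infinite_finite_induct) (auto intro: pole_order_le_const pole_order_le_add)

lemma pole_order_le_scale:
  assumes "pole_order_le h (c * z) k" "c \<noteq> 0"
  shows "pole_order_le (\<lambda>w. h (c * w)) z k"
proof -
  obtain C where C: "\<forall>\<^sub>F w in at (c * z). norm (h w) * norm (w - c * z) ^ k \<le> C"
    using assms by (auto simp: pole_order_le_def)
  have "filterlim ((*) c) (at (c * z)) (at z)"
    using assms(2) by (intro filterlim_atI tendsto_intros) (auto simp: eventually_at_filter)
  from eventually_compose_filterlim[OF C this]
  have "\<forall>\<^sub>F w in at z. norm (h (c * w)) * norm (w - z) ^ k \<le> C / norm c ^ k"
  proof eventually_elim
    case (elim w)
    have "norm (c * w - c * z) = norm c * norm (w - z)"
      by (metis norm_mult right_diff_distrib)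
    with elim show ?case
      using assms(2) by (simp add: power_mult_distrib field_simps)
  qed
  then show ?thesis by (auto simp: pole_order_le_def)
qed

text \<open>The factor \<open>g\<close> serves in both directions: its boundedness near z gives the
  upper estimate of the pole order, and \<open>g z \<noteq> 0\<close> makes that estimate
  sharp.\<close>

lemma pole_local_factorization:
  assumes h: "h nicely_meromorphic_on UNIV" and pole: "is_pole h z"
  obtains g :: "complex \<Rightarrow> complex" where "g \<midarrow>z\<rightarrow> g z" "g z \<noteq> 0" "\<forall>\<^sub>F w in at z. norm (h w) * norm (w - z) ^ pole_mult h z = norm (g w)"
proof -
  have "\<exists>\<^sub>F w in at z. h w \<noteq> 0"
    using non_zero_neighbour_pole[OF pole] by (intro eventually_frequently) auto
  then obtain \<rho> where rho: "zor_poly h z z \<noteq> 0" "\<rho> > 0" "zor_poly h z holomorphic_on cball z \<rho>"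
    "\<And>w. w \<in> cball z \<rho> - {z} \<Longrightarrow> h w = zor_poly h z w * (w - z) powi (zorder h z) \<and> zor_poly h z w \<noteq> 0"
    using zorder_exist[OF nicely_meromorphic_UNIV_at(2,3)[OF h], of z] by blast
  show ?thesis
  proof (rule that[of "zor_poly h z"])
    have "isCont (zor_poly h z) z"
      using rho(2,3) by (metis centre_in_ball continuous_on_eq_continuous_at holomorphic_on_imp_continuous_on
          holomorphic_on_subset ball_subset_cball open_ball)
    then show "zor_poly h z \<midarrow>z\<rightarrow> zor_poly h z z" by (simp add: isCont_def)
    have neg: "zorder h z < 0"
      using pole nicely_meromorphic_UNIV_at(2)[OF h] isolated_pole_imp_neg_zorder by blast
    have "\<forall>\<^sub>F w in at z. w \<in> ball z \<rho> - {z}"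
      using rho(2) by (intro eventually_at_in_open) auto
    then show "\<forall>\<^sub>F w in at z. norm (h w) * norm (w - z) ^ pole_mult h z = norm (zor_poly h z w)"
    proof eventually_elim
      case (elim w)
      then have w: "w \<in> cball z \<rho> - {z}" "norm (w - z) > 0" by auto
      have "norm (h w) = norm (zor_poly h z w) * norm (w - z) powi (zorder h z)"
        using rho(4)[OF w(1)] by (simp add: norm_mult norm_power_int)
      also have "norm (w - z) powi (zorder h z) = inverse (norm (w - z) ^ pole_mult h z)"
        using neg pole by (simp add: power_int_def pole_mult_def power_inverse)
      finally show ?case using w(2) by simp
    qed
  qed (fact rho(1))
qed

lemma pole_order_le_pole_mult:
  assumes h: "h nicely_meromorphic_on UNIV"
  shows "pole_order_le h z (pole_mult h z)"
proof (cases "is_pole h z")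
  case True
  obtain g :: "complex \<Rightarrow> complex" where g: "g \<midarrow>z\<rightarrow> g z" "g z \<noteq> 0" "\<forall>\<^sub>F w in at z. norm (h w) * norm (w - z) ^ pole_mult h z = norm (g w)"
    by (rule pole_local_factorization[OF h True])
  have "\<forall>\<^sub>F w in at z. norm (g w) < norm (g z) + 1"
    using tendsto_norm[OF g(1)] by (rule order_tendstoD) simp
  with g(3) have "\<forall>\<^sub>F w in at z. norm (h w) * norm (w - z) ^ pole_mult h z \<le> norm (g z) + 1"
    by eventually_elim simp
  then show ?thesis by (auto simp: pole_order_le_def)
next
  case False
  then have "h \<midarrow>z\<rightarrow> h z"
    using h by (auto simp: nicely_meromorphic_on_def)
  then have "\<forall>\<^sub>F w in at z. norm (h w) < norm (h z) + 1"
    by (intro order_tendstoD(2)[OF tendsto_norm]) auto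
  then have "\<forall>\<^sub>F w in at z. norm (h w) * norm (w - z) ^ pole_mult h z \<le> norm (h z) + 1"
    by eventually_elim (use False in \<open>simp add: pole_mult_def\<close>)
  then show ?thesis by (auto simp: pole_order_le_def)
qed

text \<open>If the multiplicity exceeded \<open>k\<close>, the factor \<open>g\<close> would be
  bounded near z by a constant times a positive power of |w - z|, forcing
  \<open>g z = 0\<close>.\<close>

lemma pole_mult_le:
  assumes h: "h nicely_meromorphic_on UNIV" and k: "pole_order_le h z k"
  shows "pole_mult h z \<le> k"
proof (rule ccontr)
  assume "\<not> pole_mult h z \<le> k"
  then obtain d where d: "pole_mult h z = k + Suc d"
    by (metis add_Suc_right less_imp_Suc_add not_le)
  then have pole: "is_pole h z"
    by (auto simp: pole_mult_def split: if_splits)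
  obtain g :: "complex \<Rightarrow> complex" where g: "g \<midarrow>z\<rightarrow> g z" "g z \<noteq> 0" "\<forall>\<^sub>F w in at z. norm (h w) * norm (w - z) ^ pole_mult h z = norm (g w)"
    by (rule pole_local_factorization[OF h pole])
  obtain C where "\<forall>\<^sub>F w in at z. norm (h w) * norm (w - z) ^ k \<le> C"
    using k by (auto simp: pole_order_le_def)
  with g(3) have "\<forall>\<^sub>F w in at z. norm (g w) \<le> C * norm (w - z) ^ Suc d"
  proof eventually_elim
    case (elim w)
    have "norm (g w) = (norm (h w) * norm (w - z) ^ k) * norm (w - z) ^ Suc d"
      using elim(1) by (simp only: d power_add mult.assoc)
    also have "\<dots> \<le> C * norm (w - z) ^ Suc d"
      using elim(2) by (intro mult_right_mono) auto
    finally show ?case .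
  qed
  moreover have "((\<lambda>w. C * norm (w - z) ^ Suc d) \<longlongrightarrow> C * norm (z - z) ^ Suc d) (at z)"
    by (intro tendsto_intros)
  ultimately have "norm (g z) \<le> C * norm (z - z) ^ Suc d"
    using tendsto_le[OF at_neq_bot _ tendsto_norm[OF g(1)]] by blast
  with g(2) show False by simp
qed

lemma pole_order_le_inverse:
  assumes f: "f nicely_meromorphic_on UNIV" "f z0 \<noteq> 0"
  shows "pole_order_le (\<lambda>w. inverse (f w)) z (zero_mult f z)"
proof -
  have "zorder (\<lambda>w. inverse (f w)) z = - zorder f z"
    using nicely_meromorphic_UNIV_at[OF f(1)] nicely_meromorphic_UNIV_ev_nonzero_at(2)[OF f]
    by (intro zorder_inverse) auto
  then have "pole_mult (\<lambda>w. inverse (f w)) z \<le> zero_mult f z"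
    by (simp add: pole_mult_def zero_mult_def)
  then show ?thesis
    using pole_order_le_mono[OF pole_order_le_pole_mult[OF nicely_meromorphic_on_inverse[OF f(1)]]] by blast
qed

lemma weighted_count_mono:
  assumes "finite {z. norm z \<le> r \<and> m' z \<noteq> 0}" "\<And>z. m z \<le> m' z"
  shows "weighted_count m r \<le> weighted_count m' r"
proof -
  let ?A = "{z. 0 < norm z \<and> norm z \<le> r \<and> m' z \<noteq> 0}"
  have fin: "finite ?A" by (rule finite_subset[OF _ assms(1)]) auto
  have "weighted_count m r = (\<Sum>z\<in>?A. real (m z) * ln (r / norm z))"
  proof (intro weighted_count_superset fin)
    have "m' z \<noteq> 0" if "m z \<noteq> 0" for z using assms(2)[of z] that by simp
    then show "{z. 0 < norm z \<and> norm z \<le> r \<and> m z \<noteq> 0} \<subseteq> ?A" by auto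
  qed auto
  also have "\<dots> \<le> weighted_count m' r"
    unfolding weighted_count_def using assms(2) by (intro sum_mono mult_right_mono ln_ge_zero) auto
  finally show ?thesis .
qed

lemma finite_pole_mult:
  assumes "f nicely_meromorphic_on UNIV"
  shows "finite {z. norm z \<le> r \<and> pole_mult f z \<noteq> 0}"
  using cosparse_imp_finite[OF pole_mult_cosparse[OF assms], of r] by simp

text \<open>A pole at the origin contributes ln r to the counting function directly. Otherwise f - f
  0 has a zero at the origin, and Jensen's formula gives this zero the weight ln r. The estimate is
  there to make the order of a non-constant coefficient non-negative.\<close>

lemma nev_T_nonconstant_lower_bound:
  assumes f: "f nicely_meromorphic_on UNIV" and nc: "\<not> (\<exists>c. \<forall>z. f z = c)"
  shows "\<exists>C. \<forall>r\<ge>1. ln r - C \<le> nev_T f r"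
proof (cases "is_pole f 0")
  case True
  then have "pole_mult f 0 \<ge> 1"
    using pole_mult_pos_iff[OF f] by (simp add: Suc_leI)
  then have "ln r - 0 \<le> nev_T f r" if "r \<ge> 1" for r
    using that nev_m_nonneg[of f r] weighted_count_nonneg[of "pole_mult f" r]
      mult_right_mono[of 1 "real (pole_mult f 0)" "ln r"]
    by (simp add: nev_T_def nev_N_eq[OF f])
  then show ?thesis by blast
next
  case False
  \<comment> \<open>At a pole of f the plain difference has the value - f 0;
    \<open>remove_sings\<close> restores the value 0 required of a nicely meromorphic
    function.\<close>
  define g where "g = remove_sings (\<lambda>z. f z - f 0)"
  have mero: "(\<lambda>z. f z - f 0) meromorphic_on UNIV"
    using f by (intro meromorphic_intros) (simp add: nicely_meromorphic_on_def)
  have g: "g nicely_meromorphic_on UNIV"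
    unfolding g_def by (rule remove_sings_nicely_meromorphic[OF mero])
  have g_eq: "\<forall>\<^sub>\<approx>z. g z = f z - f 0"
    unfolding g_def by (rule eventually_remove_sings_eq[OF mero])
  have an: "(\<lambda>z. f z - f 0) analytic_on {0}"
    using nicely_meromorphic_on_imp_analytic_at[OF f _ False] by (intro analytic_intros) auto
  then have g0: "g 0 = 0" "g analytic_on {0}"
    by (auto simp: g_def intro: remove_sings_analytic_on)
  obtain z1 where z1: "g z1 \<noteq> 0"
  proof (rule ccontr)
    assume "\<not> thesis"
    with that have "g z = 0" for z by blast
    with g_eq have "\<forall>\<^sub>\<approx>z. f z = f 0"
      by (auto elim: eventually_mono)
    moreover have "\<forall>\<^sub>\<approx>z. f z \<noteq> f 0"
      using nicely_meromorphic_imp_constant_or_avoid[OF f, of "f 0"] nc by auto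
    ultimately have "\<forall>\<^sub>\<approx>(z::complex). False"
      by eventually_elim simp
    then show False by (simp add: eventually_False)
  qed
  have "zorder g 0 > 0"
    using zorder_pos_iff'[OF g0(2)] g0(1) nicely_meromorphic_UNIV_ev_nonzero_at(2)[OF g z1] by blast
  then have z1': "zero_mult g 0 \<ge> 1" by (simp add: zero_mult_def)
  have pm: "pole_mult g z \<le> pole_mult f z" for z
  proof (rule pole_mult_le[OF g])
    have "\<forall>\<^sub>F w in at z. g w = f w + (- f 0)"
      using eventually_cosparse_imp_eventually_at[OF g_eq] by simp
    then show "pole_order_le g z (pole_mult f z)"
      using pole_order_le_add[OF pole_order_le_pole_mult[OF f] pole_order_le_const, of "- f 0" z]
      by (simp add: pole_order_le_cong)
  qed
  define C where "C = ln 2 + ln_plus (norm (f 0)) - ln (norm (zor_poly g 0 0))"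
  have "ln r - C \<le> nev_T f r" if r: "r \<ge> 1" for r
  proof -
    have r0: "0 < r" using r by simp
    let ?v = "\<lambda>z. ln_plus (norm (f z)) + (ln_plus (norm (f 0)) + ln 2)"
    have le: "ln (norm (g z)) \<le> ?v z" if "g z = f z - f 0" for z
    proof -
      let ?m = "max (norm (f z)) (norm (f 0))"
      have "ln (norm (g z)) \<le> ln_plus (norm (g z))"
        by (simp add: ln_plus_eq_max)
      also have "norm (g z) \<le> 2 * ?m"
        using norm_triangle_ineq4[of "f z" "f 0"] that by simp
      then have "ln_plus (norm (g z)) \<le> ln_plus (2 * ?m)"
        by (rule ln_plus_mono)
      also have "\<dots> \<le> ln_plus 2 + ln_plus ?m"
        by (intro ln_plus_mult_le) (auto simp: le_max_iff_disj)
      also have "ln_plus ?m \<le> ln_plus (norm (f z)) + ln_plus (norm (f 0))"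
        by (simp add: max_def)
      finally show ?thesis by (simp add: ln_plus_def)
    qed
    have int: "circle_integrable (\<lambda>z. ln_plus (norm (f z))) r"
      by (rule circle_integrable_ln_plus[OF f r0])
    have fin: "finite {z. norm z = \<bar>r\<bar> \<and> \<not> ln (norm (g z)) \<le> ?v z}"
      by (rule finite_subset[OF _ cosparse_imp_finite[OF g_eq, of r]]) (use le r in auto)
    have "circle_mean (\<lambda>z. ln (norm (g z))) r \<le> circle_mean ?v r"
      using r0 by (intro circle_mean_mono_ae fin Jensen_formula(1)[OF g z1] circle_integrable_add int) auto
    also have "\<dots> = nev_m f r + (ln_plus (norm (f 0)) + ln 2)"
      using circle_mean_add[OF int circle_integrable_const] by (simp add: nev_m_eq_circle_mean)
    finally have 1: "circle_mean (\<lambda>z. ln (norm (g z))) r \<le> nev_m f r + (ln_plus (norm (f 0)) + ln 2)" .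
    have 2: "weighted_count (pole_mult g) r \<le> weighted_count (pole_mult f) r"
      by (intro weighted_count_mono finite_pole_mult f pm)
    have "pole_mult g 0 = 0"
      using pm[of 0] False by (simp add: pole_mult_def)
    then have "1 * ln r \<le> (real (zero_mult g 0) - real (pole_mult g 0)) * ln r"
      using z1' r by (intro mult_right_mono) auto
    then have 3: "ln r \<le> (real (zero_mult g 0) - real (pole_mult g 0)) * ln r" by simp
    have 4: "weighted_count (pole_mult f) r \<le> nev_N f r"
      by (rule nev_N_nonneg(2)[OF f r])
    show ?thesis
      using 1 2 3 4 Jensen_formula_counts[OF g z1 r0] weighted_count_nonneg[of "zero_mult g" r]
      by (simp add: nev_T_def C_def)
  qed
  then show ?thesis by blast
qed

section \<open>Unwinding the dilation recurrence\<close>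

text \<open>Strong induction on \<open>K\<close>. From |z| \<ge> \<delta> a step leads to moduli
  between |p|^n |z| and |p| |z|, hence never past the base annulus. The forward invariant set
  \<open>G\<close> leaves room for exceptional points of the recurrence. Stated for a general real
  function \<open>P\<close>, the result applies both to log+ |f| and to pole multiplicities.\<close>

lemma dilation_recurrence_unwind:
  fixes P A :: "complex \<Rightarrow> real" and p :: complex
  assumes p: "norm p < 1" and \<delta>: "0 < \<delta>"
    and A: "\<And>z. 0 \<le> A z"
    and G: "\<And>z. z \<in> G \<Longrightarrow> p * z \<in> G"
    and step: "\<And>z M. z \<in> G \<Longrightarrow> \<delta> \<le> norm z \<Longrightarrow> 0 \<le> M \<Longrightarrow> (\<And>j. j \<in> {1..n} \<Longrightarrow> P (p ^ j * z) \<le> M)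
       \<Longrightarrow> P z \<le> A z + M"
    and base: "\<And>z. z \<in> G \<Longrightarrow> norm p ^ n * \<delta> \<le> norm z \<Longrightarrow> norm z < \<delta> \<Longrightarrow> P z \<le> B"
    and B: "0 \<le> B"
    and z: "z \<in> G" "norm p ^ n * \<delta> \<le> norm z" "norm (p ^ K * z) < \<delta>"
  shows "P z \<le> (\<Sum>k<K. A (p ^ k * z)) + B"
  using z
proof (induction K arbitrary: z rule: less_induct)
  case (less K z)
  have Gj: "p ^ j * z \<in> G" for j
    by (induction j) (use less.prems G in \<open>auto simp: mult.assoc\<close>)
  show ?case
  proof (cases "norm z < \<delta>")
    case True
    then show ?thesis
      using base[OF less.prems(1,2)] sum_nonneg[of "{..<K}" "\<lambda>k. A (p ^ k * z)"] A by fastforce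
  next
    case False
    have K: "0 < K"
      using False less.prems(3) by (cases K) auto
    \<comment> \<open>One bound for all j at once: starting from p^j z the orbit collects only the
      terms with j \<le> k < K, which form part of this non-negative sum.\<close>
    let ?M = "(\<Sum>k\<in>{1..<K}. A (p ^ k * z)) + B"
    have M: "0 \<le> ?M"
      using A B by (intro add_nonneg_nonneg sum_nonneg) auto
    have "P z \<le> A z + ?M"
    proof (rule step)
      fix j assume j: "j \<in> {1..n}"
      have "norm p ^ n \<le> norm p ^ j"
        using p j by (intro power_decreasing) auto
      then have lower: "norm p ^ n * \<delta> \<le> norm (p ^ j * z)"
        using False \<delta> unfolding norm_mult norm_power by (intro mult_mono) auto
      show "P (p ^ j * z) \<le> ?M"
      proof (cases "j \<le> K")
        case True
        have "P (p ^ j * z) \<le> (\<Sum>k<K - j. A (p ^ k * (p ^ j * z))) + B"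
        proof (rule less.IH)
          have "p ^ (K - j) * (p ^ j * z) = p ^ K * z"
            using True by (simp add: mult.assoc[symmetric] power_add[symmetric])
          then show "norm (p ^ (K - j) * (p ^ j * z)) < \<delta>"
            using less.prems(3) by (simp only:)
        qed (use j K Gj lower in auto)
        also have "(\<Sum>k<K - j. A (p ^ k * (p ^ j * z))) = (\<Sum>k\<in>{j..<K}. A (p ^ k * z))"
        proof -
          have "(\<Sum>k\<in>{0+j..<(K - j)+j}. A (p ^ k * z)) = (\<Sum>k\<in>{0..<K - j}. A (p ^ (k + j) * z))"
            by (rule sum.shift_bounds_nat_ivl)
          then show ?thesis
            using True by (simp add: power_add mult.assoc lessThan_atLeast0)
        qed
        also have "\<dots> \<le> (\<Sum>k\<in>{1..<K}. A (p ^ k * z))"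
          using j A by (intro sum_mono2) auto
        finally show ?thesis by simp
      next
        \<comment> \<open>Here j > K, so p^j z lies at least as far in as p^K z; it is already in
          the base annulus.\<close>
        case False
        have "norm (p ^ j * z) = norm p ^ (j - K) * norm (p ^ K * z)"
          using False by (simp add: norm_mult norm_power mult.assoc[symmetric] power_add[symmetric])
        also have "\<dots> \<le> 1 * norm (p ^ K * z)"
          using p by (intro mult_right_mono power_le_one) auto
        finally have "P (p ^ j * z) \<le> B"
          using less.prems(3) lower Gj by (intro base) auto
        moreover have "0 \<le> (\<Sum>k\<in>{1..<K}. A (p ^ k * z))"
          using A by (intro sum_nonneg) auto
        ultimately show ?thesis by linarith
      qed
    qed (use less.prems False M in auto)
    also have "A z + ?M = (\<Sum>k<K. A (p ^ k * z)) + B"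
      using K by (simp add: lessThan_atLeast0 sum.atLeast_Suc_lessThan)
    finally show ?thesis .
  qed
qed

lemma cosparse_scale:
  fixes c :: complex
  assumes "\<forall>\<^sub>\<approx>z. P z" "c \<noteq> 0"
  shows "\<forall>\<^sub>\<approx>z. P (c * z)"
proof -
  have "\<forall>\<^sub>F w in at z. P (c * w)" for z
  proof -
    have "\<forall>\<^sub>F w in at (c * z). P w"
      using assms(1) by (rule eventually_cosparse_imp_eventually_at) auto
    moreover have "filterlim ((*) c) (at (c * z)) (at z)"
      using assms(2) by (intro filterlim_atI tendsto_intros) (auto simp: eventually_at_filter)
    ultimately show ?thesis by (rule eventually_compose_filterlim)
  qed
  then show ?thesis by (subst eventually_cosparse_open_eq) auto
qed

text \<open>Counterpart of \<open>circle_rotate\<close> for counting functions: z \<mapsto> e z is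
  injective, keeps points in the disc of radius r, and can only increase the weight ln (r /
  |z|).\<close>

lemma weighted_count_dilate_le:
  assumes e: "e \<noteq> 0" "norm e \<le> 1" and F: "finite F" "F \<subseteq> {z. 0 < norm z \<and> norm z \<le> r}"
    and fin: "finite {z. norm z \<le> r \<and> m z \<noteq> 0}"
  shows "(\<Sum>z\<in>F. real (m (e * z)) * ln (r / norm z)) \<le> weighted_count m r"
proof -
  let ?S = "{z. 0 < norm z \<and> norm z \<le> r \<and> m z \<noteq> 0}"
  have finS: "finite ?S" by (rule finite_subset[OF _ fin]) auto
  have le: "norm (e * z) \<le> norm z" for z
    using mult_right_mono[OF e(2), of "norm z"] by (simp add: norm_mult)
  have sub: "(*) e ` F \<subseteq> {z. 0 < norm z \<and> norm z \<le> r}"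
    using F(2) e(1) le by (force intro: order_trans)
  have "(\<Sum>z\<in>F. real (m (e * z)) * ln (r / norm z)) \<le> (\<Sum>z\<in>F. real (m (e * z)) * ln (r / norm (e * z)))"
  proof (intro sum_mono mult_left_mono ln_mono)
    fix z assume "z \<in> F"
    then have z: "0 < norm z" "norm z \<le> r" using F(2) by auto
    show "r / norm z \<le> r / norm (e * z)"
      using z e(1) le[of z] order_trans[OF norm_ge_zero z(2)]
      by (intro divide_left_mono) (auto intro!: mult_pos_pos)
    show "0 < r / norm z" using z less_le_trans[OF z] by simp
  qed auto
  also have "\<dots> = (\<Sum>w\<in>(*) e ` F. real (m w) * ln (r / norm w))"
    using e(1) by (subst sum.reindex) (auto simp: inj_on_def)
  also have "\<dots> \<le> (\<Sum>w\<in>(*) e ` F \<union> ?S. real (m w) * ln (r / norm w))"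
    using finS F(1) by (intro sum_mono2) (auto intro!: mult_nonneg_nonneg ln_ge_zero)
  also have "\<dots> = weighted_count m r"
    using finS F(1) sub by (intro weighted_count_superset[symmetric]) auto
  finally show ?thesis .
qed

lemma dilation_equation_solved:
  assumes c: "c \<noteq> 0" and b0: "b 0 nicely_meromorphic_on UNIV" "b 0 w0 \<noteq> 0"
    and eq: "\<forall>\<^sub>\<approx>z. (\<Sum>j\<le>n. b j (c * z) * f (p ^ j * z)) = b (n+1) (c * z)"
  shows "\<forall>\<^sub>\<approx>z. f z = inverse (b 0 (c * z)) * (b (n+1) (c * z) - (\<Sum>j\<in>{1..n}. b j (c * z) * f (p ^ j * z)))"
  using eq cosparse_scale[OF nicely_meromorphic_UNIV_ev_nonzero[OF b0] c]
proof eventually_elim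
  case (elim z)
  have "(\<Sum>j\<le>n. b j (c * z) * f (p ^ j * z)) = b 0 (c * z) * f z + (\<Sum>j\<in>{1..n}. b j (c * z) * f (p ^ j * z))"
    by (simp add: atMost_atLeast0 sum.atLeast_Suc_atMost)
  with elim have "b 0 (c * z) * f z = b (n+1) (c * z) - (\<Sum>j\<in>{1..n}. b j (c * z) * f (p ^ j * z))"
    by (simp add: algebra_simps)
  with elim(2) show ?case
    by (metis mult.assoc left_inverse mult_1)
qed

text \<open>Pole orders add in products, and a sum has at most the largest order; the largest order
  of a coefficient is majorised by the total. As \<open>pole_order_le\<close> looks at punctured
  neighbourhoods, the sparse exceptional set of the equation does no harm and the inequality holds
  at every z.\<close>

lemma dilation_equation_pole_mult:
  fixes b :: "nat \<Rightarrow> complex \<Rightarrow> complex" and M :: nat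
  assumes p: "p \<noteq> 0" and c: "c \<noteq> 0" and b: "\<And>j. j \<le> n + 1 \<Longrightarrow> b j nicely_meromorphic_on UNIV"
    and b0: "b 0 w0 \<noteq> 0" and f: "f nicely_meromorphic_on UNIV"
    and eq: "\<forall>\<^sub>\<approx>z. (\<Sum>j\<le>n. b j (c * z) * f (p ^ j * z)) = b (n+1) (c * z)"
    and M: "\<And>j. j \<in> {1..n} \<Longrightarrow> pole_mult f (p ^ j * z) \<le> M"
  shows "pole_mult f z \<le> (zero_mult (b 0) (c * z) + (\<Sum>j\<in>{1..n+1}. pole_mult (b j) (c * z))) + M"
proof (rule pole_mult_le[OF f])
  let ?R = "\<lambda>z. b (n+1) (c * z) + - (\<Sum>j\<in>{1..n}. b j (c * z) * f (p ^ j * z))"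
  let ?k = "(\<Sum>j\<in>{1..n+1}. pole_mult (b j) (c * z)) + M"
  have bj: "pole_order_le (\<lambda>w. b j (c * w)) z (pole_mult (b j) (c * z))" if "j \<le> n + 1" for j
    by (intro pole_order_le_scale pole_order_le_pole_mult b c that)
  have le: "pole_mult (b j) (c * z) \<le> (\<Sum>j\<in>{1..n+1}. pole_mult (b j) (c * z))" if "j \<in> {1..n+1}" for j
    using that by (intro member_le_sum) auto
  have "pole_order_le ?R z ?k"
  proof (intro pole_order_le_add)
    show "pole_order_le (\<lambda>w. b (n+1) (c * w)) z ?k"
      using le[of "n+1"] by (intro pole_order_le_mono[OF bj]) auto
    show "pole_order_le (\<lambda>w. - (\<Sum>j\<in>{1..n}. b j (c * w) * f (p ^ j * w))) z ?k"
      unfolding pole_order_le_uminus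
    proof (rule pole_order_le_sum)
      fix j assume j: "j \<in> {1..n}"
      have "pole_order_le (\<lambda>w. f (p ^ j * w)) z (pole_mult f (p ^ j * z))"
        using p by (intro pole_order_le_scale pole_order_le_pole_mult f) auto
      then have "pole_order_le (\<lambda>w. b j (c * w) * f (p ^ j * w)) z (pole_mult (b j) (c * z) + pole_mult f (p ^ j * z))"
        using j by (intro pole_order_le_mult bj) auto
      then show "pole_order_le (\<lambda>w. b j (c * w) * f (p ^ j * w)) z ?k"
        by (rule pole_order_le_mono) (use M[OF j] le[of j] j in auto)
    qed
  qed
  moreover have "pole_order_le (\<lambda>w. inverse (b 0 (c * w))) z (zero_mult (b 0) (c * z))"
    using pole_order_le_scale[OF pole_order_le_inverse[OF b[of 0] b0] c] by simp
  ultimately have "pole_order_le (\<lambda>w. inverse (b 0 (c * w)) * ?R w) z (zero_mult (b 0) (c * z) + ?k)"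
    by (intro pole_order_le_mult)
  moreover have "\<forall>\<^sub>F w in at z. f w = inverse (b 0 (c * w)) * ?R w"
    using eventually_cosparse_imp_eventually_at[OF dilation_equation_solved[OF c b[of 0] b0 eq]] by simp
  ultimately have "pole_order_le f z (zero_mult (b 0) (c * z) + ?k)"
    by (simp only: pole_order_le_cong)
  then show "pole_order_le f z (zero_mult (b 0) (c * z) + (\<Sum>j\<in>{1..n+1}. pole_mult (b j) (c * z)) + M)"
    by (simp add: add.assoc)
qed

lemma dilation_equation_ln_plus:
  fixes f :: "complex \<Rightarrow> complex" and b :: "nat \<Rightarrow> complex \<Rightarrow> complex"
  assumes eq: "f z = inverse (b 0 (c * z)) * (b (n+1) (c * z) - (\<Sum>j\<in>{1..n}. b j (c * z) * f (p ^ j * z)))"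
    and M: "0 \<le> M" "\<And>j. j \<in> {1..n} \<Longrightarrow> ln_plus (norm (f (p ^ j * z))) \<le> M"
  shows "ln_plus (norm (f z)) \<le> (ln_plus (norm (inverse (b 0 (c * z)))) +
     (\<Sum>j\<in>{1..n+1}. ln_plus (norm (b j (c * z)))) + ln (real n + 2)) + M"
proof -
  \<comment> \<open>The inhomogeneous term enters as summand n + 1 with factor 1. The n + 1 summands
    account for the constant ln (n + 2).\<close>
  define x where "x = (\<lambda>j. norm (b j (c * z)) * (if j = n + 1 then 1 else norm (f (p ^ j * z))))"
  let ?S = "\<Sum>j\<in>{1..n+1}. ln_plus (norm (b j (c * z)))"
  have "norm (b (n+1) (c * z) - (\<Sum>j\<in>{1..n}. b j (c * z) * f (p ^ j * z))) \<le>
     norm (b (n+1) (c * z)) + norm (\<Sum>j\<in>{1..n}. b j (c * z) * f (p ^ j * z))"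
    by (rule norm_triangle_ineq4)
  also have "norm (\<Sum>j\<in>{1..n}. b j (c * z) * f (p ^ j * z)) \<le> (\<Sum>j\<in>{1..n}. x j)"
    by (rule order_trans[OF norm_sum]) (auto simp: x_def norm_mult intro!: sum_mono)
  finally have le: "norm (b (n+1) (c * z) - (\<Sum>j\<in>{1..n}. b j (c * z) * f (p ^ j * z))) \<le> (\<Sum>j\<in>{1..n+1}. x j)"
    by (simp add: x_def)
  have "ln_plus (\<Sum>j\<in>{1..n+1}. x j) \<le> ln (real (n + 1) + 1) + (?S + M)"
  proof (rule ln_plus_sum_le)
    fix j assume j: "j \<in> {1..n+1}"
    have "ln_plus (x j) \<le> ln_plus (norm (b j (c * z))) + ln_plus (if j = n + 1 then 1 else norm (f (p ^ j * z)))"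
      unfolding x_def by (intro ln_plus_mult_le) auto
    also have "ln_plus (norm (b j (c * z))) \<le> ?S"
      using j by (intro member_le_sum) auto
    also have "ln_plus (if j = n + 1 then 1 else norm (f (p ^ j * z))) \<le> M"
      using M j by (auto simp: ln_plus_def[of 1])
    finally show "ln_plus (x j) \<le> ?S + M" by simp
  qed (use M in \<open>auto simp: x_def intro!: add_nonneg_nonneg sum_nonneg\<close>)
  moreover have "ln_plus (norm (f z)) \<le> ln_plus (norm (inverse (b 0 (c * z)))) +
     ln_plus (norm (b (n+1) (c * z) - (\<Sum>j\<in>{1..n}. b j (c * z) * f (p ^ j * z))))"
    by (subst eq, subst norm_mult) (intro ln_plus_mult_le, auto)
  moreover note ln_plus_mono[OF le]
  ultimately show ?thesis by (simp add: add_ac)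
qed

section \<open>Growth of solutions\<close>

lemma finite_zero_mult:
  assumes "f nicely_meromorphic_on UNIV" "f z0 \<noteq> 0"
  shows "finite {z. norm z \<le> r \<and> zero_mult f z \<noteq> 0}"
  by (rule finite_subset[OF _ finite_zorder_support[OF assms, of r]]) (auto simp: zero_mult_def)

text \<open>\<open>K\<close> is the first index at which the radius falls below \<delta>; minimality
  keeps all earlier radii at least \<delta> and bounds \<open>K\<close> by the logarithm of r. For r
  \<ge> e one has ln r \<ge> 1, which absorbs the additive constants into \<open>C\<close>.\<close>

lemma least_power_below:
  fixes x :: real
  assumes x: "0 < x" "x < 1" and \<delta>: "0 < \<delta>"
  shows "\<exists>C. \<forall>r\<ge>exp 1. \<exists>K. x ^ K * r < \<delta> \<and> (\<forall>k<K. \<delta> \<le> x ^ k * r) \<and> real K \<le> C * ln r"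
proof -
  define C where "C = 1 + (1 + \<bar>ln \<delta>\<bar>) / ln (1 / x)"
  have L: "0 < ln (1 / x)" using x by (intro ln_gt_zero) auto
  have "\<exists>K. x ^ K * r < \<delta> \<and> (\<forall>k<K. \<delta> \<le> x ^ k * r) \<and> real K \<le> C * ln r" if r: "exp 1 \<le> r" for r
  proof -
    have r0: "0 < r" using r exp_gt_zero[of "1::real"] by linarith
    have lr: "1 \<le> ln r" using r r0 by (metis exp_gt_zero ln_exp ln_mono)
    define K where "K = (LEAST K. x ^ K * r < \<delta>)"
    obtain k where "x ^ k < \<delta> / r"
      using real_arch_pow_inv[of "\<delta> / r" x] x \<delta> r0 by auto
    then have "x ^ k * r < \<delta>" using r0 by (simp add: field_simps)
    then have K: "x ^ K * r < \<delta>" unfolding K_def by (rule LeastI)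
    have K': "\<delta> \<le> x ^ k * r" if "k < K" for k
      using not_less_Least[of k "\<lambda>K. x ^ K * r < \<delta>"] that unfolding K_def by simp
    have "real K \<le> C * ln r"
    proof (cases K)
      case 0
      have "0 \<le> C" using L by (auto simp: C_def intro!: add_nonneg_nonneg divide_nonneg_pos)
      then show ?thesis using 0 lr by simp
    next
      case (Suc k)
      then have "\<delta> \<le> x ^ k * r" using K'[of k] by simp
      then have "ln \<delta> \<le> ln (x ^ k * r)" using \<delta> by (intro ln_mono) auto
      also have "\<dots> = real k * ln x + ln r"
        using x r0 by (simp add: ln_mult ln_realpow)
      finally have "real k * ln (1 / x) \<le> ln r - ln \<delta>"
        using x by (simp add: ln_div)
      also have "\<dots> \<le> (1 + \<bar>ln \<delta>\<bar>) * ln r"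
      proof -
        have "\<bar>ln \<delta>\<bar> * 1 \<le> \<bar>ln \<delta>\<bar> * ln r" using lr by (intro mult_left_mono) auto
        then show ?thesis by (simp add: distrib_right)
      qed
      finally have "real k \<le> (1 + \<bar>ln \<delta>\<bar>) / ln (1 / x) * ln r"
        using L by (simp add: field_simps)
      then show ?thesis using Suc lr by (simp add: C_def distrib_right)
    qed
    with K K' show ?thesis by blast
  qed
  then show ?thesis by blast
qed

lemma nicely_meromorphic_punctured_disc:
  assumes f: "f nicely_meromorphic_on UNIV"
  obtains \<delta> where "0 < \<delta>" "\<And>z. z \<noteq> 0 \<Longrightarrow> norm z \<le> \<delta> \<Longrightarrow> \<not> is_pole f z"
proof -
  have "\<forall>\<^sub>\<approx>z. \<not> is_pole f z"
    using f by (intro meromorphic_on_imp_not_pole_cosparse) (simp add: nicely_meromorphic_on_def)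
  then have "\<forall>\<^sub>F z in at 0. \<not> is_pole f z"
    by (rule eventually_cosparse_imp_eventually_at) auto
  then obtain d where d: "d > 0" "\<And>z. z \<noteq> 0 \<Longrightarrow> dist z 0 < d \<Longrightarrow> \<not> is_pole f z"
    by (auto simp: eventually_at)
  show ?thesis
    by (rule that[of "d / 2"]) (use d in auto)
qed

lemma ln_plus_bounded_on_annulus:
  assumes f: "f nicely_meromorphic_on UNIV" and d: "0 < d"
    and np: "\<And>z. z \<noteq> 0 \<Longrightarrow> norm z \<le> \<delta> \<Longrightarrow> \<not> is_pole f z"
  obtains B where "0 \<le> B" "\<And>z. d \<le> norm z \<Longrightarrow> norm z \<le> \<delta> \<Longrightarrow> ln_plus (norm (f z)) \<le> B"
proof -
  let ?A = "{z::complex. d \<le> norm z \<and> norm z \<le> \<delta>}"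
  have "closed ({z::complex. d \<le> norm z} \<inter> {z. norm z \<le> \<delta>})"
    by (intro closed_Int closed_Collect_le continuous_intros)
  moreover have "?A = {z. d \<le> norm z} \<inter> {z. norm z \<le> \<delta>}" by auto
  moreover have "bounded ?A"
    by (rule bounded_subset[OF bounded_cball[of 0 \<delta>]]) auto
  ultimately have "compact ?A" by (simp add: compact_eq_bounded_closed)
  moreover have "continuous_on ?A f"
  proof (intro continuous_at_imp_continuous_on ballI)
    fix z assume "z \<in> ?A"
    moreover from this have "z \<noteq> 0" using d by auto
    ultimately have "\<not> is_pole f z" using np[of z] by simp
    then show "isCont f z"
      using f by (auto simp: nicely_meromorphic_on_def isCont_def)
  qed
  ultimately have "bounded (f ` ?A)"
    by (intro compact_imp_bounded compact_continuous_image)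
  then obtain C where "\<And>z. z \<in> ?A \<Longrightarrow> norm (f z) \<le> C"
    by (auto simp: bounded_iff)
  then show ?thesis
    by (intro that[of "ln_plus C"]) (auto intro: ln_plus_mono)
qed

text \<open>The counting and the proximity function are bounded by the same unwinding, each in at
  most O(log r) steps of cost O(\<Psi> r). The condition \<open>norm c \<le> 1\<close> keeps the
  coefficient arguments c p^k z in the disc of radius r, so that \<open>\<Psi> r\<close> dominates
  all of them.\<close>

lemma nev_T_dilation_equation:
  fixes b :: "nat \<Rightarrow> complex \<Rightarrow> complex" and \<Psi> :: "real \<Rightarrow> real"
  assumes p: "p \<noteq> 0" "norm p < 1" and c: "c \<noteq> 0" "norm c \<le> 1"
    and b: "\<And>j. j \<le> n + 1 \<Longrightarrow> b j nicely_meromorphic_on UNIV"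
    and b0: "b 0 w0 \<noteq> 0" and f: "f nicely_meromorphic_on UNIV"
    and eq: "\<forall>\<^sub>\<approx>z. (\<Sum>j\<le>n. b j (c * z) * f (p ^ j * z)) = b (n+1) (c * z)"
    and t0: "1 \<le> t0" and \<Psi>_mono: "\<And>x y. t0 \<le> x \<Longrightarrow> x \<le> y \<Longrightarrow> \<Psi> x \<le> \<Psi> y"
    and \<Psi>_ge: "\<And>x. t0 \<le> x \<Longrightarrow> 1 \<le> \<Psi> x"
    and T: "\<And>j t. j \<le> n + 1 \<Longrightarrow> t0 \<le> t \<Longrightarrow> nev_T (b j) t \<le> \<Psi> t"
  shows "\<exists>C. \<forall>\<^sub>F r in at_top. nev_T f r \<le> C * ln r * \<Psi> r"
proof -
  obtain \<delta> where \<delta>: "0 < \<delta>" "\<And>z. z \<noteq> 0 \<Longrightarrow> norm z \<le> \<delta> \<Longrightarrow> \<not> is_pole f z"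
    using nicely_meromorphic_punctured_disc[OF f] by blast
  have pn: "0 < norm p ^ n * \<delta>" using p \<delta> by simp
  obtain B where B: "0 \<le> B" "\<And>z. norm p ^ n * \<delta> \<le> norm z \<Longrightarrow> norm z \<le> \<delta> \<Longrightarrow> ln_plus (norm (f z)) \<le> B"
    using ln_plus_bounded_on_annulus[OF f pn \<delta>(2)] by blast
  obtain CK where CK: "\<And>r. exp 1 \<le> r \<Longrightarrow> \<exists>K. norm p ^ K * r < \<delta> \<and> (\<forall>k<K. \<delta> \<le> norm p ^ k * r) \<and> real K \<le> CK * ln r"
    using least_power_below[of "norm p" \<delta>] p \<delta>(1) by auto

  \<comment> \<open>\<open>D\<close> is the cost of one step for pole multiplicities;
    \<open>v\<close>, defined next, is the cost of one step for log+ |f|.\<close>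
  define D where "D = (\<lambda>z. zero_mult (b 0) z + (\<Sum>j\<in>{1..n+1}. pole_mult (b j) z))"
  define v where "v = (\<lambda>z. ln_plus (norm (inverse (b 0 z))) + (\<Sum>j\<in>{1..n+1}. ln_plus (norm (b j z))) + ln (real n + 2))"
  define \<kappa> where "\<kappa> = \<bar>ln (norm (zor_poly (b 0) 0 0))\<bar>"
  \<comment> \<open>The n + 1 functions b_1, ..., b_(n+1) and the reciprocal of b_0 account for n +
    2 copies of \<Psi>; \<open>\<kappa>\<close> from the first main theorem and the logarithm are
    absorbed because \<Psi> \<ge> 1.\<close>
  define C1 where "C1 = real n + 2 + \<kappa> + ln (real n + 2)"

  have b0_nice: "b 0 nicely_meromorphic_on UNIV" by (rule b) simp
  have binv: "(\<lambda>z. inverse (b 0 z)) nicely_meromorphic_on UNIV"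
    by (rule nicely_meromorphic_on_inverse[OF b0_nice])
  have ln2: "0 \<le> ln (real n + 2)" by simp
  have C1: "0 \<le> C1" using ln2 by (simp add: C1_def \<kappa>_def)
  have v_nonneg: "0 \<le> v z" for z
    using ln2 by (auto simp: v_def intro!: add_nonneg_nonneg sum_nonneg)

  have fmt: "nev_m (\<lambda>z. inverse (b 0 z)) t + weighted_count (zero_mult (b 0)) t \<le> \<Psi> t + \<kappa>" if "t0 \<le> t" for t
    using first_main_theorem[OF b0_nice b0, of t] T[of 0 t] that t0 unfolding \<kappa>_def by simp
  have \<kappa>\<Psi>: "x \<le> x * \<Psi> t" if "t0 \<le> t" "0 \<le> x" for x t
    using mult_left_mono[OF \<Psi>_ge[OF that(1)] that(2)] by simp

  have \<kappa>0: "0 \<le> \<kappa>" by (simp add: \<kappa>_def)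
  have C1\<Psi>: "of_nat (card {1..n+1}) * \<Psi> t + (\<Psi> t + \<kappa>) + ln (real n + 2) \<le> C1 * \<Psi> t" if "t0 \<le> t" for t
  proof -
    have "C1 * \<Psi> t = of_nat (card {1..n+1}) * \<Psi> t + \<Psi> t + \<kappa> * \<Psi> t + ln (real n + 2) * \<Psi> t"
      by (simp add: C1_def algebra_simps)
    then show ?thesis using \<kappa>\<Psi>[OF that \<kappa>0] \<kappa>\<Psi>[OF that ln2] by linarith
  qed

  have v_int: "circle_integrable v t" if "0 < t" for t
    unfolding v_def
    by (intro circle_integrable_add circle_integrable_sum circle_integrable_const circle_integrable_ln_plus binv b that) auto
  have v_mean: "circle_mean v t = nev_m (\<lambda>z. inverse (b 0 z)) t + (\<Sum>j\<in>{1..n+1}. nev_m (b j) t) + ln (real n + 2)"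
    if "0 < t" for t
  proof -
    have i1: "circle_integrable (\<lambda>z. ln_plus (norm (inverse (b 0 z)))) t"
      by (intro circle_integrable_ln_plus binv that)
    have i2: "circle_integrable (\<lambda>z. ln_plus (norm (b j z))) t" if "j \<in> {1..n+1}" for j
      using that by (intro circle_integrable_ln_plus b \<open>0 < t\<close>) auto
    have i3: "circle_integrable (\<lambda>z. \<Sum>j\<in>{1..n+1}. ln_plus (norm (b j z))) t"
      by (intro circle_integrable_sum i2)
    have m3: "circle_mean (\<lambda>z. \<Sum>j\<in>{1..n+1}. ln_plus (norm (b j z))) t = (\<Sum>j\<in>{1..n+1}. nev_m (b j) t)"
      unfolding nev_m_eq_circle_mean by (intro circle_mean_sum i2)
    show ?thesis
      unfolding v_def circle_mean_add[OF circle_integrable_add[OF i1 i3] circle_integrable_const]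
        circle_mean_add[OF i1 i3] m3 nev_m_eq_circle_mean circle_mean_const ..
  qed
  have v_large: "circle_mean v t \<le> C1 * \<Psi> t" if t: "t0 \<le> t" for t
  proof -
    have t1: "1 \<le> t" using t t0 by simp
    have "nev_m (b j) t \<le> \<Psi> t" if "j \<in> {1..n+1}" for j
      using T[of j t] nev_N_nonneg(1)[OF b t1, of j] that t by (simp add: nev_T_def)
    then have "(\<Sum>j\<in>{1..n+1}. nev_m (b j) t) \<le> of_nat (card {1..n+1}) * \<Psi> t"
      by (intro sum_bounded_above) auto
    moreover have "nev_m (\<lambda>z. inverse (b 0 z)) t \<le> \<Psi> t + \<kappa>"
      using fmt[OF t] weighted_count_nonneg[of "zero_mult (b 0)" t] by linarith
    ultimately show ?thesis
      using v_mean[of t] t1 C1\<Psi>[OF t] by linarith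
  qed
  have cd: "0 < norm c * \<delta>" using c \<delta> by simp
  \<comment> \<open>Below \<open>t0\<close> nothing is assumed about \<Psi>, so compactness takes
    over. The lower end is |c| \<delta> because all circles that occur have radius |c p^k| r with
    |p|^k r \<ge> \<delta>.\<close>
  have "\<exists>C2. 0 \<le> C2 \<and> (\<forall>t\<in>{norm c * \<delta>..t0}. circle_mean v t \<le> C2)"
  proof -
    obtain Ci where Ci: "\<forall>t\<in>{norm c * \<delta>..t0}. nev_m (\<lambda>z. inverse (b 0 z)) t \<le> Ci"
      using nev_m_bounded[OF binv cd] by blast
    have "\<forall>j\<in>{1..n+1}. \<exists>C. \<forall>t\<in>{norm c * \<delta>..t0}. nev_m (b j) t \<le> C"
      using nev_m_bounded[OF b cd] by auto
    then obtain Cb where Cb: "\<forall>j\<in>{1..n+1}. \<forall>t\<in>{norm c * \<delta>..t0}. nev_m (b j) t \<le> Cb j"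
      by metis
    have "circle_mean v t \<le> \<bar>Ci + (\<Sum>j\<in>{1..n+1}. Cb j) + ln (real n + 2)\<bar>" if t: "t \<in> {norm c * \<delta>..t0}" for t
    proof -
      have "(\<Sum>j\<in>{1..n+1}. nev_m (b j) t) \<le> (\<Sum>j\<in>{1..n+1}. Cb j)"
        using Cb t by (intro sum_mono) auto
      moreover have "nev_m (\<lambda>z. inverse (b 0 z)) t \<le> Ci" using Ci t by blast
      moreover have "0 < t" using t cd by auto
      ultimately show ?thesis using v_mean[of t] by linarith
    qed
    then show ?thesis by (meson abs_ge_zero)
  qed
  then obtain C2 where C2: "0 \<le> C2" "\<And>t. t \<in> {norm c * \<delta>..t0} \<Longrightarrow> circle_mean v t \<le> C2"
    by blast
  have v_all: "circle_mean v t \<le> (C1 + C2) * \<Psi> r" if "norm c * \<delta> \<le> t" "t \<le> r" "t0 \<le> r" for t r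
  proof (cases "t0 \<le> t")
    case True
    have "circle_mean v t \<le> C1 * \<Psi> t" by (rule v_large[OF True])
    also have "\<dots> \<le> C1 * \<Psi> r" using C1 \<Psi>_mono[OF True that(2)] by (intro mult_left_mono)
    also have "\<dots> \<le> (C1 + C2) * \<Psi> r"
      using C2(1) \<Psi>_ge[OF that(3)] by (intro mult_right_mono) auto
    finally show ?thesis .
  next
    case False
    then have "circle_mean v t \<le> C2" using that by (intro C2) auto
    also have "\<dots> \<le> (C1 + C2) * 1" using C1 by simp
    also have "\<dots> \<le> (C1 + C2) * \<Psi> r"
      using C1 C2(1) \<Psi>_ge[OF that(3)] by (intro mult_left_mono) auto
    finally show ?thesis .
  qed

  have D_fin: "finite {z. norm z \<le> r \<and> D z \<noteq> 0}" for r
  proof -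
    have "{z. norm z \<le> r \<and> D z \<noteq> 0} \<subseteq> {z. norm z \<le> r \<and> zero_mult (b 0) z \<noteq> 0} \<union>
      (\<Union>j\<in>{1..n+1}. {z. norm z \<le> r \<and> pole_mult (b j) z \<noteq> 0})"
      by (auto simp: D_def sum_eq_0_iff)
    then show ?thesis
      by (rule finite_subset) (intro finite_UnI finite_UN_I finite_zero_mult[OF b0_nice b0] finite_pole_mult b, auto)
  qed
  have D_count: "weighted_count D r \<le> C1 * \<Psi> r" if r: "t0 \<le> r" for r
  proof -
    have r1: "1 \<le> r" using r t0 by simp
    have fin: "finite {z. norm z \<le> r \<and> pole_mult (b j) z \<noteq> 0}" if "j \<in> {1..n+1}" for j
      using that by (intro finite_pole_mult b) auto
    have fin': "finite {z. norm z \<le> r \<and> (\<Sum>j\<in>{1..n+1}. pole_mult (b j) z) \<noteq> 0}"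
      by (rule finite_subset[OF _ D_fin[of r]]) (auto simp: D_def)
    have "weighted_count D r = weighted_count (zero_mult (b 0)) r + (\<Sum>j\<in>{1..n+1}. weighted_count (pole_mult (b j)) r)"
      unfolding D_def using fin'
      by (subst weighted_count_add[OF finite_zero_mult[OF b0_nice b0]], simp, subst weighted_count_sum) (use fin in auto)
    moreover have "weighted_count (pole_mult (b j)) r \<le> \<Psi> r" if "j \<in> {1..n+1}" for j
      using T[of j r] nev_N_nonneg(2)[OF b r1, of j] nev_m_nonneg[of "b j" r] that r by (simp add: nev_T_def)
    then have "(\<Sum>j\<in>{1..n+1}. weighted_count (pole_mult (b j)) r) \<le> of_nat (card {1..n+1}) * \<Psi> r"
      by (intro sum_bounded_above) auto
    moreover have "weighted_count (zero_mult (b 0)) r \<le> \<Psi> r + \<kappa>"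
      using fmt[OF r] nev_m_nonneg[of "\<lambda>z. inverse (b 0 z)" r] by linarith
    ultimately show ?thesis
      using C1\<Psi>[OF r] ln2 by linarith
  qed

  have N_bound: "weighted_count (pole_mult f) r \<le> real K * (C1 * \<Psi> r)"
    if r: "t0 \<le> r" and K: "norm p ^ K * r < \<delta>" for r K
  proof -
    let ?F = "{z. 0 < norm z \<and> norm z \<le> r \<and> pole_mult f z \<noteq> 0}"
    have finF: "finite ?F"
      by (rule finite_subset[OF _ finite_pole_mult[OF f, of r]]) auto
    \<comment> \<open>The multiplicity recurrence holds everywhere, hence the invariant set is
      \<open>UNIV\<close>; the base constant is 0 because f has no poles in the punctured
      disc.\<close>
    have unw: "real (pole_mult f z) \<le> (\<Sum>k<K. real (D (c * (p ^ k * z)))) + 0" if z: "z \<in> ?F" for z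
    proof (rule dilation_recurrence_unwind[of p \<delta> "\<lambda>z. real (D (c * z))" UNIV n "\<lambda>z. real (pole_mult f z)"])
      fix z M assume M: "0 \<le> M" "\<And>j. j \<in> {1..n} \<Longrightarrow> real (pole_mult f (p ^ j * z)) \<le> M"
      \<comment> \<open>Multiplicities are natural numbers, so the real bound \<open>M\<close> may
        be rounded down before the recurrence is applied.\<close>
      have "pole_mult f z \<le> (zero_mult (b 0) (c * z) + (\<Sum>j\<in>{1..n+1}. pole_mult (b j) (c * z))) + nat \<lfloor>M\<rfloor>"
        using M(2) by (intro dilation_equation_pole_mult[OF p(1) c(1) b b0 f eq]) (auto simp: le_nat_floor)
      then have "real (pole_mult f z) \<le> real (D (c * z)) + real (nat \<lfloor>M\<rfloor>)"
        unfolding D_def by linarith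
      also have "real (nat \<lfloor>M\<rfloor>) \<le> M" using M(1) by simp
      finally show "real (pole_mult f z) \<le> real (D (c * z)) + M" by simp
    next
      fix z :: complex assume z: "norm p ^ n * \<delta> \<le> norm z" "norm z < \<delta>"
      have "z \<noteq> 0" using z(1) pn by auto
      then show "real (pole_mult f z) \<le> 0"
        using \<delta>(2)[of z] z(2) by (simp add: pole_mult_def)
    next
      have "is_pole f z" using z by (auto simp: pole_mult_def split: if_splits)
      then have "\<delta> < norm z" using \<delta>(2)[of z] z by fastforce
      moreover have "norm p ^ n * \<delta> \<le> 1 * \<delta>"
        using p \<delta> by (intro mult_right_mono power_le_one) auto
      ultimately show "norm p ^ n * \<delta> \<le> norm z" by simp
      have "norm (p ^ K * z) \<le> norm p ^ K * r"
        using z by (auto simp: norm_mult norm_power intro!: mult_left_mono)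
      then show "norm (p ^ K * z) < \<delta>" using K by linarith
    qed (use p \<delta> in auto)
    have "weighted_count (pole_mult f) r \<le> (\<Sum>z\<in>?F. (\<Sum>k<K. real (D (c * (p ^ k * z)))) * ln (r / norm z))"
      unfolding weighted_count_def
      by (intro sum_mono mult_right_mono ln_ge_zero) (use unw in auto)
    also have "\<dots> = (\<Sum>k<K. \<Sum>z\<in>?F. real (D ((c * p ^ k) * z)) * ln (r / norm z))"
      unfolding sum_distrib_right mult.assoc by (rule sum.swap)
    also have "\<dots> \<le> (\<Sum>k<K. weighted_count D r)"
    proof (rule sum_mono)
      fix k
      have "norm c * norm p ^ k \<le> 1"
        using c p by (intro mult_le_one power_le_one) auto
      then show "(\<Sum>z\<in>?F. real (D ((c * p ^ k) * z)) * ln (r / norm z)) \<le> weighted_count D r"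
        using c p by (intro weighted_count_dilate_le finF D_fin) (auto simp: norm_mult norm_power)
    qed
    also have "\<dots> \<le> real K * (C1 * \<Psi> r)"
      using D_count[OF r] by (simp add: mult_left_mono)
    finally show ?thesis .
  qed

  have m_bound: "nev_m f r \<le> real K * ((C1 + C2) * \<Psi> r) + B"
    if r: "t0 \<le> r" and K: "norm p ^ K * r < \<delta>" "\<forall>k<K. \<delta> \<le> norm p ^ k * r" and rd: "norm p ^ n * \<delta> \<le> r" for r K
  proof -
    have r0: "0 < r" using r t0 by simp
    define ok where "ok = (\<lambda>z. f z = inverse (b 0 (c * z)) * (b (n+1) (c * z) - (\<Sum>j\<in>{1..n}. b j (c * z) * f (p ^ j * z))))"
    have ok: "\<forall>\<^sub>\<approx>z. ok z"
      unfolding ok_def by (rule dilation_equation_solved[OF c(1) b0_nice b0 eq])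
    \<comment> \<open>The equation is demanded only while the orbit stays outside the disc of radius
      \<delta>. For |z| = r this concerns the indices k < K, so only finitely many points of the
      circle fall outside \<open>G\<close>.\<close>
    define G where "G = {z. \<forall>k. \<delta> \<le> norm (p ^ k * z) \<longrightarrow> ok (p ^ k * z)}"
    let ?v = "\<lambda>z. (\<Sum>k<K. v (c * (p ^ k * z))) + B"
    have unw: "ln_plus (norm (f z)) \<le> ?v z" if z: "norm z = r" "z \<in> G" for z
    proof (rule dilation_recurrence_unwind[of p \<delta> "\<lambda>z. v (c * z)" G n "\<lambda>z. ln_plus (norm (f z))"])
      fix z assume "z \<in> G"
      then have "\<delta> \<le> norm (p ^ Suc k * z) \<longrightarrow> ok (p ^ Suc k * z)" for k
        unfolding G_def by blast
      then show "p * z \<in> G" by (auto simp: G_def mult_ac)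
    next
      fix z M assume z: "z \<in> G" "\<delta> \<le> norm z" and M: "0 \<le> M" "\<And>j. j \<in> {1..n} \<Longrightarrow> ln_plus (norm (f (p ^ j * z))) \<le> M"
      have "ok z" using z unfolding G_def by (auto dest: spec[of _ 0])
      then show "ln_plus (norm (f z)) \<le> v (c * z) + M"
        unfolding v_def ok_def using M by (intro dilation_equation_ln_plus) auto
    qed (use z p \<delta> B v_nonneg rd K in \<open>auto simp: norm_mult norm_power\<close>)
    have fin: "finite {z. norm z = \<bar>r\<bar> \<and> \<not> ln_plus (norm (f z)) \<le> ?v z}"
    proof (rule finite_subset)
      show "finite (\<Union>k<K. {z. norm z \<le> r \<and> \<not> ok (p ^ k * z)})"
        using p by (intro finite_UN_I cosparse_imp_finite cosparse_scale[OF ok]) auto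
      have "\<exists>k<K. \<not> ok (p ^ k * z)" if z: "norm z = r" "\<not> ln_plus (norm (f z)) \<le> ?v z" for z
      proof -
        have "z \<notin> G" using unw z by blast
        then obtain k where k: "\<delta> \<le> norm (p ^ k * z)" "\<not> ok (p ^ k * z)"
          by (auto simp: G_def)
        have "k < K"
        proof (rule ccontr)
          assume "\<not> k < K"
          then have "norm p ^ k \<le> norm p ^ K" using p by (intro power_decreasing) auto
          then have "norm p ^ k * r \<le> norm p ^ K * r" using r0 by (intro mult_right_mono) auto
          then show False using k(1) z K(1) by (simp add: norm_mult norm_power)
        qed
        with k show ?thesis by blast
      qed
      then show "{z. norm z = \<bar>r\<bar> \<and> \<not> ln_plus (norm (f z)) \<le> ?v z} \<subseteq> (\<Union>k<K. {z. norm z \<le> r \<and> \<not> ok (p ^ k * z)})"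
        using r0 by fastforce
    qed
    have rot: "circle_integrable (\<lambda>z. v (c * (p ^ k * z))) r"
        "circle_mean (\<lambda>z. v (c * (p ^ k * z))) r = circle_mean v (norm (c * p ^ k) * r)" for k
    proof -
      have "circle_integrable v (norm (c * p ^ k) * r)"
        using c p r0 by (intro v_int) auto
      from circle_rotate[OF _ this] c p
      show "circle_integrable (\<lambda>z. v (c * (p ^ k * z))) r"
        "circle_mean (\<lambda>z. v (c * (p ^ k * z))) r = circle_mean v (norm (c * p ^ k) * r)"
        by (auto simp: mult.assoc)
    qed
    have "nev_m f r \<le> circle_mean ?v r"
      unfolding nev_m_eq_circle_mean using r0
      by (intro circle_mean_mono_ae fin circle_integrable_ln_plus f circle_integrable_add circle_integrable_sum rot(1)) auto
    also have "\<dots> = (\<Sum>k<K. circle_mean v (norm (c * p ^ k) * r)) + B"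
      by (simp add: circle_mean_add[OF circle_integrable_sum[OF rot(1)] circle_integrable_const] circle_mean_sum[OF rot(1)] rot(2))
    also have "(\<Sum>k<K. circle_mean v (norm (c * p ^ k) * r)) \<le> of_nat (card {..<K}) * ((C1 + C2) * \<Psi> r)"
    proof (rule sum_bounded_above)
      fix k assume "k \<in> {..<K}"
      then have "\<delta> \<le> norm p ^ k * r" using K by auto
      then have 1: "norm c * \<delta> \<le> norm (c * p ^ k) * r"
        using c by (simp add: norm_mult norm_power mult.assoc mult_left_mono)
      have "norm (c * p ^ k) \<le> 1"
        unfolding norm_mult norm_power using c p by (intro mult_le_one power_le_one) auto
      then have 2: "norm (c * p ^ k) * r \<le> r"
        using mult_right_mono[of "norm (c * p ^ k)" 1 r] r0 by simp
      show "circle_mean v (norm (c * p ^ k) * r) \<le> (C1 + C2) * \<Psi> r"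
        by (rule v_all[OF 1 2 r])
    qed
    finally show ?thesis by simp
  qed

  \<comment> \<open>Per step the proximity function costs C1 + C2 and the counting function C1. The
    base constant \<open>B\<close> and the pole of f at the origin are absorbed through \<Psi> \<ge>
    1 and ln r \<ge> 1.\<close>
  define E where "E = \<bar>CK\<bar> * (2 * C1 + C2) + B + real (pole_mult f 0)"
  have "nev_T f r \<le> E * ln r * \<Psi> r" if r: "max t0 (max (exp 1) \<delta>) \<le> r" for r
  proof -
    have r': "t0 \<le> r" "exp 1 \<le> r" "\<delta> \<le> r" using r by auto
    have r0: "0 < r" using r'(1) t0 by simp
    have lr: "1 \<le> ln r" using r'(2) r0 by (metis exp_gt_zero ln_exp ln_mono)
    have \<Psi>1: "1 \<le> \<Psi> r" by (rule \<Psi>_ge[OF r'(1)])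
    have lr\<Psi>: "1 \<le> ln r * \<Psi> r" "ln r \<le> ln r * \<Psi> r"
      using lr \<Psi>1 mult_mono[of 1 "ln r" 1 "\<Psi> r"] mult_left_mono[of 1 "\<Psi> r" "ln r"] by auto
    obtain K where K: "norm p ^ K * r < \<delta>" "\<forall>k<K. \<delta> \<le> norm p ^ k * r" "real K \<le> CK * ln r"
      using CK[OF r'(2)] by blast
    have "norm p ^ n * \<delta> \<le> 1 * \<delta>"
      using p \<delta> by (intro mult_right_mono power_le_one) auto
    then have rd: "norm p ^ n * \<delta> \<le> r" using r' by simp
    have K': "real K \<le> \<bar>CK\<bar> * ln r"
      using K(3) lr by (meson abs_ge_self mult_right_mono order_trans zero_le_one)
    have "nev_T f r \<le> (real K * ((C1 + C2) * \<Psi> r) + B) + (real K * (C1 * \<Psi> r) + real (pole_mult f 0) * ln r)"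
      unfolding nev_T_def nev_N_eq[OF f r0]
      using m_bound[OF r'(1) K(1,2) rd] N_bound[OF r'(1) K(1)] by linarith
    also have "\<dots> = real K * ((2 * C1 + C2) * \<Psi> r) + B + real (pole_mult f 0) * ln r"
      by (simp add: algebra_simps)
    also have "real K * ((2 * C1 + C2) * \<Psi> r) \<le> (\<bar>CK\<bar> * ln r) * ((2 * C1 + C2) * \<Psi> r)"
      using K' C1 C2(1) \<Psi>1 by (intro mult_right_mono) auto
    also have "B \<le> B * (ln r * \<Psi> r)"
      using mult_left_mono[OF lr\<Psi>(1) B(1)] by simp
    also have "real (pole_mult f 0) * ln r \<le> real (pole_mult f 0) * (ln r * \<Psi> r)"
      using lr\<Psi>(2) by (intro mult_left_mono) auto
    finally show ?thesis by (simp add: E_def algebra_simps)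
  qed
  then show ?thesis
    unfolding eventually_at_top_linorder by blast
qed

lemma nev_T_q_difference_equation:
  fixes a :: "nat \<Rightarrow> complex \<Rightarrow> complex" and \<Psi> :: "real \<Rightarrow> real"
  assumes q: "q \<noteq> 0" "norm q \<noteq> 1"
    and a: "\<And>j. j \<le> n + 1 \<Longrightarrow> a j nicely_meromorphic_on UNIV"
    and a0n: "a 0 w0 \<noteq> 0" "a n w1 \<noteq> 0" and f: "f nicely_meromorphic_on UNIV"
    and eq: "\<forall>\<^sub>\<approx>z. (\<Sum>j\<le>n. a j z * f (q ^ j * z)) = a (n+1) z"
    and t0: "1 \<le> t0" and \<Psi>_mono: "\<And>x y. t0 \<le> x \<Longrightarrow> x \<le> y \<Longrightarrow> \<Psi> x \<le> \<Psi> y"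
    and \<Psi>_ge: "\<And>x. t0 \<le> x \<Longrightarrow> 1 \<le> \<Psi> x"
    and T: "\<And>j t. j \<le> n + 1 \<Longrightarrow> t0 \<le> t \<Longrightarrow> nev_T (a j) t \<le> \<Psi> t"
  shows "\<exists>C. \<forall>\<^sub>F r in at_top. nev_T f r \<le> C * ln r * \<Psi> r"
proof (cases "norm q < 1")
  case True
  show ?thesis
    by (rule nev_T_dilation_equation[where p = q and c = 1 and b = a and n = n and ?w0.0 = w0 and ?t0.0 = t0])
       (use True assms in auto)
next
  case False
  define p where "p = inverse q"
  \<comment> \<open>Only the indices up to n are reversed; index n + 1 carries the inhomogeneous
    term and stays. The leading coefficient is now \<open>a n\<close>, which is why the witness
    \<open>w1\<close> takes over.\<close>
  define b where "b = (\<lambda>j. if j \<le> n then a (n - j) else a j)"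
  have p: "p \<noteq> 0" "norm p < 1"
    using q False by (auto simp: p_def norm_inverse inverse_less_1_iff)
  have pq: "q ^ j * (p ^ n * z) = p ^ (n - j) * z" if "j \<le> n" for j z
  proof -
    have "q ^ j * p ^ j = 1"
      using q by (simp add: p_def flip: power_mult_distrib)
    moreover have "p ^ n = p ^ j * p ^ (n - j)"
      using that by (simp flip: power_add)
    ultimately show ?thesis by (simp add: mult.assoc[symmetric])
  qed
  have "\<forall>\<^sub>\<approx>z. (\<Sum>j\<le>n. a j (p ^ n * z) * f (q ^ j * (p ^ n * z))) = a (n+1) (p ^ n * z)"
    using cosparse_scale[OF eq, of "p ^ n"] p by simp
  then have eq': "\<forall>\<^sub>\<approx>z. (\<Sum>j\<le>n. b j (p ^ n * z) * f (p ^ j * z)) = b (n+1) (p ^ n * z)"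
  proof eventually_elim
    case (elim z)
    have "(\<Sum>j\<le>n. a j (p ^ n * z) * f (q ^ j * (p ^ n * z))) = (\<Sum>j\<le>n. b j (p ^ n * z) * f (p ^ j * z))"
      by (rule sum.reindex_bij_witness[of _ "\<lambda>j. n - j" "\<lambda>j. n - j"])
         (auto simp: b_def pq)
    with elim show ?case by (simp add: b_def)
  qed
  show ?thesis
  proof (rule nev_T_dilation_equation[where p = p and c = "p ^ n" and b = b and n = n and ?w0.0 = w1 and ?t0.0 = t0])
    show "norm (p ^ n) \<le> 1"
      using p by (auto simp: norm_power intro: power_le_one)
  qed (use p a a0n f eq' t0 \<Psi>_mono \<Psi>_ge T in \<open>auto simp: b_def\<close>)
qed

section \<open>From characteristics to \<phi>-orders, and relations between \<alpha>, \<beta> and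
  \<gamma>\<close>

lemma nev_T_const:
  assumes "\<And>z. f z = c"
  shows "nev_T f r = ln_plus (norm c)"
proof -
  have "\<not> is_pole f z" for z
    using assms not_is_pole_const[of c z] by (simp add: assms[abs_def] ext)
  then show ?thesis
    by (simp add: nev_T_def nev_m_eq_circle_mean nev_N_def pole_count_def assms)
qed

text \<open>From ln r \<le> \<phi> r the quotient lies eventually in [0, 1]. Finiteness allows the
  final bound to be computed with real numbers.\<close>

lemma beta_phi_bounds:
  assumes unb: "filterlim \<phi> at_top at_top" and le: "\<forall>\<^sub>F r in at_top. ln r \<le> \<phi> r"
  obtains \<beta> where "beta_phi \<phi> = ereal \<beta>" "0 \<le> \<beta>"
proof -
  have ev: "\<forall>\<^sub>F r in at_top. 1 < \<phi> r"
    using unb by (simp add: filterlim_at_top_dense)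
  have r: "\<forall>\<^sub>F r in at_top. exp 1 < (r::real)"
    by (rule eventually_gt_at_top)
  have "\<forall>\<^sub>F r in at_top. 0 \<le> ln (ln r) / ln (\<phi> r) \<and> ln (ln r) / ln (\<phi> r) \<le> 1"
    using ev le r
  proof eventually_elim
    case (elim r)
    have r0: "0 < r" using elim(3) exp_gt_zero[of "1::real"] by linarith
    then have "1 < ln r" using elim(3) by (metis exp_less_cancel_iff exp_ln)
    then have "0 \<le> ln (ln r)" "ln (ln r) \<le> ln (\<phi> r)" using elim by auto
    then show ?case using elim by (auto simp: divide_simps)
  qed
  then have "\<forall>\<^sub>F r in at_top. 0 \<le> ereal (ln (ln r) / ln (\<phi> r))" "\<forall>\<^sub>F r in at_top. ereal (ln (ln r) / ln (\<phi> r)) \<le> 1"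
    by (auto elim!: eventually_mono)
  then have "0 \<le> beta_phi \<phi>" "beta_phi \<phi> \<le> 1"
    unfolding beta_phi_def by (auto intro!: le_Limsup Limsup_bounded)
  then show ?thesis
    by (cases "beta_phi \<phi>") (auto intro: that)
qed

lemma phi_order_le:
  assumes unb: "filterlim \<phi> at_top at_top" and le: "\<forall>\<^sub>F r in at_top. ln r \<le> \<phi> r"
    and f: "f nicely_meromorphic_on UNIV" and \<sigma>: "0 \<le> \<sigma>"
    and T: "\<forall>\<^sub>F r in at_top. nev_T f r \<le> C * ln r * \<phi> r powr \<sigma>"
  shows "phi_order \<phi> f \<le> beta_phi \<phi> + ereal \<sigma>"
proof -
  obtain \<beta> where \<beta>: "beta_phi \<phi> = ereal \<beta>" "0 \<le> \<beta>"
    using beta_phi_bounds[OF unb le] .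
  \<comment> \<open>D \<ge> 1 makes ln D non-negative, as needed where \<open>nev_T f r = 0\<close>
    and its logarithm is 0 by convention.\<close>
  define D where "D = max C 1"
  have ev: "\<forall>\<^sub>F r in at_top. 1 < \<phi> r"
    using unb by (simp add: filterlim_at_top_dense)
  have r: "\<forall>\<^sub>F r in at_top. exp 1 < (r::real)"
    by (rule eventually_gt_at_top)
  have bound: "\<forall>\<^sub>F r in at_top. ln (nev_T f r) / ln (\<phi> r) \<le> ln D / ln (\<phi> r) + ln (ln r) / ln (\<phi> r) + \<sigma>"
    using ev r T
  proof eventually_elim
    case (elim r)
    have r0: "0 < r" using elim(2) exp_gt_zero[of "1::real"] by linarith
    have lr: "1 < ln r" using elim(2) r0 by (metis exp_less_cancel_iff exp_ln)
    have L: "0 < ln (\<phi> r)" using elim(1) by simp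
    have D: "1 \<le> D" by (simp add: D_def)
    have "ln (nev_T f r) \<le> ln D + ln (ln r) + \<sigma> * ln (\<phi> r)"
    proof (cases "nev_T f r = 0")
      case True
      then show ?thesis using D lr L \<sigma> by (auto intro!: add_nonneg_nonneg)
    next
      case False
      have "1 \<le> r" using elim(2) one_le_exp_iff[of "1::real"] by linarith
      then have "0 < nev_T f r" using nev_T_nonneg[OF f] False by (metis less_eq_real_def)
      moreover have "C * ln r * \<phi> r powr \<sigma> \<le> D * ln r * \<phi> r powr \<sigma>"
        using lr by (intro mult_right_mono) (auto simp: D_def)
      ultimately have "ln (nev_T f r) \<le> ln (D * ln r * \<phi> r powr \<sigma>)"
        using elim(3) by (intro ln_mono) auto
      also have "\<dots> = ln D + ln (ln r) + \<sigma> * ln (\<phi> r)"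
        using D lr elim(1) by (simp add: ln_mult ln_powr)
      finally show ?thesis .
    qed
    then have "ln (nev_T f r) / ln (\<phi> r) \<le> (ln D + ln (ln r) + \<sigma> * ln (\<phi> r)) / ln (\<phi> r)"
      using L by (intro divide_right_mono) auto
    also have "\<dots> = ln D / ln (\<phi> r) + ln (ln r) / ln (\<phi> r) + \<sigma>"
      using L by (simp add: add_divide_distrib)
    finally show ?case .
  qed
  have "phi_order \<phi> f \<le> ereal (\<beta> + \<sigma> + e)" if e: "0 < e" for e
  proof -
    have "Limsup at_top (\<lambda>r. ereal (ln (ln r) / ln (\<phi> r))) < ereal (\<beta> + e / 2)"
      using \<beta> e unfolding beta_phi_def by simp
    then have 1: "\<forall>\<^sub>F r in at_top. ln (ln r) / ln (\<phi> r) < \<beta> + e / 2"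
      by (auto dest: Limsup_lessD)
    have "filterlim (\<lambda>r. ln (\<phi> r)) at_top at_top"
      by (rule filterlim_compose[OF ln_at_top unb])
    then have "((\<lambda>r. ln D / ln (\<phi> r)) \<longlongrightarrow> 0) at_top"
      by (intro tendsto_divide_0[OF tendsto_const] filterlim_at_top_imp_at_infinity)
    then have 2: "\<forall>\<^sub>F r in at_top. ln D / ln (\<phi> r) < e / 2"
      using e by (intro order_tendstoD) auto
    have "\<forall>\<^sub>F r in at_top. ereal (ln (nev_T f r) / ln (\<phi> r)) \<le> ereal (\<beta> + \<sigma> + e)"
      using 1 2 bound
    proof eventually_elim
      case (elim r)
      then have "ln (nev_T f r) / ln (\<phi> r) \<le> \<beta> + \<sigma> + e" by linarith
      then show ?case by simp
    qed
    then show ?thesis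
      unfolding phi_order_def phi_order_fun_def by (rule Limsup_bounded)
  qed
  then have "phi_order \<phi> f \<le> ereal (\<beta> + \<sigma>)"
    by (intro ereal_le_epsilon2[of _ "ereal (\<beta> + \<sigma>)"] allI impI) simp
  then show ?thesis by (simp add: \<beta>)
qed

lemma phi_order_nonneg:
  assumes unb: "filterlim \<phi> at_top at_top"
    and f: "f nicely_meromorphic_on UNIV" and nc: "\<not> (\<exists>c. \<forall>z. f z = c)"
  shows "0 \<le> phi_order \<phi> f"
proof -
  obtain C where C: "\<forall>r\<ge>1. ln r - C \<le> nev_T f r"
    using nev_T_nonconstant_lower_bound[OF f nc] by blast
  have ev: "\<forall>\<^sub>F r in at_top. 1 < \<phi> r"
    using unb by (simp add: filterlim_at_top_dense)
  have "\<forall>\<^sub>F r in at_top. C + 1 < ln r"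
    using ln_at_top by (simp add: filterlim_at_top_dense)
  moreover have "\<forall>\<^sub>F r in at_top. (1::real) < r"
    by (rule eventually_gt_at_top)
  ultimately have "\<forall>\<^sub>F r in at_top. 0 \<le> ereal (ln (nev_T f r) / ln (\<phi> r))"
    using ev
  proof eventually_elim
    case (elim r)
    then have "1 < nev_T f r" using C[rule_format, of r] by linarith
    then show ?case using elim(3) by simp
  qed
  then show ?thesis
    unfolding phi_order_def phi_order_fun_def by (intro le_Limsup) auto
qed

text \<open>Evaluating the quotient in the definition of \<open>\<gamma>\<close> at \<open>s r\<close> instead of \<open>r\<close>, along those
  \<open>r\<close> that realise \<open>\<alpha>\<close>, costs only the factor \<open>\<alpha>\<close>, because \<open>s (s r) / s r \<le> s r \<le> r\<^sup>2\<close>.\<close>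

lemma gamma_le_alpha_beta:
  assumes unb: "filterlim \<phi> at_top at_top"
    and s_bounds: "\<forall>r>R0. r < s r \<and> s r \<le> r\<^sup>2"
    and \<alpha>: "alpha_phi_s \<phi> s = ereal \<alpha>" "0 \<le> \<alpha>" and \<beta>: "beta_phi \<phi> = ereal \<beta>" "0 \<le> \<beta>"
    and \<gamma>: "gamma_phi_s \<phi> s = ereal \<gamma>"
  shows "\<gamma> \<le> \<alpha> * \<beta>"
proof (rule ccontr)
  assume less: "\<not> \<gamma> \<le> \<alpha> * \<beta>"
  \<comment> \<open>Expanding, (\<alpha> + e)(\<beta> + e) + e = \<alpha>\<beta> + e(\<alpha> +
    \<beta> + e + 1); with e \<le> 1 the last bracket is below \<alpha> + \<beta> + 3, so the whole
    stays below \<gamma>.\<close>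
  define e where "e = min 1 ((\<gamma> - \<alpha> * \<beta>) / (\<alpha> + \<beta> + 3))"
  have e: "0 < e" "e \<le> 1" using less \<alpha> \<beta> by (auto simp: e_def)
  have "e \<le> (\<gamma> - \<alpha> * \<beta>) / (\<alpha> + \<beta> + 3)" unfolding e_def by simp
  then have "e * (\<alpha> + \<beta> + 3) \<le> \<gamma> - \<alpha> * \<beta>"
    using \<alpha>(2) \<beta>(2) by (subst (asm) pos_le_divide_eq) auto
  moreover have "e * (\<alpha> + \<beta> + e + 1) < e * (\<alpha> + \<beta> + 3)"
    using e by (intro mult_strict_left_mono) auto
  ultimately have e3: "(\<alpha> + e) * (\<beta> + e) + e < \<gamma>"
    by (simp add: algebra_simps)
  have s_lim: "filterlim s at_top at_top"
  proof (rule filterlim_at_top_mono[OF filterlim_ident])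
    show "\<forall>\<^sub>F r in at_top. r \<le> s r"
      using eventually_gt_at_top[of R0] by eventually_elim (use s_bounds in force)
  qed
  have \<phi>s_lim: "filterlim (\<lambda>r. \<phi> (s r)) at_top at_top"
    by (rule filterlim_compose[OF unb s_lim])
  have "ereal ((\<alpha> + e) * (\<beta> + e) + e) < Liminf at_top (\<lambda>r. ereal (ln (ln (s r / r)) / ln (\<phi> r)))"
    using e3 \<gamma> unfolding gamma_phi_s_def by simp
  then have "\<forall>\<^sub>F r in at_top. ereal ((\<alpha> + e) * (\<beta> + e) + e) < ereal (ln (ln (s r / r)) / ln (\<phi> r))"
    by (rule less_LiminfD)
  then have 1: "\<forall>\<^sub>F r in at_top. (\<alpha> + e) * (\<beta> + e) + e < ln (ln (s (s r) / s r)) / ln (\<phi> (s r))"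
    using s_lim by (auto dest: eventually_compose_filterlim)
  have "Limsup at_top (\<lambda>r. ereal (ln (ln r) / ln (\<phi> r))) < ereal (\<beta> + e)"
    using \<beta> e unfolding beta_phi_def by simp
  then have 2: "\<forall>\<^sub>F r in at_top. ereal (ln (ln r) / ln (\<phi> r)) < ereal (\<beta> + e)"
    by (rule Limsup_lessD)
  have "filterlim (\<lambda>r. ln (\<phi> (s r))) at_top at_top"
    by (rule filterlim_compose[OF ln_at_top \<phi>s_lim])
  then have "((\<lambda>r. ln 2 / ln (\<phi> (s r))) \<longlongrightarrow> 0) at_top"
    by (intro tendsto_divide_0[OF tendsto_const] filterlim_at_top_imp_at_infinity)
  then have 3: "\<forall>\<^sub>F r in at_top. ln 2 / ln (\<phi> (s r)) < e"
    using e by (intro order_tendstoD) auto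
  have 4: "\<forall>\<^sub>F r in at_top. 1 < \<phi> r" "\<forall>\<^sub>F r in at_top. 1 < \<phi> (s r)"
    using unb \<phi>s_lim by (simp_all add: filterlim_at_top_dense)
  have 5: "\<forall>\<^sub>F r in at_top. max R0 (exp 1) < r"
    by (rule eventually_gt_at_top)
  \<comment> \<open>The contradiction aimed at: the quotient whose lower limit is \<alpha> would
    eventually stay above \<alpha> + e.\<close>
  have "\<forall>\<^sub>F r in at_top. ereal (\<alpha> + e) \<le> ereal (ln (\<phi> r) / ln (\<phi> (s r)))"
    using 1 2 3 4 5
  proof eventually_elim
    case (elim r)
    have r: "R0 < r" "exp 1 < r" using elim by auto
    have r0: "0 < r" using r(2) exp_gt_zero[of "1::real"] by linarith
    have lr: "1 < ln r" using r(2) r0 by (metis exp_less_cancel_iff exp_ln)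
    have sr: "r < s r" "s r \<le> r\<^sup>2" using s_bounds r by auto
    have ssr: "s r < s (s r)" "s (s r) \<le> (s r)\<^sup>2" using s_bounds[rule_format, of "s r"] r sr by auto
    have s0: "0 < s r" using sr r0 by simp
    have q1: "1 < s (s r) / s r" using ssr s0 by simp
    have "s (s r) / s r \<le> s r" using ssr s0 by (simp add: field_simps power2_eq_square)
    also have "\<dots> \<le> r\<^sup>2" by (rule sr(2))
    finally have "ln (s (s r) / s r) \<le> ln (r\<^sup>2)" using q1 by (intro ln_mono) auto
    also have "\<dots> = 2 * ln r" using r0 by (simp add: ln_realpow)
    finally have "ln (ln (s (s r) / s r)) \<le> ln (2 * ln r)" using q1 by (intro ln_mono) auto
    also have "\<dots> = ln 2 + ln (ln r)" using lr by (simp add: ln_mult)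
    finally have le: "ln (ln (s (s r) / s r)) \<le> ln 2 + ln (ln r)" .
    let ?L = "ln (\<phi> (s r))" and ?M = "ln (\<phi> r)"
    have L: "0 < ?L" "0 < ?M" using elim by auto
    have "(\<alpha> + e) * (\<beta> + e) + e < (ln 2 + ln (ln r)) / ?L"
      using elim(1) divide_right_mono[OF le, of ?L] L by linarith
    also have "\<dots> = ln 2 / ?L + (ln (ln r) / ?M) * (?M / ?L)"
      using L by (simp add: add_divide_distrib)
    also have "\<dots> \<le> e + (\<beta> + e) * (?M / ?L)"
      using elim(2,3) L by (intro add_mono mult_right_mono) auto
    finally have "(\<beta> + e) * (\<alpha> + e) < (\<beta> + e) * (?M / ?L)"
      by (simp add: mult.commute)
    then have "\<alpha> + e < ?M / ?L"
      using \<beta> e by (simp only: mult_less_cancel_left_pos)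
    then show ?case by simp
  qed
  then have "ereal (\<alpha> + e) \<le> alpha_phi_s \<phi> s"
    unfolding alpha_phi_s_def by (rule Liminf_bounded)
  then show False using \<alpha> e by simp
qed

lemma alpha_le_1:
  assumes unb: "filterlim \<phi> at_top at_top" and mono: "mono_on {R0<..} \<phi>"
    and s_bounds: "\<forall>r>R0. r < s r \<and> s r \<le> r\<^sup>2"
  shows "alpha_phi_s \<phi> s \<le> 1"
proof -
  have ev: "\<forall>\<^sub>F r in at_top. 1 < \<phi> r"
    using unb by (simp add: filterlim_at_top_dense)
  have "\<forall>\<^sub>F r in at_top. ereal (ln (\<phi> r) / ln (\<phi> (s r))) \<le> 1"
    using ev eventually_gt_at_top[of R0]
  proof eventually_elim
    case (elim r)
    have "\<phi> r \<le> \<phi> (s r)"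
      using s_bounds elim by (intro mono_onD[OF mono]) (auto intro: less_imp_le less_trans)
    then show ?case using elim by simp
  qed
  then have "Limsup at_top (\<lambda>r. ereal (ln (\<phi> r) / ln (\<phi> (s r)))) \<le> 1"
    by (rule Limsup_bounded)
  then show ?thesis
    unfolding alpha_phi_s_def using Liminf_le_Limsup[of at_top] by (meson order_trans trivial_limit_at_top_linorder)
qed

text \<open>From below, a constant k > 1 under the lower limit of s r / r makes the numerator at
  least ln (ln k), which ln (\<phi> r) eventually outweighs. From above, s r / r \<le> r and ln r
  \<le> \<phi> r.\<close>

lemma gamma_bounds:
  assumes unb: "filterlim \<phi> at_top at_top" and le: "\<forall>\<^sub>F r in at_top. ln r \<le> \<phi> r"
    and s_bounds: "\<forall>r>R0. r < s r \<and> s r \<le> r\<^sup>2"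
    and s_liminf: "Liminf at_top (\<lambda>r. ereal (s r / r)) > 1"
  obtains \<gamma> where "gamma_phi_s \<phi> s = ereal \<gamma>"
proof -
  obtain k where k: "1 < ereal k" "ereal k < Liminf at_top (\<lambda>r. ereal (s r / r))"
    using ereal_dense2[OF s_liminf] by blast
  have 1: "\<forall>\<^sub>F r in at_top. ereal k < ereal (s r / r)"
    using k(2) by (rule less_LiminfD)
  have ev: "\<forall>\<^sub>F r in at_top. exp \<bar>ln (ln k)\<bar> < \<phi> r"
    using unb by (simp add: filterlim_at_top_dense)
  have ev1: "\<forall>\<^sub>F r in at_top. 1 < \<phi> r"
    using unb by (simp add: filterlim_at_top_dense)
  have "\<forall>\<^sub>F r in at_top. ereal (-1) \<le> ereal (ln (ln (s r / r)) / ln (\<phi> r)) \<and>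
      ereal (ln (ln (s r / r)) / ln (\<phi> r)) \<le> 1"
    using 1 ev ev1 le eventually_gt_at_top[of "max R0 1"]
  proof eventually_elim
    case (elim r)
    have r: "R0 < r" "1 < r" using elim by auto
    have L: "0 < ln (\<phi> r)" using elim by simp
    have k1: "1 < k" using k(1) by simp
    have kq: "k < s r / r" using elim(1) by simp
    have q1: "1 < s r / r" using kq k1 by simp
    have lower: "ln (ln k) \<le> ln (ln (s r / r))" using kq k1 q1 by (intro ln_mono) auto
    have "\<bar>ln (ln k)\<bar> < ln (\<phi> r)"
      using elim(2) by (metis exp_gt_zero exp_ln exp_less_cancel_iff less_trans)
    then have lower': "- ln (\<phi> r) \<le> ln (ln (s r / r))" using lower by linarith
    have "s r \<le> r\<^sup>2" using s_bounds r by blast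
    then have "s r / r \<le> r" using r by (simp add: field_simps power2_eq_square)
    then have "ln (s r / r) \<le> ln r" using q1 by (intro ln_mono) auto
    also have "\<dots> \<le> \<phi> r" by (rule elim(4))
    finally have "ln (ln (s r / r)) \<le> ln (\<phi> r)" using q1 by (intro ln_mono) auto
    with lower' L show ?case by (simp add: field_simps)
  qed
  then have A: "\<forall>\<^sub>F r in at_top. ereal (-1) \<le> ereal (ln (ln (s r / r)) / ln (\<phi> r))"
    and B: "\<forall>\<^sub>F r in at_top. ereal (ln (ln (s r / r)) / ln (\<phi> r)) \<le> 1"
    by (auto elim: eventually_mono)
  have "ereal (-1) \<le> gamma_phi_s \<phi> s"
    unfolding gamma_phi_s_def by (rule Liminf_bounded[OF A])
  moreover have "gamma_phi_s \<phi> s \<le> 1"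
    unfolding gamma_phi_s_def
    using Liminf_le_Limsup[of at_top] Limsup_bounded[OF B] by (meson order_trans trivial_limit_at_top_linorder)
  ultimately show ?thesis
    by (cases "gamma_phi_s \<phi> s") (auto intro: that)
qed

theorem theorem2p2:
  fixes R0 :: real and \<phi> s :: "real \<Rightarrow> real"
    and q :: complex and n :: nat and a :: "nat \<Rightarrow> complex \<Rightarrow> complex"
    and f :: "complex \<Rightarrow> complex"
  assumes R0: "R0 > 0"
    \<comment> \<open>standing assumptions on phi\<close>
    and phi_pos: "\<forall>r>R0. \<phi> r > 0"
    and phi_mono: "mono_on {R0<..} \<phi>"
    and phi_unbdd: "filterlim \<phi> at_top at_top"
    and phi_bounds: "\<forall>r>R0. ln r \<le> \<phi> r \<and> \<phi> r \<le> r"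
    \<comment> \<open>standing assumptions on s\<close>
    and s_pos: "\<forall>r>R0. s r > 0"
    and s_mono: "mono_on {R0<..} s"
    and s_bounds: "\<forall>r>R0. r < s r \<and> s r \<le> r\<^sup>2"
    and s_liminf: "Liminf at_top (\<lambda>r. ereal (s r / r)) > 1"
    \<comment> \<open>hypotheses of the theorem\<close>
    and q: "q \<noteq> 0" "norm q \<noteq> 1"
    and a_mero: "\<forall>j\<le>n+1. a j nicely_meromorphic_on UNIV"
    and a_fin: "\<forall>j\<le>n+1. phi_order \<phi> (a j) < \<infinity>"
    and a_ord: "\<forall>j\<le>n+1. mero_order (a j) < 1"
    and a0an: "\<not> (\<forall>z. a 0 z * a n z = 0)"
    and s_convex: "convex_on {R0<..} s"
    and s_diff: "\<forall>r>R0. s differentiable (at r)"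
    and s_growth: "Limsup at_top (\<lambda>r. ereal (r\<^sup>2 * deriv s r / (s r)\<^sup>2)) < \<infinity>"
    and phi_subadd: "\<forall>x\<ge>R0. \<forall>y\<ge>R0. \<phi> (x + y) \<le> \<phi> x + \<phi> y"
    and phi_diff: "\<forall>r>R0. \<phi> differentiable (at r)"
    and lam_cond:
      "Limsup at_top (\<lambda>r. ereal (deriv \<phi> (s r) * deriv s r * r / \<phi> (s r)))
           < inverse (zero_exp_conv \<phi> (a 0))
       \<or> Liminf at_top (\<lambda>r. ereal (deriv \<phi> (s r) * deriv s r * r / \<phi> (s r)))
           \<ge> inverse (zero_exp_conv \<phi> (a 0))"
    and alpha_pos: "alpha_phi_s \<phi> s > 0"
    \<comment> \<open>f is a meromorphic solution\<close>
    and f_mero: "f nicely_meromorphic_on UNIV"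
    and f_std: "phi_order \<phi> f < \<infinity> \<longrightarrow> mero_order f < 1"
    and f_sol: "\<forall>\<^sub>\<approx>z. (\<Sum>j\<le>n. a j z * f (q ^ j * z)) = a (n+1) z"
  shows "((\<exists>j\<le>n+1. \<not> (\<exists>c. \<forall>z. a j z = c)) \<longrightarrow>
            phi_order \<phi> f \<le> (MAX j\<in>{0..n+1}. phi_order \<phi> (a j)) / (alpha_phi_s \<phi> s)\<^sup>2
                              - gamma_phi_s \<phi> s / alpha_phi_s \<phi> s + 2 * beta_phi \<phi>)
       \<and> ((\<forall>j\<le>n+1. \<exists>c. \<forall>z. a j z = c) \<longrightarrow> phi_order \<phi> f \<le> beta_phi \<phi>)"
proof -
  have \<phi>_ln: "\<forall>\<^sub>F r in at_top. ln r \<le> \<phi> r"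
    using eventually_gt_at_top[of R0] by eventually_elim (use phi_bounds in auto)
  have \<phi>_1: "\<forall>\<^sub>F r in at_top. 1 < \<phi> r"
    using phi_unbdd by (simp add: filterlim_at_top_dense)
  obtain w where w: "a 0 w \<noteq> 0" "a n w \<noteq> 0"
    using a0an by auto
  obtain \<beta> where \<beta>: "beta_phi \<phi> = ereal \<beta>" "0 \<le> \<beta>"
    using beta_phi_bounds[OF phi_unbdd \<phi>_ln] .
  \<comment> \<open>Both halves of the theorem are instances: \<Psi> is a power of \<phi> in the
    first and a constant in the second.\<close>
  have solution_bound: "\<exists>C. \<forall>\<^sub>F r in at_top. nev_T f r \<le> C * ln r * \<Psi> r"
    if "1 \<le> t0" "\<And>x y. t0 \<le> x \<Longrightarrow> x \<le> y \<Longrightarrow> \<Psi> x \<le> \<Psi> y" "\<And>x. t0 \<le> x \<Longrightarrow> 1 \<le> \<Psi> x"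
      "\<And>j t. j \<le> n + 1 \<Longrightarrow> t0 \<le> t \<Longrightarrow> nev_T (a j) t \<le> \<Psi> t" for t0 :: real and \<Psi> :: "real \<Rightarrow> real"
    using a_mero by (intro nev_T_q_difference_equation[OF q _ w f_mero f_sol that]) auto
  show ?thesis
  proof (intro conjI impI)
    assume nonconst: "\<exists>j\<le>n+1. \<not> (\<exists>c. \<forall>z. a j z = c)"
    define \<rho> where "\<rho> = (MAX j\<in>{0..n+1}. phi_order \<phi> (a j))"
    have \<rho>_ge: "phi_order \<phi> (a j) \<le> \<rho>" if "j \<le> n + 1" for j
      unfolding \<rho>_def using that by (intro Max_ge) auto
    have "\<rho> < \<infinity>"
      unfolding \<rho>_def using a_fin by (subst Max_less_iff) auto
    \<comment> \<open>A non-constant coefficient has unbounded characteristic, hence non-negative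
      order, and the maximum inherits this.\<close>
    moreover have "0 \<le> \<rho>"
      using nonconst \<rho>_ge phi_order_nonneg[OF phi_unbdd] a_mero by (meson order_trans)
    ultimately obtain \<rho>' where \<rho>': "\<rho> = ereal \<rho>'" "0 \<le> \<rho>'"
      by (cases \<rho>) auto
    have bound: "phi_order \<phi> f \<le> ereal (\<beta> + \<rho>' + e)" if e: "0 < e" for e
    proof -
      define \<sigma> where "\<sigma> = \<rho>' + e"
      have \<sigma>: "0 \<le> \<sigma>" using \<rho>' e by (simp add: \<sigma>_def)
      have "\<forall>\<^sub>F r in at_top. nev_T (a j) r \<le> \<phi> r powr \<sigma>" if j: "j \<le> n + 1" for j
      proof -
        have "phi_order \<phi> (a j) < ereal \<sigma>"
          using \<rho>_ge[OF j] \<rho>' e by (auto simp: \<sigma>_def intro: le_less_trans)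
        then have "\<forall>\<^sub>F r in at_top. ereal (ln (nev_T (a j) r) / ln (\<phi> r)) < ereal \<sigma>"
          unfolding phi_order_def phi_order_fun_def by (rule Limsup_lessD)
        then show ?thesis
          using \<phi>_1
        proof eventually_elim
          case (elim r)
          show ?case
          proof (cases "0 < nev_T (a j) r")
            case True
            have "ln (nev_T (a j) r) < \<sigma> * ln (\<phi> r)"
              using elim by (simp add: field_simps)
            then have "nev_T (a j) r < exp (\<sigma> * ln (\<phi> r))"
              using True by (metis exp_less_cancel_iff exp_ln)
            then show ?thesis using elim(2) by (simp add: powr_def)
          next
            \<comment> \<open>The logarithmic inequality says nothing about a non-positive
              characteristic, but a power of \<phi> majorises it anyway.\<close>
            case False
            then show ?thesis by (meson not_le order_trans powr_ge_zero less_imp_le)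
          qed
        qed
      qed
      then have "\<forall>\<^sub>F r in at_top. \<forall>j\<in>{..n+1}. nev_T (a j) r \<le> \<phi> r powr \<sigma>"
        by (intro eventually_ball_finite) auto
      then have "\<forall>\<^sub>F r in at_top. (\<forall>j\<in>{..n+1}. nev_T (a j) r \<le> \<phi> r powr \<sigma>) \<and> 1 < \<phi> r \<and> R0 < r \<and> 1 \<le> r"
        using \<phi>_1 eventually_gt_at_top[of R0] eventually_ge_at_top[of 1] by eventually_elim auto
      then obtain t0 where t0: "\<And>r. t0 \<le> r \<Longrightarrow>
          (\<forall>j\<in>{..n+1}. nev_T (a j) r \<le> \<phi> r powr \<sigma>) \<and> 1 < \<phi> r \<and> R0 < r \<and> 1 \<le> r"
        by (auto simp: eventually_at_top_linorder)
      have "\<exists>C. \<forall>\<^sub>F r in at_top. nev_T f r \<le> C * ln r * (\<phi> r powr \<sigma>)"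
      proof (rule solution_bound)
        show "1 \<le> t0" using t0[of t0] by simp
        show "\<phi> x powr \<sigma> \<le> \<phi> y powr \<sigma>" if "t0 \<le> x" "x \<le> y" for x y
        proof -
          have "\<phi> x \<le> \<phi> y"
            using t0[of x] t0[of y] that by (intro mono_onD[OF phi_mono]) auto
          then show ?thesis using t0[of x] that \<sigma> by (intro powr_mono2) auto
        qed
        show "1 \<le> \<phi> x powr \<sigma>" if "t0 \<le> x" for x
          using t0[OF that] \<sigma> by (intro ge_one_powr_ge_zero) auto
      qed (use t0 in auto)
      then obtain C where "\<forall>\<^sub>F r in at_top. nev_T f r \<le> C * ln r * \<phi> r powr \<sigma>"
        by blast
      from phi_order_le[OF phi_unbdd \<phi>_ln f_mero \<sigma> this] show ?thesis
        by (simp add: \<beta> \<sigma>_def add.assoc)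
    qed
    have "phi_order \<phi> f \<le> ereal (\<beta> + \<rho>')"
      by (rule ereal_le_epsilon2) (use bound in auto)
    moreover obtain \<alpha> where \<alpha>: "alpha_phi_s \<phi> s = ereal \<alpha>" "0 < \<alpha>" "\<alpha> \<le> 1"
      using alpha_pos alpha_le_1[OF phi_unbdd phi_mono s_bounds] by (cases "alpha_phi_s \<phi> s") auto
    obtain \<gamma> where \<gamma>: "gamma_phi_s \<phi> s = ereal \<gamma>"
      using gamma_bounds[OF phi_unbdd \<phi>_ln s_bounds s_liminf] .
    have "\<gamma> \<le> \<alpha> * \<beta>"
      using gamma_le_alpha_beta[OF phi_unbdd s_bounds \<alpha>(1) _ \<beta> \<gamma>] \<alpha> by simp
    then have "\<gamma> / \<alpha> \<le> \<beta>"
      using \<alpha> by (simp add: field_simps)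
    \<comment> \<open>The sign of \<open>\<rho>'\<close> matters here: division by \<alpha>^2 \<le>
      1 enlarges only non-negative numbers.\<close>
    moreover have "\<rho>' \<le> \<rho>' / \<alpha>\<^sup>2"
      using \<rho>' \<alpha> by (simp add: pos_le_divide_eq mult_left_le power_le_one)
    ultimately have "phi_order \<phi> f \<le> ereal (\<rho>' / \<alpha>\<^sup>2 - \<gamma> / \<alpha> + 2 * \<beta>)"
      by (elim order_trans) simp
    also have "\<dots> = \<rho> / (alpha_phi_s \<phi> s)\<^sup>2 - gamma_phi_s \<phi> s / alpha_phi_s \<phi> s + 2 * beta_phi \<phi>"
      using \<alpha> by (simp add: \<rho>' \<gamma> \<beta> power2_eq_square)
    finally show "phi_order \<phi> f \<le> (MAX j\<in>{0..n+1}. phi_order \<phi> (a j)) / (alpha_phi_s \<phi> s)\<^sup>2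
                              - gamma_phi_s \<phi> s / alpha_phi_s \<phi> s + 2 * beta_phi \<phi>"
      unfolding \<rho>_def .
  next
    assume const: "\<forall>j\<le>n+1. \<exists>c. \<forall>z. a j z = c"
    \<comment> \<open>The summand 1 ensures the lower bound 1 that is required of \<Psi>.\<close>
    define M where "M = 1 + (\<Sum>j\<le>n+1. ln_plus (norm (a j 0)))"
    have "nev_T (a j) t \<le> M" if j: "j \<le> n + 1" for j t
    proof -
      have "nev_T (a j) t = ln_plus (norm (a j 0))"
        using const j by (intro nev_T_const) metis
      also have "\<dots> \<le> (\<Sum>j\<le>n+1. ln_plus (norm (a j 0)))"
        using j by (intro member_le_sum) auto
      finally show ?thesis by (simp add: M_def)
    qed
    moreover have M: "1 \<le> M"
      by (simp add: M_def sum_nonneg)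
    ultimately have "\<exists>C. \<forall>\<^sub>F r in at_top. nev_T f r \<le> C * ln r * M"
      by (intro solution_bound[of 1 "\<lambda>_. M"]) auto
    then obtain C where "\<forall>\<^sub>F r in at_top. nev_T f r \<le> C * ln r * M"
      by blast
    \<comment> \<open>The constant majorant is read as exponent 0, so that only \<beta>
      remains.\<close>
    then have "\<forall>\<^sub>F r in at_top. nev_T f r \<le> (C * M) * ln r * \<phi> r powr 0"
      using \<phi>_1 by eventually_elim (simp add: mult_ac)
    from phi_order_le[OF phi_unbdd \<phi>_ln f_mero order_refl this] show "phi_order \<phi> f \<le> beta_phi \<phi>"
      by (simp add: zero_ereal_def[symmetric])
  qed
qed

end
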